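(* Let $\mathbf{p}_1,\ldots,\mathbf{p}_d\in\Pi^n_o$, put $P=(\mathbf{p}_1,\ldots,\mathbf{p}_d)$, and let $\mathcal{C}\in\otimes^d\mathbb{R}^n$ be given. Denote by $\omega$ the difference between the maximum and the minimum entry of $\mathcal{C}$. Then for a given $\delta>0$ one can find $\mathcal{B}\in \mathrm{U}(P)$ in $O\left(\frac{\omega^3 d^4 n^{d+1}\log n}{\delta^3}\right)$ operations such that $$\langle \mathcal{C},\mathcal{B}\rangle\le \tau(\mathcal{C},P)+\delta .$$
   Context: $[n]=\{1,\ldots,n\}$. $\otimes^d\mathbb{R}^n$ is the space of real $d$-mode tensors $\mathcal{U}=[u_{i_1,\ldots,i_d}]$, $i_1,\ldots,i_d\in[n]$, and $\otimes^d\mathbb{R}^n_+$ is the set of those with nonnegative entries; $\langle\mathcal{C},\mathcal{U}\rangle=\sum_{i_1,\ldots,i_d\in[n]}c_{i_1,\ldots,i_d}u_{i_1,\ldots,i_d}$. $\Pi^n\subset\mathbb{R}^n$ is the simplex of probability vectors and $\Pi^n_o$ the set of probability vectors with all coordinates positive. For $j\in[d]$ the $j$-th marginal of $\mathcal{U}$ is $\mathbf{s}_j(\mathcal{U})=(s_{1,j}(\mathcal{U}),\ldots,s_{n,j}(\mathcal{U}))$, where $s_{i_j,j}(\mathcal{U})=\sum_{i_k\in[n],\,k\ne j}u_{i_1,\ldots,i_d}$. For $P=(\mathbf{p}_1,\ldots,\mathbf{p}_d)$, $\mathrm{U}(P)=\{\mathcal{U}\in\otimes^d\mathbb{R}^n_+:\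 \mathbf{s}_j(\mathcal{U})=\mathbf{p}_j,\ j\in[d]\}$. The tensor optimal transport (TOT) value is $\tau(\mathcal{C},P)=\min\{\langle\mathcal{C},\mathcal{U}\rangle:\ \mathcal{U}\in\mathrm{U}(P)\}$. "Operations" are elementary real operations (arithmetic operations, comparisons, and evaluations of $\exp$ and $\log$).
   Formalization: The operation bound is taken as O(ω³d⁴n^{d+1} log n/δ³ + n^d + dn): the stated bound is 0 when ω = 0 and tends to 0 for large δ, where finding an element of U(P) still takes operations; for n ≥ 2 and δ ≤ ω the added terms are absorbed. *)

theory Defs
  imports "HOL-Analysis.Analysis"
begin

section \<open>Tensors and tensor optimal transport\<close>

text \<open>
  Coordinates and modes are numbered from 0: \<open>[n]\<close> is \<open>{..<n}\<close> and \<open>[d]\<close> is \<open>{..<d}\<close>.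
  A tensor is a function on multi-indices of which only the values on \<open>multi_indices n d\<close>
  matter; likewise \<open>P j k\<close> is coordinate \<open>k < n\<close> of the vector \<open>p_j\<close>, \<open>j < d\<close>.
\<close>

type_synonym tensor = "(nat \<Rightarrow> nat) \<Rightarrow> real"

definition multi_indices :: "nat \<Rightarrow> nat \<Rightarrow> (nat \<Rightarrow> nat) set" where
  "multi_indices n d = ({..<d} \<rightarrow>\<^sub>E {..<n})"

definition tensor_inner :: "nat \<Rightarrow> nat \<Rightarrow> tensor \<Rightarrow> tensor \<Rightarrow> real" where
  "tensor_inner n d C U = (\<Sum>i\<in>multi_indices n d. C i * U i)"

definition marginal :: "nat \<Rightarrow> nat \<Rightarrow> tensor \<Rightarrow> nat \<Rightarrow> nat \<Rightarrow> real" where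
  "marginal n d U j k = (\<Sum>i | i \<in> multi_indices n d \<and> i j = k. U i)"

definition positive_prob_vectors :: "nat \<Rightarrow> (nat \<Rightarrow> real) set" where
  "positive_prob_vectors n = {p. (\<forall>k<n. 0 < p k) \<and> (\<Sum>k<n. p k) = 1}"

definition transport_polytope :: "nat \<Rightarrow> nat \<Rightarrow> (nat \<Rightarrow> nat \<Rightarrow> real) \<Rightarrow> tensor set" where
  "transport_polytope n d P =
     {U. (\<forall>i\<in>multi_indices n d. 0 \<le> U i) \<and> (\<forall>j<d. \<forall>k<n. marginal n d U j k = P j k)}"

text \<open>
  \<open>LEAST\<close> on the reals denotes the minimum of a set provided it exists; that it does is
  \<open>tot_value_attained\<close> below.
\<close>

definition tot_value :: "nat \<Rightarrow> nat \<Rightarrow> tensor \<Rightarrow> (nat \<Rightarrow> nat \<Rightarrow> real) \<Rightarrow> real" where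
  "tot_value n d C P = (LEAST v. v \<in> tensor_inner n d C ` transport_polytope n d P)"

definition entry_range :: "nat \<Rightarrow> nat \<Rightarrow> tensor \<Rightarrow> real" where
  "entry_range n d C = Max (C ` multi_indices n d) - Min (C ` multi_indices n d)"

section \<open>A real-number machine with operation counts\<close>

text \<open>
  One program treats all \<open>n\<close> and \<open>d\<close>. The store consists of arrays of reals. Addresses and
  the bounds of \<open>For\<close> loops are index expressions over \<open>n\<close>, \<open>d\<close> and the counters of the
  enclosing \<open>For\<close> loops. These counters are lexically scoped and cannot be assigned, so index
  values never depend on real data: all information about the real input flows through
  real operations, and these are exactly what is counted. Index computations, copying of reals
  and loading an index value as a real constant are free; no other real constants exist.
\<close>

datatype iexp =
    INum nat | IVar string
  | IAdd iexp iexp | ISub iexp iexp | IMul iexp iexp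
  | IDiv iexp iexp | IMod iexp iexp | IPow iexp iexp

datatype rexp =
    Cell string iexp
  | OfIndex iexp
  | Add rexp rexp | Sub rexp rexp | Mul rexp rexp | Divide rexp rexp
  | Exp rexp | Log rexp

datatype com =
    Skip
  | Assign string iexp rexp
  | Seq com com
  | IfLess rexp rexp com com
  | WhileLess rexp rexp com
  | For string iexp com

type_synonym ienv = "string \<Rightarrow> nat"
type_synonym store = "string \<Rightarrow> nat \<Rightarrow> real"

fun ival :: "ienv \<Rightarrow> iexp \<Rightarrow> nat" where
  "ival E (INum k) = k"
| "ival E (IVar x) = E x"
| "ival E (IAdd a b) = ival E a + ival E b"
| "ival E (ISub a b) = ival E a - ival E b"
| "ival E (IMul a b) = ival E a * ival E b"
| "ival E (IDiv a b) = ival E a div ival E b"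
| "ival E (IMod a b) = ival E a mod ival E b"
| "ival E (IPow a b) = ival E a ^ ival E b"

fun rval :: "ienv \<Rightarrow> store \<Rightarrow> rexp \<Rightarrow> real" where
  "rval E s (Cell a x) = s a (ival E x)"
| "rval E s (OfIndex x) = real (ival E x)"
| "rval E s (Add a b) = rval E s a + rval E s b"
| "rval E s (Sub a b) = rval E s a - rval E s b"
| "rval E s (Mul a b) = rval E s a * rval E s b"
| "rval E s (Divide a b) = rval E s a / rval E s b"
| "rval E s (Exp a) = exp (rval E s a)"
| "rval E s (Log a) = ln (rval E s a)"

text \<open>Division by 0 and logarithms of nonpositive numbers are errors that block execution.\<close>

fun rdefined :: "ienv \<Rightarrow> store \<Rightarrow> rexp \<Rightarrow> bool" where
  "rdefined E s (Cell a x) = True"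
| "rdefined E s (OfIndex x) = True"
| "rdefined E s (Add a b) = (rdefined E s a \<and> rdefined E s b)"
| "rdefined E s (Sub a b) = (rdefined E s a \<and> rdefined E s b)"
| "rdefined E s (Mul a b) = (rdefined E s a \<and> rdefined E s b)"
| "rdefined E s (Divide a b) = (rdefined E s a \<and> rdefined E s b \<and> rval E s b \<noteq> 0)"
| "rdefined E s (Exp a) = rdefined E s a"
| "rdefined E s (Log a) = (rdefined E s a \<and> 0 < rval E s a)"

fun rcost :: "rexp \<Rightarrow> nat" where
  "rcost (Cell a x) = 0"
| "rcost (OfIndex x) = 0"
| "rcost (Add a b) = Suc (rcost a + rcost b)"
| "rcost (Sub a b) = Suc (rcost a + rcost b)"
| "rcost (Mul a b) = Suc (rcost a + rcost b)"
| "rcost (Divide a b) = Suc (rcost a + rcost b)"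
| "rcost (Exp a) = Suc (rcost a)"
| "rcost (Log a) = Suc (rcost a)"

text \<open>
  \<open>exec E c s t s'\<close>: in index environment \<open>E\<close>, the program \<open>c\<close> started in store \<open>s\<close> halts
  without error in store \<open>s'\<close> after exactly \<open>t\<close> real operations. In a \<open>For\<close> loop, \<open>S i\<close> is
  the store before the iteration with counter \<open>i\<close>, and \<open>T i\<close> is the cost of that iteration.
\<close>

inductive exec :: "ienv \<Rightarrow> com \<Rightarrow> store \<Rightarrow> nat \<Rightarrow> store \<Rightarrow> bool" where
  Skip: "exec E Skip s 0 s"
| Assign: "rdefined E s e \<Longrightarrow>
    exec E (Assign a x e) s (rcost e) (s(a := (s a)(ival E x := rval E s e)))"
| Seq: "exec E c1 s1 t1 s2 \<Longrightarrow> exec E c2 s2 t2 s3 \<Longrightarrow> exec E (Seq c1 c2) s1 (t1 + t2) s3"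
| IfTrue: "rdefined E s a \<Longrightarrow> rdefined E s b \<Longrightarrow> rval E s a < rval E s b \<Longrightarrow> exec E c1 s t s' \<Longrightarrow>
    exec E (IfLess a b c1 c2) s (Suc (rcost a + rcost b) + t) s'"
| IfFalse: "rdefined E s a \<Longrightarrow> rdefined E s b \<Longrightarrow> \<not> rval E s a < rval E s b \<Longrightarrow> exec E c2 s t s' \<Longrightarrow>
    exec E (IfLess a b c1 c2) s (Suc (rcost a + rcost b) + t) s'"
| WhileFalse: "rdefined E s a \<Longrightarrow> rdefined E s b \<Longrightarrow> \<not> rval E s a < rval E s b \<Longrightarrow>
    exec E (WhileLess a b c) s (Suc (rcost a + rcost b)) s"
| WhileTrue: "rdefined E s1 a \<Longrightarrow> rdefined E s1 b \<Longrightarrow> rval E s1 a < rval E s1 b \<Longrightarrow>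
    exec E c s1 t1 s2 \<Longrightarrow> exec E (WhileLess a b c) s2 t2 s3 \<Longrightarrow>
    exec E (WhileLess a b c) s1 (Suc (rcost a + rcost b) + t1 + t2) s3"
| For: "(\<And>i. i < ival E x \<Longrightarrow> exec (E(v := i)) c (S i) (T i) (S (Suc i))) \<Longrightarrow>
    exec E (For v x c) (S 0) (\<Sum>i<ival E x. T i) (S (ival E x))"

text \<open>
  Tensors are stored flat: the entry with multi-index \<open>i\<close> is at the address whose base-\<open>n\<close>
  digits are \<open>i 0, i 1, \<dots>\<close>, least significant first. The contents of cells not mentioned in
  \<open>holds_input\<close> are arbitrary.
\<close>

definition address :: "nat \<Rightarrow> nat \<Rightarrow> (nat \<Rightarrow> nat) \<Rightarrow> nat" where
  "address n d i = (\<Sum>j<d. i j * n ^ j)"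

definition stored_tensor :: "nat \<Rightarrow> nat \<Rightarrow> store \<Rightarrow> string \<Rightarrow> tensor" where
  "stored_tensor n d s a = (\<lambda>i. s a (address n d i))"

definition size_env :: "nat \<Rightarrow> nat \<Rightarrow> ienv" where
  "size_env n d = (\<lambda>_. 0)(''n'' := n, ''d'' := d)"

definition holds_input ::
  "nat \<Rightarrow> nat \<Rightarrow> (nat \<Rightarrow> nat \<Rightarrow> real) \<Rightarrow> tensor \<Rightarrow> real \<Rightarrow> store \<Rightarrow> bool" where
  "holds_input n d P C \<delta> s \<longleftrightarrow>
     (\<forall>i\<in>multi_indices n d. stored_tensor n d s ''C'' i = C i) \<and>
     (\<forall>j<d. \<forall>k<n. s ''P'' (j * n + k) = P j k) \<and>
     s ''delta'' 0 = \<delta>"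

section \<open>The operation bound\<close>

definition bound_term :: "nat \<Rightarrow> nat \<Rightarrow> real \<Rightarrow> real \<Rightarrow> real" where
  "bound_term n d \<omega> \<delta> = \<omega> ^ 3 * real d ^ 4 * real n ^ (d + 1) * ln (real n) / \<delta> ^ 3"

text \<open>
  \<open>bound_term\<close> vanishes for \<open>n = 1\<close> or \<open>\<omega> = 0\<close> and tends to 0 for large \<open>\<delta>\<close>, where no algorithm
  can meet it literally: even an arbitrary element of the polytope takes operations to compute.
  As usual for running times, the bound is therefore read as including the number of input
  entries. In the regime \<open>n \<ge> 2\<close>, \<open>\<delta> \<le> \<omega>\<close> this number is itself \<open>O(bound_term)\<close>, see
  \<open>input_size_le_bound_term\<close>.
\<close>

definition input_size :: "nat \<Rightarrow> nat \<Rightarrow> nat" where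
  "input_size n d = n ^ d + d * n"

lemma input_size_le_bound_term:
  assumes "2 \<le> n" "1 \<le> d" "0 < \<delta>" "\<delta> \<le> \<omega>"
  shows "real (input_size n d) \<le> (2 / ln 2) * bound_term n d \<omega> \<delta>"
proof -
  have "1 * 1 \<le> d ^ 4 * n" "d * 1 \<le> d ^ 4 * n ^ d"
    using assms by (intro mult_mono; simp add: self_le_power)+
  then have "1 * n ^ d \<le> (d ^ 4 * n) * n ^ d" "d * n \<le> (d ^ 4 * n ^ d) * n"
    by (intro mult_right_mono; simp)+
  then have "n ^ d \<le> d ^ 4 * n ^ (d + 1)" "d * n \<le> d ^ 4 * n ^ (d + 1)"
    by (simp_all only: mult_1 power_add power_one_right mult.assoc mult.commute mult.left_commute)
  then have "input_size n d \<le> 2 * (d ^ 4 * n ^ (d + 1))"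
    unfolding input_size_def by linarith
  then have "real (input_size n d) \<le> real (2 * (d ^ 4 * n ^ (d + 1)))"
    by (rule of_nat_mono)
  then have 1: "real (input_size n d) \<le> 2 * (real d ^ 4 * real n ^ (d + 1))"
    by simp
  have 2: "1 \<le> \<omega> ^ 3 / \<delta> ^ 3" using assms by (simp add: power_mono)
  have 3: "1 \<le> ln (real n) / ln 2" using assms by simp
  have "1 * 1 \<le> (\<omega> ^ 3 / \<delta> ^ 3) * (ln (real n) / ln 2)"
    using 2 3 by (intro mult_mono) auto
  then have "(2 * (real d ^ 4 * real n ^ (d + 1))) * 1 \<le>
      (2 * (real d ^ 4 * real n ^ (d + 1))) * ((\<omega> ^ 3 / \<delta> ^ 3) * (ln (real n) / ln 2))"
    by (intro mult_left_mono) auto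
  with 1 show ?thesis by (simp add: bound_term_def algebra_simps)
qed

section \<open>The minimum defining \<open>tot_value\<close> exists\<close>

lemma finite_multi_indices [simp]: "finite (multi_indices n d)"
  by (simp add: multi_indices_def finite_PiE)

lemma product_tensor_marginal:
  assumes "\<And>l. l < d \<Longrightarrow> (\<Sum>k<n. P l k) = 1" "j < d" "k < n"
  shows "marginal n d (\<lambda>i. \<Prod>l<d. P l (i l)) j k = P j k"
proof -
  let ?f = "\<lambda>l m. if l = j \<and> m \<noteq> k then 0 else P l m"
  have "marginal n d (\<lambda>i. \<Prod>l<d. P l (i l)) j k
      = (\<Sum>i\<in>multi_indices n d. if i j = k then \<Prod>l<d. P l (i l) else 0)"
    unfolding marginal_def by (simp add: sum.inter_filter)
  also have "\<dots> = (\<Sum>i\<in>multi_indices n d. \<Prod>l<d. ?f l (i l))"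
  proof (intro sum.cong refl)
    fix i
    show "(if i j = k then \<Prod>l<d. P l (i l) else 0) = (\<Prod>l<d. ?f l (i l))"
    proof (cases "i j = k")
      case True
      then show ?thesis by (auto intro!: prod.cong)
    next
      case False
      then have "(\<Prod>l<d. ?f l (i l)) = 0" using assms(2) by (intro prod_zero) auto
      then show ?thesis using False by simp
    qed
  qed
  also have "\<dots> = (\<Prod>l<d. \<Sum>m<n. ?f l m)"
    unfolding multi_indices_def by (subst prod_sum_PiE) auto
  also have "\<dots> = (\<Prod>l<d. if l = j then P j k else 1)"
  proof (intro prod.cong refl)
    fix l assume l: "l \<in> {..<d}"
    show "(\<Sum>m<n. ?f l m) = (if l = j then P j k else 1)"
    proof (cases "l = j")
      case True
      then have "(\<Sum>m<n. ?f l m) = (\<Sum>m<n. if k = m then P j m else 0)"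
        by (intro sum.cong) auto
      then show ?thesis using assms(3) True by simp
    qed (use assms(1) l in auto)
  qed
  also have "\<dots> = P j k" using assms(2) by simp
  finally show ?thesis .
qed

lemma transport_polytope_nonempty:
  assumes "\<And>j. j < d \<Longrightarrow> P j \<in> positive_prob_vectors n"
  shows "(\<lambda>i. \<Prod>l<d. P l (i l)) \<in> transport_polytope n d P"
  using assms product_tensor_marginal[of d P n]
  by (auto simp: transport_polytope_def positive_prob_vectors_def multi_indices_def PiE_iff
        intro!: prod_nonneg prod_pos less_imp_le)

lemma transport_polytope_entry_le_1:
  assumes "1 \<le> d" "\<And>j. j < d \<Longrightarrow> P j \<in> positive_prob_vectors n"
    and U: "U \<in> transport_polytope n d P" and i: "i \<in> multi_indices n d"
  shows "U i \<le> 1"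
proof -
  have i0: "i 0 < n" using i assms(1) by (auto simp: multi_indices_def PiE_iff)
  have "U i \<le> marginal n d U 0 (i 0)"
    unfolding marginal_def using U i
    by (intro member_le_sum) (auto simp: transport_polytope_def)
  also have "\<dots> = P 0 (i 0)" using U assms(1) i0 by (auto simp: transport_polytope_def)
  also have "\<dots> \<le> (\<Sum>k<n. P 0 k)"
    using assms(1) assms(2)[of 0] i0
    by (intro member_le_sum) (auto simp: positive_prob_vectors_def intro: less_imp_le)
  also have "\<dots> = 1" using assms(1) assms(2)[of 0] by (simp add: positive_prob_vectors_def)
  finally show ?thesis .
qed

lemma tot_minimum_exists:
  assumes d: "1 \<le> d" and P: "\<And>j. j < d \<Longrightarrow> P j \<in> positive_prob_vectors n"
  shows "\<exists>U\<in>transport_polytope n d P. \<forall>V\<in>transport_polytope n d P.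
           tensor_inner n d C U \<le> tensor_inner n d C V"
proof -
  let ?I = "multi_indices n d" and ?U = "transport_polytope n d P"
  let ?B = "PiE UNIV (\<lambda>i. if i \<in> ?I then {0..1::real} else {0})"
  let ?r = "\<lambda>V i. if i \<in> ?I then V i else (0::real)"
  let ?M = "{V. \<forall>j<d. \<forall>k<n. marginal n d V j k = P j k}"
  have B: "compact ?B"
  proof -
    have "compactin (product_topology (\<lambda>_. euclidean) UNIV) ?B"
      by (subst compactin_PiE) auto
    then show ?thesis by (simp add: euclidean_product_topology)
  qed
  have cont: "continuous_on UNIV (\<lambda>V::tensor. \<Sum>i\<in>A. c i * V i)" for A and c :: tensor
    by (intro continuous_on_sum continuous_on_mult continuous_on_const
        continuous_on_product_coordinates)
  have "continuous_on UNIV (\<lambda>V. marginal n d V j k)" for j k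
    using cont[of "\<lambda>_. 1"] unfolding marginal_def by simp
  then have "closed {V. marginal n d V j k = P j k}" for j k
    by (intro closed_Collect_eq continuous_on_const)
  then have M: "closed ?M"
    by (intro closed_Collect_all closed_Collect_imp) auto
  have r: "?r V \<in> ?B \<inter> ?M" and r_inner: "tensor_inner n d C (?r V) = tensor_inner n d C V"
    if V: "V \<in> ?U" for V
  proof -
    have "marginal n d (?r V) j k = marginal n d V j k" for j k
      unfolding marginal_def by (intro sum.cong) auto
    then show "?r V \<in> ?B \<inter> ?M"
      using V transport_polytope_entry_le_1[OF d P V] by (auto simp: transport_polytope_def)
    show "tensor_inner n d C (?r V) = tensor_inner n d C V"
      unfolding tensor_inner_def by (intro sum.cong) auto
  qed
  have BU: "?B \<inter> ?M \<subseteq> ?U"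
  proof
    fix V assume V: "V \<in> ?B \<inter> ?M"
    then have "V i \<in> (if i \<in> ?I then {0..1} else {0})" for i by blast
    then have "0 \<le> V i" if "i \<in> ?I" for i using that by (metis atLeastAtMost_iff)
    then show "V \<in> ?U" using V by (auto simp: transport_polytope_def)
  qed
  have cpt: "compact (?B \<inter> ?M)" using B M by (rule compact_Int_closed)
  have ne: "?B \<inter> ?M \<noteq> {}" using r[OF transport_polytope_nonempty[OF P]] by blast
  have co: "continuous_on (?B \<inter> ?M) (tensor_inner n d C)"
    using cont[of C ?I] unfolding tensor_inner_def
    by (auto intro: continuous_on_subset)
  obtain U where U: "U \<in> ?B \<inter> ?M"
    and min: "\<forall>V\<in>?B \<inter> ?M. tensor_inner n d C U \<le> tensor_inner n d C V"
    by (rule bexE[OF continuous_attains_inf[OF cpt ne co]])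
  have "tensor_inner n d C U \<le> tensor_inner n d C V" if "V \<in> ?U" for V
    using bspec[OF min r[OF that]] unfolding r_inner[OF that] .
  with subsetD[OF BU U] show ?thesis by (intro bexI ballI)
qed

lemma tot_value_attained:
  assumes "1 \<le> d" "\<And>j. j < d \<Longrightarrow> P j \<in> positive_prob_vectors n"
  shows "tot_value n d C P \<in> tensor_inner n d C ` transport_polytope n d P"
    and "\<And>U. U \<in> transport_polytope n d P \<Longrightarrow> tot_value n d C P \<le> tensor_inner n d C U"
proof -
  obtain U where U: "U \<in> transport_polytope n d P"
    and min: "\<forall>V\<in>transport_polytope n d P. tensor_inner n d C U \<le> tensor_inner n d C V"
    using tot_minimum_exists[of d P n C] assms by blast
  have "tot_value n d C P = tensor_inner n d C U"
    unfolding tot_value_def using U min by (intro Least_equality) auto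
  then show "tot_value n d C P \<in> tensor_inner n d C ` transport_polytope n d P"
    and "\<And>U. U \<in> transport_polytope n d P \<Longrightarrow> tot_value n d C P \<le> tensor_inner n d C U"
    using U min by auto
qed

section \<open>Execution is deterministic\<close>

inductive_cases exec_SkipE: "exec E Skip s t s'"
inductive_cases exec_AssignE: "exec E (Assign a x e) s t s'"
inductive_cases exec_SeqE: "exec E (Seq c1 c2) s t s'"
inductive_cases exec_IfE: "exec E (IfLess a b c1 c2) s t s'"
inductive_cases exec_WhileE: "exec E (WhileLess a b c) s t s'"
inductive_cases exec_ForE: "exec E (For v x c) s t s'"

lemma exec_deterministic:
  "exec E c s t s' \<Longrightarrow> exec E c s u s'' \<Longrightarrow> u = t \<and> s'' = s'"
proof (induction arbitrary: u s'' rule: exec.induct)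
  case (Skip E s)
  then show ?case by (auto elim: exec_SkipE)
next
  case (Assign E s e a x)
  from Assign.prems show ?case by (auto elim: exec_AssignE)
next
  case (Seq E c1 s1 t1 s2 c2 t2 s3)
  from Seq.prems show ?case by (rule exec_SeqE) (use Seq.IH in blast)
next
  case (IfTrue E s a b c1 t s' c2)
  from IfTrue.prems show ?case by (rule exec_IfE) (use IfTrue.hyps in \<open>auto dest: IfTrue.IH\<close>)
next
  case (IfFalse E s a b c2 t s' c1)
  from IfFalse.prems show ?case by (rule exec_IfE) (use IfFalse.hyps in \<open>auto dest: IfFalse.IH\<close>)
next
  case (WhileFalse E s a b c)
  from WhileFalse.prems show ?case by (rule exec_WhileE) (use WhileFalse.hyps in auto)
next
  case (WhileTrue E s1 a b c t1 s2 t2 s3)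
  from WhileTrue.prems show ?case
    by (rule exec_WhileE) (use WhileTrue.hyps in \<open>auto dest!: WhileTrue.IH(1) dest: WhileTrue.IH(2)\<close>)
next
  case (For E x v c S T)
  from For.prems obtain S' T' where eq: "S' 0 = S 0" "u = (\<Sum>i<ival E x. T' i)" "s'' = S' (ival E x)"
    and step: "\<And>i. i < ival E x \<Longrightarrow> exec (E(v := i)) c (S' i) (T' i) (S' (Suc i))"
    by (rule exec_ForE) metis
  have S: "S' i = S i" if "i \<le> ival E x" for i
    using that
  proof (induction i)
    case 0
    then show ?case using eq by simp
  next
    case (Suc i)
    then have "exec (E(v := i)) c (S i) (T' i) (S' (Suc i))" using step[of i] by simp
    with For.IH[of i] Suc.prems show ?case by (metis Suc_le_eq)
  qed
  have "T' i = T i" if "i < ival E x" for i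
    using For.IH[of i] step[of i] S[of i] that by (metis less_imp_le)
  then show ?case using eq S by simp
qed

end

theory Submission
  imports Defs
begin

text \<open>
  Let \<open>\<omega>\<close> be the range of the entries of \<open>C\<close>. If \<open>\<delta> \<ge> \<omega>\<close>, the product tensor is good enough; it is
  built mode by mode, so that its cost is a geometric sum. Otherwise start from the Gibbs kernel
  \<open>exp (- \<eta> C) / Z\<close> with \<open>\<eta> = 2 d ln n / \<delta>\<close> and rescale modes as in the algorithm of Sinkhorn as
  long as the \<open>j\<close>-th marginal of the current tensor \<open>B\<close> has distance more than
  \<open>\<epsilon> = \<delta> / (8 d \<omega>)\<close> from \<open>p\<^sub>j\<close> for some \<open>j\<close>.

  For a fixed \<open>U\<close> in the polytope, rescaling mode \<open>j\<close> increases \<open>\<Sum> U ln B\<close> by the relative entropy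
  of \<open>p\<^sub>j\<close> with respect to the \<open>j\<close>-th marginal, hence by at least \<open>\<epsilon>\<^sup>2 / 4\<close>. This sum is never
  positive because \<open>B\<close> has total mass 1, and it is at least \<open>- (\<eta> \<omega> + d ln n)\<close> initially. So
  \<open>O (d\<^sup>3 \<omega>\<^sup>3 ln n / \<delta>\<^sup>3)\<close> sweeps of cost \<open>O (d n\<^sup>d)\<close> suffice, whatever the size of the smallest
  coordinate of the \<open>p\<^sub>j\<close>.

  The final \<open>B\<close> is optimal up to \<open>d ln n / \<eta> = \<delta> / 2\<close> among the tensors with its own marginals.
  Rounding it to the marginals \<open>P\<close>, and in the proof an optimal tensor to the marginals of \<open>B\<close>,
  costs \<open>2 d \<epsilon> \<omega> = \<delta> / 4\<close> each.
\<close>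

section \<open>Marginals\<close>

lemma multi_indices_less: "i \<in> multi_indices n d \<Longrightarrow> j < d \<Longrightarrow> i j < n"
  by (auto simp: multi_indices_def PiE_iff)

lemma card_multi_indices: "card (multi_indices n d) = n ^ d"
  by (simp add: multi_indices_def card_PiE)

lemma multi_indices_nonempty: "1 \<le> n \<Longrightarrow> multi_indices n d \<noteq> {}"
  using card_multi_indices[of n d] by force

text \<open>Grouping the multi-indices by their \<open>j\<close>-th coordinate: a weight that
  depends on one coordinate sees only the marginal of that mode. The weights used later are
  constants (total mass), quotients (rescaling) and logarithms (potential).\<close>

lemma sum_mode:
  assumes "j < d"
  shows "(\<Sum>i\<in>multi_indices n d. U i * f (i j)) = (\<Sum>k<n. f k * marginal n d U j k)"
proof -
  have "(\<Sum>k<n. f k * marginal n d U j k) =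
      (\<Sum>k<n. \<Sum>i | i \<in> multi_indices n d \<and> i j = k. U i * f (i j))"
    unfolding marginal_def sum_distrib_left by (intro sum.cong) auto
  also have "\<dots> = (\<Sum>i\<in>multi_indices n d. U i * f (i j))"
    using multi_indices_less[OF _ assms] by (intro sum.group) auto
  finally show ?thesis ..
qed

lemma sum_marginal:
  assumes "j < d"
  shows "(\<Sum>k<n. marginal n d U j k) = (\<Sum>i\<in>multi_indices n d. U i)"
  using sum_mode[OF assms, where U = U and f = "\<lambda>_. 1"] by simp

lemma marginal_cong:
  assumes "\<And>i. i \<in> multi_indices n d \<Longrightarrow> U i = V i"
  shows "marginal n d U = marginal n d V"
  unfolding marginal_def by (intro ext sum.cong) (use assms in auto)

lemma marginal_mono:
  assumes "\<And>i. i \<in> multi_indices n d \<Longrightarrow> U i \<le> V i"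
  shows "marginal n d U j k \<le> marginal n d V j k"
  unfolding marginal_def by (intro sum_mono) (use assms in auto)

lemma marginal_nonneg:
  assumes "\<And>i. i \<in> multi_indices n d \<Longrightarrow> 0 \<le> U i"
  shows "0 \<le> marginal n d U j k"
  unfolding marginal_def by (intro sum_nonneg) (use assms in auto)

lemma marginal_linear:
  "marginal n d (\<lambda>i. U i + c * V i) j k = marginal n d U j k + c * marginal n d V j k"
  unfolding marginal_def by (simp add: sum.distrib sum_distrib_left)

lemma marginal_diff:
  "marginal n d (\<lambda>i. U i - V i) j k = marginal n d U j k - marginal n d V j k"
  unfolding marginal_def by (simp add: sum_subtractf)

lemma marginal_pos:
  assumes "\<And>i. i \<in> multi_indices n d \<Longrightarrow> 0 < U i" "j < d" "k < n"
  shows "0 < marginal n d U j k"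
proof -
  \<comment> \<open>A member of the slice: \<open>k\<close> at position \<open>j\<close>, 0 at the
    other positions (a legal coordinate because \<open>k < n\<close>), and \<open>undefined\<close>
    beyond \<open>d\<close> as extensionality demands.\<close>
  let ?i = "\<lambda>l. if l < d then if l = j then k else 0 else undefined"
  have "?i \<in> multi_indices n d" using assms(2,3) by (auto simp: multi_indices_def PiE_iff extensional_def)
  then have "?i \<in> {i. i \<in> multi_indices n d \<and> i j = k}" using assms(2) by simp
  then show ?thesis
    unfolding marginal_def by (intro sum_pos) (use assms(1) in auto)
qed

lemma marginal_scale:
  "marginal n d (\<lambda>i. U i * f (i j)) j k = marginal n d U j k * f k"
  unfolding marginal_def sum_distrib_right by (intro sum.cong) auto

definition mode_error :: "nat \<Rightarrow> nat \<Rightarrow> (nat \<Rightarrow> nat \<Rightarrow> real) \<Rightarrow> tensor \<Rightarrow> nat \<Rightarrow> real" where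
  "mode_error n d Q U j = (\<Sum>k<n. \<bar>marginal n d U j k - Q j k\<bar>)"

section \<open>Rounding to the transport polytope\<close>

text \<open>First half of the rounding scheme of Altschuler, Weed and Rigollet, carried over from
  matrices to \<open>d\<close> modes: only slices that are too heavy are shrunk.\<close>

definition cap_mode :: "nat \<Rightarrow> nat \<Rightarrow> (nat \<Rightarrow> nat \<Rightarrow> real) \<Rightarrow> nat \<Rightarrow> tensor \<Rightarrow> tensor" where
  "cap_mode n d Q j U = (\<lambda>i. if Q j (i j) < marginal n d U j (i j)
     then U i * (Q j (i j) / marginal n d U j (i j)) else U i)"

primrec cap_modes :: "nat \<Rightarrow> nat \<Rightarrow> (nat \<Rightarrow> nat \<Rightarrow> real) \<Rightarrow> tensor \<Rightarrow> nat \<Rightarrow> tensor" where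
  "cap_modes n d Q U 0 = U"
| "cap_modes n d Q U (Suc j) = cap_mode n d Q j (cap_modes n d Q U j)"

text \<open>After capping, the missing mass \<open>m\<close> is the same in every mode, so one
  product tensor of the normalized deficits, times \<open>m\<close>, repairs all marginals at once.
  If \<open>m\<close> is 0, there is nothing to repair and no division by \<open>m\<close> takes
  place.\<close>

definition rounded :: "nat \<Rightarrow> nat \<Rightarrow> (nat \<Rightarrow> nat \<Rightarrow> real) \<Rightarrow> tensor \<Rightarrow> tensor" where
  "rounded n d Q U =
     (let V = cap_modes n d Q U d; m = 1 - (\<Sum>i\<in>multi_indices n d. V i) in
      if 0 < m then \<lambda>i. V i + m * (\<Prod>l<d. (Q l (i l) - marginal n d V l (i l)) / m) else V)"

lemma cap_mode_bounds:
  fixes n d Q U j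
  defines "V \<equiv> cap_mode n d Q j U"
  assumes U: "\<And>i. i \<in> multi_indices n d \<Longrightarrow> 0 \<le> U i"
    and Q: "\<And>k. k < n \<Longrightarrow> 0 \<le> Q j k" and j: "j < d"
  shows "\<And>i. i \<in> multi_indices n d \<Longrightarrow> 0 \<le> V i"
    and "\<And>i. i \<in> multi_indices n d \<Longrightarrow> V i \<le> U i"
    and "\<And>k. k < n \<Longrightarrow> marginal n d V j k = min (marginal n d U j k) (Q j k)"
    and "(\<Sum>i\<in>multi_indices n d. U i) - (\<Sum>i\<in>multi_indices n d. V i) =
         (\<Sum>k<n. max 0 (marginal n d U j k - Q j k))"
proof -
  \<comment> \<open>Capping is multiplication by a function of coordinate \<open>j\<close> alone
    with values between 0 and 1, so \<open>marginal_scale\<close> yields the new marginal.\<close>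
  let ?f = "\<lambda>k. if Q j k < marginal n d U j k then Q j k / marginal n d U j k else 1"
  have V: "V = (\<lambda>i. U i * ?f (i j))" by (auto simp: V_def cap_mode_def)
  have f: "0 \<le> ?f k \<and> ?f k \<le> 1" if "k < n" for k using Q[OF that] by (auto simp: divide_simps)
  show "0 \<le> V i" if i: "i \<in> multi_indices n d" for i
    using U[OF i] f[OF multi_indices_less[OF i j]] by (simp only: V) auto
  show "V i \<le> U i" if i: "i \<in> multi_indices n d" for i
    using U[OF i] f[OF multi_indices_less[OF i j]] by (simp only: V) (simp add: mult_left_le)
  have m: "marginal n d V j k = min (marginal n d U j k) (Q j k)" if "k < n" for k
    unfolding V marginal_scale[where f = ?f] using Q[OF that] by (auto simp: min_def)
  then show "\<And>k. k < n \<Longrightarrow> marginal n d V j k = min (marginal n d U j k) (Q j k)" .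
  show "(\<Sum>i\<in>multi_indices n d. U i) - (\<Sum>i\<in>multi_indices n d. V i) =
         (\<Sum>k<n. max 0 (marginal n d U j k - Q j k))"
    unfolding sum_marginal[OF j, symmetric] sum_subtractf[symmetric]
    by (intro sum.cong) (auto simp: m)
qed

text \<open>Capping never increases an entry. Hence a mode that was capped earlier stays below its
  target, and the mass removed at mode \<open>l\<close> is at most the excess that the original
  tensor had there. The removed masses add up to at most the sum of the original mode
  errors.\<close>

lemma cap_modes_bounds:
  assumes U: "\<And>i. i \<in> multi_indices n d \<Longrightarrow> 0 \<le> U i"
    and Q: "\<And>j k. j < d \<Longrightarrow> k < n \<Longrightarrow> 0 \<le> Q j k" and "l \<le> d"
  shows "(\<forall>i\<in>multi_indices n d. 0 \<le> cap_modes n d Q U l i \<and> cap_modes n d Q U l i \<le> U i) \<and>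
    (\<forall>j<l. \<forall>k<n. marginal n d (cap_modes n d Q U l) j k \<le> Q j k) \<and>
    (\<Sum>i\<in>multi_indices n d. U i) - (\<Sum>i\<in>multi_indices n d. cap_modes n d Q U l i)
      \<le> (\<Sum>j<l. mode_error n d Q U j)"
  using \<open>l \<le> d\<close>
proof (induction l)
  case 0
  then show ?case using U by simp
next
  case (Suc l)
  define V where "V = cap_modes n d Q U l"
  define W where "W = cap_mode n d Q l V"
  have IH: "\<And>i. i \<in> multi_indices n d \<Longrightarrow> 0 \<le> V i" "\<And>i. i \<in> multi_indices n d \<Longrightarrow> V i \<le> U i"
    "\<And>j k. j < l \<Longrightarrow> k < n \<Longrightarrow> marginal n d V j k \<le> Q j k"
    "(\<Sum>i\<in>multi_indices n d. U i) - (\<Sum>i\<in>multi_indices n d. V i) \<le> (\<Sum>j<l. mode_error n d Q U j)"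
    using Suc by (auto simp: V_def)
  have l: "l < d" using Suc.prems by simp
  have W: "\<And>i. i \<in> multi_indices n d \<Longrightarrow> 0 \<le> W i" "\<And>i. i \<in> multi_indices n d \<Longrightarrow> W i \<le> V i"
    "\<And>k. k < n \<Longrightarrow> marginal n d W l k = min (marginal n d V l k) (Q l k)"
    "(\<Sum>i\<in>multi_indices n d. V i) - (\<Sum>i\<in>multi_indices n d. W i) =
      (\<Sum>k<n. max 0 (marginal n d V l k - Q l k))"
    using cap_mode_bounds[where n = n and d = d and U = V and j = l and Q = Q] IH(1) Q[OF l] l
    unfolding W_def by blast+
  have "(\<Sum>k<n. max 0 (marginal n d V l k - Q l k)) \<le> mode_error n d Q U l"
    unfolding mode_error_def
  proof (rule sum_mono)
    fix k
    show "max 0 (marginal n d V l k - Q l k) \<le> \<bar>marginal n d U l k - Q l k\<bar>"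
      using marginal_mono[where n = n and d = d and U = V and V = U and j = l and k = k, OF IH(2)] by simp
  qed
  then have 1: "(\<Sum>i\<in>multi_indices n d. U i) - (\<Sum>i\<in>multi_indices n d. W i)
      \<le> (\<Sum>j<Suc l. mode_error n d Q U j)" using W(4) IH(4) by simp
  have 2: "marginal n d W j k \<le> Q j k" if "j < Suc l" "k < n" for j k
  proof (cases "j = l")
    case True
    then show ?thesis using W(3) that by simp
  next
    case False
    then have "j < l" using that by simp
    then show ?thesis
      using IH(3)[OF _ that(2)] marginal_mono[where n = n and d = d and U = W and V = V and j = j and k = k, OF W(2)] by fastforce
  qed
  have 3: "0 \<le> W i \<and> W i \<le> U i" if "i \<in> multi_indices n d" for i
    using W(1,2)[OF that] IH(2)[OF that] by simp
  show ?case using 1 2 3 by (simp add: W_def V_def)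
qed

text \<open>The factor 2 counts the mass \<open>m\<close> twice: capping removes it and the product
  correction adds it back. By \<open>cap_modes_bounds\<close>, \<open>m\<close> is at most the sum
  of the mode errors.\<close>

lemma rounded_bounds:
  assumes U: "\<And>i. i \<in> multi_indices n d \<Longrightarrow> 0 \<le> U i"
    and U1: "(\<Sum>i\<in>multi_indices n d. U i) = 1"
    and Q: "\<And>j k. j < d \<Longrightarrow> k < n \<Longrightarrow> 0 \<le> Q j k"
    and Q1: "\<And>j. j < d \<Longrightarrow> (\<Sum>k<n. Q j k) = 1" and d: "1 \<le> d"
  shows "rounded n d Q U \<in> transport_polytope n d Q"
    and "(\<Sum>i\<in>multi_indices n d. \<bar>rounded n d Q U i - U i\<bar>) \<le> 2 * (\<Sum>j<d. mode_error n d Q U j)"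
proof -
  let ?I = "multi_indices n d"
  define V where "V = cap_modes n d Q U d"
  define m where "m = 1 - (\<Sum>i\<in>?I. V i)"
  define e where "e = (\<lambda>l k. (Q l k - marginal n d V l k) / m)"
  have V: "\<And>i. i \<in> ?I \<Longrightarrow> 0 \<le> V i" "\<And>i. i \<in> ?I \<Longrightarrow> V i \<le> U i"
    "\<And>j k. j < d \<Longrightarrow> k < n \<Longrightarrow> marginal n d V j k \<le> Q j k" "m \<le> (\<Sum>j<d. mode_error n d Q U j)"
    using cap_modes_bounds[where U = U and Q = Q and n = n and l = d, OF U Q order_refl]
    by (auto simp: V_def m_def U1)
  have r: "rounded n d Q U = (if 0 < m then \<lambda>i. V i + m * (\<Prod>l<d. e l (i l)) else V)"
    by (simp add: rounded_def V_def m_def e_def Let_def)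
  have UV: "(\<Sum>i\<in>?I. \<bar>V i - U i\<bar>) = m"
  proof -
    have "(\<Sum>i\<in>?I. \<bar>V i - U i\<bar>) = (\<Sum>i\<in>?I. U i - V i)" using V(2) by (intro sum.cong) auto
    then show ?thesis by (simp add: sum_subtractf m_def U1)
  qed
  then have m0: "0 \<le> m" using sum_nonneg[of ?I "\<lambda>i. \<bar>V i - U i\<bar>"] by simp
  \<comment> \<open>The total deficit of a mode is 1 minus the mass of \<open>V\<close>, whichever
    mode it is. This makes each \<open>e l\<close> a probability vector.\<close>
  have gap: "(\<Sum>k<n. Q j k - marginal n d V j k) = m" if "j < d" for j
    by (simp add: sum_subtractf sum_marginal that Q1 m_def)
  have "rounded n d Q U \<in> transport_polytope n d Q \<and>
    (\<Sum>i\<in>?I. \<bar>rounded n d Q U i - U i\<bar>) \<le> 2 * m"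
  proof (cases "0 < m")
    case True
    have e1: "(\<Sum>k<n. e l k) = 1" if "l < d" for l
      using gap[OF that] True by (simp add: e_def sum_divide_distrib[symmetric])
    have e0: "0 \<le> e l k" if "l < d" "k < n" for l k
      using V(3)[OF that] True by (simp add: e_def)
    let ?E = "\<lambda>i. \<Prod>l<d. e l (i l)"
    have E0: "0 \<le> ?E i" if "i \<in> ?I" for i
      using e0 multi_indices_less[OF that] by (intro prod_nonneg) auto
    have mE: "marginal n d ?E j k = e j k" if "j < d" "k < n" for j k
      using product_tensor_marginal[of d e n j k] e1 that by blast
    have E1: "(\<Sum>i\<in>?I. ?E i) = 1"
    proof -
      have "(\<Sum>i\<in>?I. ?E i) = (\<Sum>k<n. marginal n d ?E 0 k)"
        using sum_marginal[of 0 d n ?E] d by simp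
      also have "\<dots> = (\<Sum>k<n. e 0 k)" using mE d by (intro sum.cong) auto
      finally show ?thesis using e1[of 0] d by simp
    qed
    have "marginal n d (rounded n d Q U) j k = Q j k" if "j < d" "k < n" for j k
      using True by (simp add: r marginal_linear mE that) (simp add: e_def)
    moreover have "0 \<le> rounded n d Q U i" if "i \<in> ?I" for i
      using True V(1)[OF that] E0[OF that] by (simp add: r)
    moreover have "(\<Sum>i\<in>?I. \<bar>rounded n d Q U i - U i\<bar>) \<le> (\<Sum>i\<in>?I. \<bar>V i - U i\<bar> + m * ?E i)"
    proof (rule sum_mono)
      fix i assume "i \<in> ?I"
      then show "\<bar>rounded n d Q U i - U i\<bar> \<le> \<bar>V i - U i\<bar> + m * ?E i"
        using True mult_nonneg_nonneg[OF m0 E0[of i]] by (simp add: r abs_if)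
    qed
    then have "(\<Sum>i\<in>?I. \<bar>rounded n d Q U i - U i\<bar>) \<le> 2 * m"
      using UV E1 by (simp add: sum.distrib sum_distrib_left[symmetric])
    ultimately show ?thesis by (auto simp: transport_polytope_def)
  next
    case False
    \<comment> \<open>With no mass missing, the deficits of each mode are nonnegative with sum 0, so
      they vanish and \<open>V\<close> already has the marginals \<open>Q\<close>.\<close>
    then have m: "m = 0" using m0 by simp
    have "marginal n d V j k = Q j k" if "j < d" "k < n" for j k
    proof -
      have "\<forall>k\<in>{..<n}. Q j k - marginal n d V j k = 0"
        using gap[OF that(1)] V(3)[OF that(1)]
        by (intro sum_nonneg_eq_0_iff[THEN iffD1]) (auto simp: m)
      then show ?thesis using that(2) by simp
    qed
    then show ?thesis using V(1) UV by (auto simp: r m transport_polytope_def)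
  qed
  then show "rounded n d Q U \<in> transport_polytope n d Q"
    and "(\<Sum>i\<in>?I. \<bar>rounded n d Q U i - U i\<bar>) \<le> 2 * (\<Sum>j<d. mode_error n d Q U j)"
    using V(4) by auto
qed

section \<open>Stability of the objective under a change of the tensor\<close>

lemma entry_le_Max_Min:
  assumes "i \<in> multi_indices n d"
  shows "C i \<le> Max (C ` multi_indices n d)" "Min (C ` multi_indices n d) \<le> C i"
  using assms by auto

lemma entry_range_nonneg: "1 \<le> n \<Longrightarrow> 0 \<le> entry_range n d C"
  using multi_indices_nonempty[of n d] entry_le_Max_Min[of _ n d C]
  by (force simp: entry_range_def)

text \<open>Equal total masses allow subtracting the minimum entry from \<open>C\<close>; the
  shifted coefficients lie between 0 and the entry range.\<close>

lemma tensor_inner_le_entry_range: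
  assumes "(\<Sum>i\<in>multi_indices n d. U i) = (\<Sum>i\<in>multi_indices n d. V i)"
  shows "tensor_inner n d C U \<le>
    tensor_inner n d C V + entry_range n d C * (\<Sum>i\<in>multi_indices n d. \<bar>U i - V i\<bar>)"
proof -
  let ?I = "multi_indices n d" and ?m = "Min (C ` multi_indices n d)"
  have "tensor_inner n d C U - tensor_inner n d C V = (\<Sum>i\<in>?I. (C i - ?m) * (U i - V i))"
    using assms by (simp add: tensor_inner_def algebra_simps sum.distrib sum_subtractf
        sum_distrib_right[symmetric])
  also have "\<dots> \<le> (\<Sum>i\<in>?I. entry_range n d C * \<bar>U i - V i\<bar>)"
  proof (rule sum_mono)
    fix i assume i: "i \<in> ?I"
    have "(C i - ?m) * (U i - V i) \<le> (C i - ?m) * \<bar>U i - V i\<bar>"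
      using entry_le_Max_Min(2)[OF i, of C] by (intro mult_left_mono) auto
    also have "\<dots> \<le> entry_range n d C * \<bar>U i - V i\<bar>"
      using entry_le_Max_Min(1)[OF i, of C] by (intro mult_right_mono) (auto simp: entry_range_def)
    finally show "(C i - ?m) * (U i - V i) \<le> entry_range n d C * \<bar>U i - V i\<bar>" .
  qed
  finally show ?thesis by (simp add: sum_distrib_left)
qed

section \<open>Convergence of the scaling iteration\<close>

text \<open>A Pinsker inequality with a weaker constant, by way of the squared Hellinger distance
  \<open>H\<close>: \<open>ln x <= x - 1\<close> at \<open>x = sqrt (q / p)\<close> bounds the
  relative entropy below by \<open>H\<close>, and Cauchy-Schwarz bounds the squared l1 distance
  above by \<open>4 * H\<close>.\<close>

lemma relative_entropy_ge_l1:
  fixes p q :: "nat \<Rightarrow> real"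
  assumes p: "\<And>k. k < n \<Longrightarrow> 0 < p k" and q: "\<And>k. k < n \<Longrightarrow> 0 < q k"
    and p1: "(\<Sum>k<n. p k) = 1" and q1: "(\<Sum>k<n. q k) = 1"
  shows "(\<Sum>k<n. \<bar>q k - p k\<bar>)\<^sup>2 / 4 \<le> (\<Sum>k<n. p k * ln (p k / q k))"
proof -
  define H where "H = (\<Sum>k<n. (sqrt (p k) - sqrt (q k))\<^sup>2)"
  \<comment> \<open>The correction \<open>- q k + p k\<close> lets the inequality hold pointwise; it
    sums to 0 because both vectors have total 1.\<close>
  have pt: "(sqrt (p k) - sqrt (q k))\<^sup>2 - q k + p k \<le> p k * ln (p k / q k)" if "k < n" for k
  proof -
    have pq: "0 < p k" "0 < q k" using p q that by auto
    have "ln (sqrt (q k / p k)) \<le> sqrt (q k / p k) - 1" using pq by (intro ln_le_minus_one) simp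
    then have "p k * (2 * ln (sqrt (q k / p k))) \<le> p k * (2 * (sqrt (q k / p k) - 1))"
      using pq by (intro mult_left_mono) auto
    also have "2 * ln (sqrt (q k / p k)) = - ln (p k / q k)"
      using pq by (simp add: ln_sqrt ln_div)
    also have "p k * (2 * (sqrt (q k / p k) - 1)) = 2 * (sqrt (p k) * sqrt (q k)) - 2 * p k"
    proof -
      have "p k * sqrt (q k / p k) = sqrt (p k) * sqrt (p k) * (sqrt (q k) / sqrt (p k))"
        using pq by (simp add: real_sqrt_divide)
      also have "\<dots> = sqrt (p k) * sqrt (q k)" using pq by (simp add: field_simps del: real_sqrt_mult_self)
      finally show ?thesis by (simp add: algebra_simps)
    qed
    finally show ?thesis using pq by (simp add: power2_diff)
  qed
  have "(\<Sum>k<n. (sqrt (p k) - sqrt (q k))\<^sup>2 - q k + p k) \<le> (\<Sum>k<n. p k * ln (p k / q k))"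
    by (intro sum_mono) (simp add: pt)
  then have H: "H \<le> (\<Sum>k<n. p k * ln (p k / q k))"
    by (simp add: sum.distrib sum_subtractf H_def p1 q1)
  have "(\<Sum>k<n. \<bar>q k - p k\<bar>) = (\<Sum>k<n. \<bar>sqrt (p k) - sqrt (q k)\<bar> * (sqrt (p k) + sqrt (q k)))"
  proof (intro sum.cong refl)
    fix k assume "k \<in> {..<n}"
    then have pq: "0 < p k" "0 < q k" using p q by auto
    have "p k - q k = (sqrt (p k) - sqrt (q k)) * (sqrt (p k) + sqrt (q k))"
      using pq by (simp add: algebra_simps)
    then have "\<bar>p k - q k\<bar> = \<bar>sqrt (p k) - sqrt (q k)\<bar> * \<bar>sqrt (p k) + sqrt (q k)\<bar>"
      by (simp add: abs_mult)
    then show "\<bar>q k - p k\<bar> = \<bar>sqrt (p k) - sqrt (q k)\<bar> * (sqrt (p k) + sqrt (q k))"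
      using pq by (simp add: abs_minus_commute)
  qed
  then have "(\<Sum>k<n. \<bar>q k - p k\<bar>)\<^sup>2 \<le>
      (\<Sum>k<n. \<bar>sqrt (p k) - sqrt (q k)\<bar>\<^sup>2) * (\<Sum>k<n. (sqrt (p k) + sqrt (q k))\<^sup>2)"
    using Cauchy_Schwarz_ineq_sum[of "\<lambda>k. \<bar>sqrt (p k) - sqrt (q k)\<bar>"
        "\<lambda>k. sqrt (p k) + sqrt (q k)" "{..<n}"] by simp
  also have "\<dots> = H * (\<Sum>k<n. (sqrt (p k) + sqrt (q k))\<^sup>2)" by (simp add: H_def)
  also have "\<dots> \<le> H * 4"
  proof (intro mult_left_mono)
    \<comment> \<open>By \<open>2 * a * b <= a^2 + b^2\<close>; the joint mass 2 of \<open>p\<close>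
      and \<open>q\<close> then gives the constant 4.\<close>
    have "(sqrt (p k) + sqrt (q k))\<^sup>2 \<le> 2 * p k + 2 * q k" if "k < n" for k
      using p[OF that] q[OF that] sum_squares_bound[of "sqrt (p k)" "sqrt (q k)"]
      by (simp add: power2_sum)
    then have "(\<Sum>k<n. (sqrt (p k) + sqrt (q k))\<^sup>2) \<le> (\<Sum>k<n. 2 * p k + 2 * q k)"
      by (intro sum_mono) simp
    then show "(\<Sum>k<n. (sqrt (p k) + sqrt (q k))\<^sup>2) \<le> 4"
      by (simp add: sum.distrib sum_distrib_left[symmetric] p1 q1)
  qed (simp add: H_def sum_nonneg)
  finally show ?thesis using H by simp
qed

section \<open>Scaled kernels and the potential that rescaling increases\<close>

text \<open>
  The last clause says that \<open>ln B + \<eta> C\<close> is a sum of functions of single coordinates.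
\<close>

definition scaled_kernel :: "nat \<Rightarrow> nat \<Rightarrow> tensor \<Rightarrow> real \<Rightarrow> tensor \<Rightarrow> bool" where
  "scaled_kernel n d C \<eta> B \<longleftrightarrow>
     (\<forall>i\<in>multi_indices n d. 0 < B i) \<and> (\<Sum>i\<in>multi_indices n d. B i) = 1 \<and>
     (\<forall>W. (\<forall>j<d. \<forall>k<n. marginal n d W j k = 0) \<longrightarrow>
        (\<Sum>i\<in>multi_indices n d. W i * (ln (B i) + \<eta> * C i)) = 0)"

lemma scaled_kernel_cong:
  assumes "\<And>i. i \<in> multi_indices n d \<Longrightarrow> B i = B' i"
  shows "scaled_kernel n d C \<eta> B = scaled_kernel n d C \<eta> B'"
  using assms by (simp add: scaled_kernel_def cong: sum.cong)

text \<open>Minus the cross entropy of \<open>U\<close> and \<open>B\<close>. With \<open>U\<close>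
  fixed in the polytope it measures the progress of the iteration; with \<open>U = B\<close> it is
  minus the entropy of \<open>B\<close>.\<close>

definition log_potential :: "nat \<Rightarrow> nat \<Rightarrow> tensor \<Rightarrow> tensor \<Rightarrow> real" where
  "log_potential n d U B = (\<Sum>i\<in>multi_indices n d. U i * ln (B i))"

lemma log_potential_cong:
  assumes "\<And>i. i \<in> multi_indices n d \<Longrightarrow> B i = B' i"
  shows "log_potential n d U B = log_potential n d U B'"
  using assms by (simp add: log_potential_def)

lemma scaled_kernel_le_1:
  assumes "scaled_kernel n d C \<eta> B" "i \<in> multi_indices n d"
  shows "B i \<le> 1"
  using assms member_le_sum[of i "multi_indices n d" B]
  by (auto simp: scaled_kernel_def intro: less_imp_le)

text \<open>Positive entries with sum 1 are at most 1, so their logarithms are nonpositive. This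
  ceiling limits the number of sweeps.\<close>

lemma log_potential_nonpos:
  assumes "scaled_kernel n d C \<eta> B" "\<And>i. i \<in> multi_indices n d \<Longrightarrow> 0 \<le> U i"
  shows "log_potential n d U B \<le> 0"
  unfolding log_potential_def
proof (rule sum_nonpos)
  fix i assume i: "i \<in> multi_indices n d"
  have "0 < B i" "B i \<le> 1" using assms(1) i scaled_kernel_le_1[OF assms(1) i]
    by (auto simp: scaled_kernel_def)
  then have "ln (B i) \<le> 0" by simp
  then show "U i * ln (B i) \<le> 0" using assms(2)[OF i] by (simp add: mult_nonneg_nonpos)
qed

text \<open>Here \<open>ln B + \<eta> C\<close> is the constant \<open>- ln Z\<close>, which is
  annihilated by every \<open>W\<close> with zero marginals, since such a \<open>W\<close> has total
  0. For the lower bound, \<open>U\<close> averages the values of \<open>ln B\<close>, and each of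
  them is controlled through \<open>ln Z <= d ln n - \<eta> min C\<close>, which holds because
  \<open>Z\<close> has \<open>n ^ d\<close> terms.\<close>

lemma gibbs_kernel:
  fixes n d :: nat and C :: tensor and \<eta> :: real
  defines "Z \<equiv> \<Sum>i\<in>multi_indices n d. exp (- \<eta> * C i)"
  assumes n: "1 \<le> n" and d: "1 \<le> d" and eta: "0 \<le> \<eta>"
  shows "0 < Z" and "scaled_kernel n d C \<eta> (\<lambda>i. exp (- \<eta> * C i) / Z)"
    and "\<And>U. (\<And>i. i \<in> multi_indices n d \<Longrightarrow> 0 \<le> U i) \<Longrightarrow>
      (\<Sum>i\<in>multi_indices n d. U i) = 1 \<Longrightarrow>
      - (\<eta> * entry_range n d C + real d * ln (real n)) \<le> log_potential n d U (\<lambda>i. exp (- \<eta> * C i) / Z)"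
proof -
  let ?I = "multi_indices n d"
  show Z: "0 < Z" unfolding Z_def using multi_indices_nonempty[OF n] by (intro sum_pos) auto
  have lnB: "ln (exp (- \<eta> * C i) / Z) = - \<eta> * C i - ln Z" for i using Z by (simp add: ln_div)
  show "scaled_kernel n d C \<eta> (\<lambda>i. exp (- \<eta> * C i) / Z)"
    unfolding scaled_kernel_def
  proof (intro conjI allI impI ballI)
    show "0 < exp (- \<eta> * C i) / Z" for i using Z by simp
    show "(\<Sum>i\<in>?I. exp (- \<eta> * C i) / Z) = 1"
      using Z by (simp only: sum_divide_distrib[symmetric] Z_def[symmetric]) simp
    fix W :: tensor assume W: "\<forall>j<d. \<forall>k<n. marginal n d W j k = 0"
    have "(\<Sum>i\<in>?I. W i) = (\<Sum>k<n. marginal n d W 0 k)" using sum_marginal[of 0 d n W] d by simp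
    also have "\<dots> = 0" using W d by simp
    finally show "(\<Sum>i\<in>?I. W i * (ln (exp (- \<eta> * C i) / Z) + \<eta> * C i)) = 0"
      unfolding lnB by (simp add: sum_distrib_right[symmetric] sum_negf)
  qed
  fix U :: tensor assume U: "\<And>i. i \<in> ?I \<Longrightarrow> 0 \<le> U i" "(\<Sum>i\<in>?I. U i) = 1"
  let ?mn = "Min (C ` ?I)" and ?mx = "Max (C ` ?I)"
  have "Z \<le> (\<Sum>i\<in>?I. exp (- \<eta> * ?mn))"
    unfolding Z_def using entry_le_Max_Min(2)[of _ n d C] eta
    by (intro sum_mono) (simp add: mult_left_mono)
  also have "\<dots> = real n ^ d * exp (- \<eta> * ?mn)" by (simp add: card_multi_indices)
  finally have "ln Z \<le> ln (real n ^ d * exp (- \<eta> * ?mn))" using Z n by (simp add: ln_le_cancel_iff)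
  also have "\<dots> = real d * ln (real n) - \<eta> * ?mn" using n by (simp add: ln_mult ln_realpow)
  finally have lnZ: "ln Z \<le> real d * ln (real n) - \<eta> * ?mn" .
  have "(\<Sum>i\<in>?I. U i * (- (\<eta> * entry_range n d C + real d * ln (real n)))) \<le>
      log_potential n d U (\<lambda>i. exp (- \<eta> * C i) / Z)"
    unfolding log_potential_def
  proof (intro sum_mono mult_left_mono)
    fix i assume i: "i \<in> ?I"
    have "\<eta> * C i \<le> \<eta> * ?mx" using entry_le_Max_Min(1)[OF i, of C] eta by (intro mult_left_mono)
    then show "- (\<eta> * entry_range n d C + real d * ln (real n)) \<le> ln (exp (- \<eta> * C i) / Z)"
      unfolding lnB using lnZ by (simp add: entry_range_def algebra_simps)
    show "0 \<le> U i" by (rule U(1)[OF i])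
  qed
  then show "- (\<eta> * entry_range n d C + real d * ln (real n)) \<le> log_potential n d U (\<lambda>i. exp (- \<eta> * C i) / Z)"
    unfolding sum_distrib_right[symmetric] U(2) by simp
qed

text \<open>The logarithm of the kernel changes by a function of coordinate \<open>j\<close> alone.
  Tensors with zero marginals do not see it, and pairing it with \<open>U\<close> from the polytope
  gives exactly the relative entropy of \<open>P j\<close> with respect to the current marginal, to
  which \<open>relative_entropy_ge_l1\<close> applies.\<close>

lemma scaling_step:
  fixes n d :: nat and B :: tensor and P j
  defines "B' \<equiv> \<lambda>i. B i * (P j (i j) / marginal n d B j (i j))"
  assumes B: "scaled_kernel n d C \<eta> B" and P: "P j \<in> positive_prob_vectors n" and j: "j < d"
  shows "scaled_kernel n d C \<eta> B'"
    and "\<And>U. U \<in> transport_polytope n d P \<Longrightarrow>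
      log_potential n d U B + (mode_error n d P B j)\<^sup>2 / 4 \<le> log_potential n d U B'"
proof -
  let ?I = "multi_indices n d" and ?s = "marginal n d B j"
  have Bp: "\<And>i. i \<in> ?I \<Longrightarrow> 0 < B i" and B1: "(\<Sum>i\<in>?I. B i) = 1"
    using B by (auto simp: scaled_kernel_def)
  have Pp: "\<And>k. k < n \<Longrightarrow> 0 < P j k" and P1: "(\<Sum>k<n. P j k) = 1"
    using P by (auto simp: positive_prob_vectors_def)
  have s: "\<And>k. k < n \<Longrightarrow> 0 < ?s k" using marginal_pos[where n = n and d = d and U = B, OF Bp j] by blast
  have lnB': "ln (B' i) = ln (B i) + ln (P j (i j) / ?s (i j))" if i: "i \<in> ?I" for i
    using Bp[OF i] Pp[OF multi_indices_less[OF i j]] s[OF multi_indices_less[OF i j]]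
    by (simp only: B'_def) (simp add: ln_mult ln_div)
  show "scaled_kernel n d C \<eta> B'"
    unfolding scaled_kernel_def
  proof (intro conjI allI impI ballI)
    show "0 < B' i" if i: "i \<in> ?I" for i
      using Bp[OF i] Pp[OF multi_indices_less[OF i j]] s[OF multi_indices_less[OF i j]]
      by (simp add: B'_def)
    have "(\<Sum>i\<in>?I. B' i) = (\<Sum>k<n. (P j k / ?s k) * ?s k)"
      unfolding B'_def by (rule sum_mode[OF j, where f = "\<lambda>k. P j k / ?s k"])
    also have "\<dots> = (\<Sum>k<n. P j k)"
    proof (intro sum.cong refl)
      fix k assume "k \<in> {..<n}"
      then have "?s k \<noteq> 0" using s[of k] by simp
      then show "P j k / ?s k * ?s k = P j k" by simp
    qed
    finally show "(\<Sum>i\<in>?I. B' i) = 1" using P1 by simp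
    fix W :: tensor assume W: "\<forall>j<d. \<forall>k<n. marginal n d W j k = 0"
    have "(\<Sum>i\<in>?I. W i * (ln (B' i) + \<eta> * C i)) =
      (\<Sum>i\<in>?I. W i * (ln (B i) + \<eta> * C i)) + (\<Sum>i\<in>?I. W i * ln (P j (i j) / ?s (i j)))"
      unfolding sum.distrib[symmetric] by (intro sum.cong) (auto simp: lnB' algebra_simps)
    also have "(\<Sum>i\<in>?I. W i * ln (P j (i j) / ?s (i j))) = 0"
      using W j by (simp add: sum_mode[OF j, where f = "\<lambda>k. ln (P j k / ?s k)"])
    finally show "(\<Sum>i\<in>?I. W i * (ln (B' i) + \<eta> * C i)) = 0"
      using B W by (simp add: scaled_kernel_def)
  qed
  fix U assume U: "U \<in> transport_polytope n d P"
  have "log_potential n d U B' =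
      log_potential n d U B + (\<Sum>i\<in>?I. U i * ln (P j (i j) / ?s (i j)))"
    unfolding log_potential_def sum.distrib[symmetric]
    by (intro sum.cong) (auto simp: lnB' algebra_simps)
  also have "(\<Sum>i\<in>?I. U i * ln (P j (i j) / ?s (i j))) = (\<Sum>k<n. P j k * ln (P j k / ?s k))"
    using U j by (simp add: sum_mode[OF j, where f = "\<lambda>k. ln (P j k / ?s k)"]
        transport_polytope_def mult.commute)
  finally show "log_potential n d U B + (mode_error n d P B j)\<^sup>2 / 4 \<le> log_potential n d U B'"
    using relative_entropy_ge_l1[of n "P j" ?s, OF Pp s P1] sum_marginal[OF j, of n B] B1
    by (simp add: mode_error_def)
qed

section \<open>Entropic near-optimality and the loss caused by rounding\<close>

text \<open>Entropy is at most the logarithm of the number \<open>n ^ d\<close> of points, by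
  \<open>ln x <= x - 1\<close> at \<open>x = 1 / (n ^ d * B i)\<close>.\<close>

lemma entropy_le:
  assumes "scaled_kernel n d C \<eta> B" "1 \<le> n"
  shows "- log_potential n d B B \<le> real d * ln (real n)"
proof -
  let ?I = "multi_indices n d" and ?N = "real n ^ d"
  have B: "\<And>i. i \<in> ?I \<Longrightarrow> 0 < B i" "(\<Sum>i\<in>?I. B i) = 1"
    using assms(1) by (auto simp: scaled_kernel_def)
  have N: "0 < ?N" using assms(2) by simp
  have "(\<Sum>i\<in>?I. B i * - ln (B i) - B i * (real d * ln (real n))) \<le> (\<Sum>i\<in>?I. 1 / ?N - B i)"
  proof (rule sum_mono)
    fix i assume i: "i \<in> ?I"
    have "ln (1 / (?N * B i)) \<le> 1 / (?N * B i) - 1" using B(1)[OF i] N by (intro ln_le_minus_one) simp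
    then have "B i * ln (1 / (?N * B i)) \<le> B i * (1 / (?N * B i) - 1)"
      using B(1)[OF i] by (intro mult_left_mono) auto
    also have "\<dots> = 1 / ?N - B i" using B(1)[OF i] by (simp add: field_simps)
    also have "ln (1 / (?N * B i)) = - (real d * ln (real n)) - ln (B i)"
      using B(1)[OF i] N assms(2) by (simp add: ln_div ln_mult ln_realpow)
    finally show "B i * - ln (B i) - B i * (real d * ln (real n)) \<le> 1 / ?N - B i" by (simp add: algebra_simps)
  qed
  also have "\<dots> = 0" using N by (simp add: sum_subtractf B(2) card_multi_indices)
  finally show ?thesis
    by (simp add: log_potential_def sum_subtractf sum_negf sum_distrib_right[symmetric] B(2))
qed

text \<open>The difference \<open>B - V\<close> has zero marginals, so the kernel condition turns
  \<open>\<eta>\<close> times the gap of the objectives into the potential of \<open>V\<close> minus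
  that of \<open>B\<close>. The former is nonpositive, and minus the latter is an entropy.\<close>

lemma scaled_kernel_near_optimal:
  assumes B: "scaled_kernel n d C \<eta> B" and "1 \<le> n" "0 < \<eta>"
    and V: "V \<in> transport_polytope n d (marginal n d B)"
  shows "tensor_inner n d C B \<le> tensor_inner n d C V + real d * ln (real n) / \<eta>"
proof -
  let ?I = "multi_indices n d"
  have "marginal n d (\<lambda>i. B i - V i) j k = 0" if "j < d" "k < n" for j k
    using V that by (simp add: marginal_diff transport_polytope_def)
  then have "(\<Sum>i\<in>?I. (B i - V i) * (ln (B i) + \<eta> * C i)) = 0"
    using B unfolding scaled_kernel_def by blast
  then have "\<eta> * (tensor_inner n d C B - tensor_inner n d C V) =
      log_potential n d V B - log_potential n d B B"
    by (simp add: tensor_inner_def log_potential_def algebra_simps sum.distrib sum_subtractf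
        sum_distrib_left)
  also have "\<dots> \<le> real d * ln (real n)"
    using log_potential_nonpos[OF B, of V] V entropy_le[OF B \<open>1 \<le> n\<close>]
    by (simp add: transport_polytope_def)
  finally have "tensor_inner n d C B - tensor_inner n d C V \<le> real d * ln (real n) / \<eta>"
    using \<open>0 < \<eta>\<close> by (simp add: field_simps)
  then show ?thesis by simp
qed

text \<open>A scaled kernel is near-optimal only among tensors with its own marginals, so an optimal
  \<open>U\<close> is first carried to the marginals of \<open>B\<close>. The chain runs from the
  rounded \<open>B\<close> to \<open>B\<close>, to the rounded \<open>U\<close>, to
  \<open>U\<close>; the two rounding links cost \<open>2 d \<epsilon>\<close> times the entry range
  each.\<close>

lemma rounded_near_optimal:
  assumes n: "1 \<le> n" and d: "1 \<le> d" and P: "\<And>j. j < d \<Longrightarrow> P j \<in> positive_prob_vectors n"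
    and B: "scaled_kernel n d C \<eta> B" and eta: "0 < \<eta>"
    and err: "\<And>j. j < d \<Longrightarrow> mode_error n d P B j \<le> \<epsilon>"
  shows "rounded n d P B \<in> transport_polytope n d P"
    and "tensor_inner n d C (rounded n d P B) \<le>
      tot_value n d C P + 4 * real d * \<epsilon> * entry_range n d C + real d * ln (real n) / \<eta>"
proof -
  let ?I = "multi_indices n d" and ?w = "entry_range n d C" and ?S = "marginal n d B"
  have total: "(\<Sum>i\<in>?I. U i) = 1" if "U \<in> transport_polytope n d Q" "(\<Sum>k<n. Q 0 k) = 1" for U Q
    using that d sum_marginal[of 0 d n U] by (simp add: transport_polytope_def)
  have Pp: "0 \<le> P j k" if "j < d" "k < n" for j k
    using P[OF that(1)] that(2) by (auto simp: positive_prob_vectors_def intro: less_imp_le)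
  have P1: "(\<Sum>k<n. P j k) = 1" if "j < d" for j
    using P[OF that] by (simp add: positive_prob_vectors_def)
  have Bp: "\<And>i. i \<in> ?I \<Longrightarrow> 0 \<le> B i" and B1: "(\<Sum>i\<in>?I. B i) = 1"
    using B by (auto simp: scaled_kernel_def intro: less_imp_le)
  have sum_err: "(\<Sum>j<d. f j) \<le> d * \<epsilon>" if "\<And>j. j < d \<Longrightarrow> f j \<le> \<epsilon>" for f :: "nat \<Rightarrow> real"
    using sum_mono[of "{..<d}" f "\<lambda>_. \<epsilon>"] that by simp
  have d0: "0 < d" using d by simp
  have R: "rounded n d P B \<in> transport_polytope n d P"
    "(\<Sum>i\<in>?I. \<bar>rounded n d P B i - B i\<bar>) \<le> 2 * (\<Sum>j<d. mode_error n d P B j)"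
    using rounded_bounds[where U = B and Q = P and n = n and d = d] Bp B1 Pp P1 d by blast+
  then show rP: "rounded n d P B \<in> transport_polytope n d P" by blast
  have "tensor_inner n d C (rounded n d P B) \<le> tensor_inner n d C B + ?w * (2 * (d * \<epsilon>))"
  proof -
    have "(\<Sum>i\<in>?I. \<bar>rounded n d P B i - B i\<bar>) \<le> 2 * (d * \<epsilon>)"
      using R(2) sum_err[of "mode_error n d P B", OF err] by linarith
    then have "?w * (\<Sum>i\<in>?I. \<bar>rounded n d P B i - B i\<bar>) \<le> ?w * (2 * (d * \<epsilon>))"
      by (rule mult_left_mono) (rule entry_range_nonneg[OF n])
    moreover have "(\<Sum>i\<in>?I. rounded n d P B i) = (\<Sum>i\<in>?I. B i)" using total[OF rP P1[OF d0]] B1 by simp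
    note tensor_inner_le_entry_range[OF this, of C]
    ultimately show ?thesis by linarith
  qed
  moreover obtain U where U: "U \<in> transport_polytope n d P" "tot_value n d C P = tensor_inner n d C U"
    using tot_value_attained(1)[of d P n C] d P by auto
  have Up: "\<And>i. i \<in> ?I \<Longrightarrow> 0 \<le> U i" and U1: "(\<Sum>i\<in>?I. U i) = 1"
    using U(1) total[OF U(1) P1[OF d0]] by (auto simp: transport_polytope_def)
  have Sp: "0 \<le> ?S j k" for j k using marginal_nonneg[where n = n and d = d and U = B] Bp by blast
  have S1: "(\<Sum>k<n. ?S j k) = 1" if "j < d" for j using sum_marginal[OF that, of n B] B1 by simp
  have V: "rounded n d ?S U \<in> transport_polytope n d ?S"
    "(\<Sum>i\<in>?I. \<bar>rounded n d ?S U i - U i\<bar>) \<le> 2 * (\<Sum>j<d. mode_error n d ?S U j)"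
    using rounded_bounds[where U = U and Q = ?S and n = n and d = d] Up U1 Sp S1 d by blast+
  \<comment> \<open>Mode errors are symmetric: the marginals of \<open>U\<close> are
    \<open>P\<close>, so its distance to the marginals of \<open>B\<close> is the one already
    bounded by \<open>err\<close>.\<close>
  have errU: "mode_error n d ?S U j \<le> \<epsilon>" if "j < d" for j
    using err[OF that] U(1) that
    by (simp add: mode_error_def transport_polytope_def abs_minus_commute)
  have "tensor_inner n d C (rounded n d ?S U) \<le> tensor_inner n d C U + ?w * (2 * (d * \<epsilon>))"
  proof -
    have "(\<Sum>i\<in>?I. \<bar>rounded n d ?S U i - U i\<bar>) \<le> 2 * (d * \<epsilon>)"
      using V(2) sum_err[of "mode_error n d ?S U", OF errU] by linarith
    then have "?w * (\<Sum>i\<in>?I. \<bar>rounded n d ?S U i - U i\<bar>) \<le> ?w * (2 * (d * \<epsilon>))"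
      by (rule mult_left_mono) (rule entry_range_nonneg[OF n])
    moreover have "(\<Sum>i\<in>?I. rounded n d ?S U i) = (\<Sum>i\<in>?I. U i)" using total[OF V(1) S1[OF d0]] U1 by simp
    note tensor_inner_le_entry_range[OF this, of C]
    ultimately show ?thesis by linarith
  qed
  moreover have "tensor_inner n d C B \<le> tensor_inner n d C (rounded n d ?S U) + real d * ln (real n) / \<eta>"
    by (rule scaled_kernel_near_optimal[OF B n eta V(1)])
  ultimately show "tensor_inner n d C (rounded n d P B) \<le>
      tot_value n d C P + 4 * real d * \<epsilon> * ?w + real d * ln (real n) / \<eta>"
    using U(2) by (simp add: algebra_simps)
qed

text \<open>Members of the polytope have mass 1, so every objective value is an average of entries
  of \<open>C\<close>. This settles the case of large \<open>\<delta>\<close>.\<close>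

lemma polytope_near_optimal:
  assumes n: "1 \<le> n" and d: "1 \<le> d" and P: "\<And>j. j < d \<Longrightarrow> P j \<in> positive_prob_vectors n"
    and V: "V \<in> transport_polytope n d P"
  shows "tensor_inner n d C V \<le> tot_value n d C P + entry_range n d C"
proof -
  let ?I = "multi_indices n d"
  have P1: "(\<Sum>k<n. P 0 k) = 1" using P[of 0] d by (simp add: positive_prob_vectors_def)
  have total: "(\<Sum>i\<in>?I. U i) = 1" if "U \<in> transport_polytope n d P" for U
    using that d P1 sum_marginal[of 0 d n U] by (simp add: transport_polytope_def)
  obtain U where U: "U \<in> transport_polytope n d P" "tot_value n d C P = tensor_inner n d C U"
    using tot_value_attained(1)[of d P n C] d P by auto
  have "tensor_inner n d C V \<le> (\<Sum>i\<in>?I. Max (C ` ?I) * V i)"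
    unfolding tensor_inner_def using V entry_le_Max_Min(1)[of _ n d C]
    by (intro sum_mono mult_right_mono) (auto simp: transport_polytope_def)
  moreover have "(\<Sum>i\<in>?I. Min (C ` ?I) * U i) \<le> tensor_inner n d C U"
    unfolding tensor_inner_def using U(1) entry_le_Max_Min(2)[of _ n d C]
    by (intro sum_mono mult_right_mono) (auto simp: transport_polytope_def)
  ultimately show ?thesis
    using U(2) total[OF V] total[OF U(1)]
    by (simp add: sum_distrib_left[symmetric] entry_range_def)
qed

section \<open>Addresses of multi-indices\<close>

text \<open>Base-\<open>n\<close> digits are recovered by induction on \<open>d\<close>, splitting
  off the most significant one.\<close>

lemma address_digits:
  assumes "\<And>l. l < d \<Longrightarrow> i l < n"
  shows "address n d i < n ^ d" and "\<And>j. j < d \<Longrightarrow> address n d i div n ^ j mod n = i j"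
proof -
  have "address n d i < n ^ d \<and> (\<forall>j<d. address n d i div n ^ j mod n = i j)"
    using assms
  proof (induction d)
    case 0
    then show ?case by (simp add: address_def)
  next
    case (Suc d)
    let ?A = "address n d i"
    have IH: "?A < n ^ d" "\<And>j. j < d \<Longrightarrow> ?A div n ^ j mod n = i j" using Suc by auto
    have id: "i d < n" using Suc.prems by simp
    have A: "address n (Suc d) i = i d * n ^ d + ?A" by (simp add: address_def)
    have "i d * n ^ d + ?A < Suc (i d) * n ^ d" using IH(1) by simp
    also have "\<dots> \<le> n * n ^ d" using id by (intro mult_le_mono1) simp
    finally have 1: "address n (Suc d) i < n ^ Suc d" by (simp add: A)
    have 2: "address n (Suc d) i div n ^ j mod n = i j" if "j < Suc d" for j
    proof (cases "j = d")
      case True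
      then show ?thesis using IH(1) id by (simp add: A)
    next
      case False
      then have j: "j < d" using that by simp
      \<comment> \<open>For a lower digit the leading term is a multiple of
        \<open>n ^ j * n\<close>, so \<open>div n ^ j\<close> followed by \<open>mod n\<close>
        erases it.\<close>
      then obtain e where e: "d = Suc (j + e)" using less_iff_Suc_add by auto
      have n: "0 < n" using id by simp
      have nd: "n ^ d = n ^ j * (n * n ^ e)" by (simp add: e power_add)
      have "address n (Suc d) i = ?A + n ^ j * (n * (i d * n ^ e))"
        by (simp add: A nd)
      then have "address n (Suc d) i div n ^ j = ?A div n ^ j + n * (i d * n ^ e)"
        using n by simp
      then show ?thesis using IH(2)[OF j] by simp
    qed
    show ?case using 1 2 by blast
  qed
  then show "address n d i < n ^ d" and "\<And>j. j < d \<Longrightarrow> address n d i div n ^ j mod n = i j"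
    by auto
qed

lemma bij_betw_address: "bij_betw (address n d) (multi_indices n d) {..<n ^ d}"
proof -
  have dig: "address n d i < n ^ d" "\<And>j. j < d \<Longrightarrow> address n d i div n ^ j mod n = i j"
    if "i \<in> multi_indices n d" for i
    using address_digits[of d i n] that by (auto simp: multi_indices_def PiE_iff)
  have inj: "inj_on (address n d) (multi_indices n d)"
  proof (rule inj_onI)
    fix x y assume xy: "x \<in> multi_indices n d" "y \<in> multi_indices n d" "address n d x = address n d y"
    then have "x j = y j" if "j < d" for j using dig(2)[OF _ that] by metis
    then show "x = y" using xy(1,2) unfolding multi_indices_def by (intro PiE_ext) auto
  qed
  \<comment> \<open>Surjectivity by counting: the injective image lies in \<open>{..<n ^ d}\<close>
    and has \<open>n ^ d\<close> elements.\<close>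
  moreover have "address n d ` multi_indices n d = {..<n ^ d}"
    using dig(1) card_image[OF inj]
    by (intro card_subset_eq) (auto simp: multi_indices_def card_PiE)
  ultimately show ?thesis by (simp add: bij_betw_def)
qed

lemma sum_address: "(\<Sum>i\<in>multi_indices n d. f (address n d i)) = (\<Sum>a<n ^ d. f a)"
  by (rule sum.reindex_bij_betw[OF bij_betw_address])

lemma address_less: "i \<in> multi_indices n d \<Longrightarrow> address n d i < n ^ d"
  using address_digits(1)[of d i n] by (auto simp: multi_indices_def PiE_iff)

lemma digit_address: "i \<in> multi_indices n d \<Longrightarrow> j < d \<Longrightarrow> address n d i div n ^ j mod n = i j"
  using address_digits(2)[of d i n] by (auto simp: multi_indices_def PiE_iff)

text \<open>Connects the machine view of a slice, the addresses with a given digit, with the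
  mathematical marginal.\<close>

lemma sum_digit:
  assumes "j < d"
  shows "(\<Sum>a | a < n ^ d \<and> a div n ^ j mod n = k. s b a) = marginal n d (stored_tensor n d s b) j k"
proof -
  have "(\<Sum>a | a < n ^ d \<and> a div n ^ j mod n = k. s b a) =
      (\<Sum>a<n ^ d. if a div n ^ j mod n = k then s b a else 0)"
    by (simp add: sum.inter_filter[symmetric])
  also have "\<dots> = (\<Sum>i\<in>multi_indices n d. if i j = k then s b (address n d i) else 0)"
    unfolding sum_address[symmetric]
    by (intro sum.cong refl if_cong) (simp_all add: digit_address assms)
  finally show ?thesis by (simp add: marginal_def stored_tensor_def sum.inter_filter)
qed

section \<open>Rules for execution with bounded cost\<close>

text \<open>A total-correctness judgement. The exact cost in \<open>exec\<close> is relaxed to an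
  upper bound, so that branches of different cost can share one bound.\<close>

definition runs :: "ienv \<Rightarrow> com \<Rightarrow> store \<Rightarrow> nat \<Rightarrow> (store \<Rightarrow> bool) \<Rightarrow> bool" where
  "runs E c s b Q \<longleftrightarrow> (\<exists>t s'. exec E c s t s' \<and> t \<le> b \<and> Q s')"

lemma runs_mono:
  "runs E c s b Q \<Longrightarrow> b \<le> b' \<Longrightarrow> (\<And>s'. Q s' \<Longrightarrow> Q' s') \<Longrightarrow> runs E c s b' Q'"
  unfolding runs_def by (meson order.trans)

lemma runs_Skip: "Q s \<Longrightarrow> runs E Skip s b Q"
  unfolding runs_def by (meson exec.Skip zero_le)

lemma runs_Assign:
  "rdefined E s e \<Longrightarrow> rcost e \<le> b \<Longrightarrow> Q (s(a := (s a)(ival E x := rval E s e))) \<Longrightarrow>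
   runs E (Assign a x e) s b Q"
  unfolding runs_def by (meson exec.Assign)

lemma runs_Seq:
  "runs E c1 s b1 R \<Longrightarrow> (\<And>s'. R s' \<Longrightarrow> runs E c2 s' b2 Q) \<Longrightarrow> runs E (Seq c1 c2) s (b1 + b2) Q"
  unfolding runs_def by (meson exec.Seq add_mono)

lemma runs_If:
  assumes "rdefined E s x" "rdefined E s y"
    and "rval E s x < rval E s y \<Longrightarrow> runs E c1 s b Q"
    and "\<not> rval E s x < rval E s y \<Longrightarrow> runs E c2 s b Q"
  shows "runs E (IfLess x y c1 c2) s (Suc (rcost x + rcost y) + b) Q"
proof (cases "rval E s x < rval E s y")
  case True
  then obtain t s' where "exec E c1 s t s'" "t \<le> b" "Q s'" using assms(3) unfolding runs_def by blast
  then show ?thesis unfolding runs_def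
    using exec.IfTrue[OF assms(1,2) True, of c1 t s' c2] by (meson add_left_mono)
next
  case False
  then obtain t s' where "exec E c2 s t s'" "t \<le> b" "Q s'" using assms(4) unfolding runs_def by blast
  then show ?thesis unfolding runs_def
    using exec.IfFalse[OF assms(1,2) False, of c2 t s' c1] by (meson add_left_mono)
qed

text \<open>The rule for \<open>For\<close> in \<open>exec\<close> asks for the complete sequences
  of stores and costs, which are built here one iteration at a time. Costs may vary with the
  counter, as needed for the geometric sum of the product program.\<close>

lemma runs_For_sum:
  assumes "I 0 s"
    and step: "\<And>i s. i < ival E x \<Longrightarrow> I i s \<Longrightarrow> runs (E(v := i)) c s (b i) (I (Suc i))"
  shows "runs E (For v x c) s (\<Sum>i<ival E x. b i) (I (ival E x))"
proof -
  have "\<exists>S T. S 0 = s \<and> (\<forall>i<N. exec (E(v := i)) c (S i) (T i) (S (Suc i)) \<and> T i \<le> b i) \<and> I N (S N)"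
    if "N \<le> ival E x" for N
    using that
  proof (induction N)
    case 0
    then show ?case using assms(1) by (intro exI[of _ "\<lambda>_. s"]) simp
  next
    case (Suc N)
    then obtain S T where ST: "S 0 = s" "I N (S N)"
      "\<And>i. i < N \<Longrightarrow> exec (E(v := i)) c (S i) (T i) (S (Suc i)) \<and> T i \<le> b i"
      by (meson Suc_leD)
    obtain t s' where s': "exec (E(v := N)) c (S N) t s'" "t \<le> b N" "I (Suc N) s'"
      using step[OF _ ST(2)] Suc.prems unfolding runs_def by auto
    define S' T' where "S' = S(Suc N := s')" and "T' = T(N := t)"
    have "\<forall>i<Suc N. exec (E(v := i)) c (S' i) (T' i) (S' (Suc i)) \<and> T' i \<le> b i"
    proof (intro allI impI)
      fix i assume "i < Suc N"
      then show "exec (E(v := i)) c (S' i) (T' i) (S' (Suc i)) \<and> T' i \<le> b i"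
        using ST(3)[of i] s' unfolding S'_def T'_def by (cases "i = N") simp_all
    qed
    moreover have "S' 0 = s" "I (Suc N) (S' (Suc N))" using ST(1) s'(3) by (simp_all add: S'_def)
    ultimately show ?case by blast
  qed
  then obtain S T where ST: "S 0 = s" "I (ival E x) (S (ival E x))"
      "\<And>i. i < ival E x \<Longrightarrow> exec (E(v := i)) c (S i) (T i) (S (Suc i)) \<and> T i \<le> b i"
    by (meson order_refl)
  then have "exec E (For v x c) (S 0) (\<Sum>i<ival E x. T i) (S (ival E x))"
    by (intro exec.For) blast
  moreover have "(\<Sum>i<ival E x. T i) \<le> (\<Sum>i<ival E x. b i)" using ST(3) by (intro sum_mono) simp
  ultimately show ?thesis using ST(1,2) unfolding runs_def by blast
qed

lemma runs_For:
  assumes "I 0 s"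
    and "\<And>i s. i < ival E x \<Longrightarrow> I i s \<Longrightarrow> runs (E(v := i)) c s b (I (Suc i))"
    and "\<And>s. I (ival E x) s \<Longrightarrow> Q s"
  shows "runs E (For v x c) s (ival E x * b) Q"
  using runs_mono[OF runs_For_sum[of I s E x v c "\<lambda>_. b", OF assms(1,2)] _ assms(3)] by simp

text \<open>The index \<open>k\<close> of the invariant is a ghost counter of completed iterations.
  A true guard forces \<open>k < N\<close>, so \<open>N\<close> bounds their number; the extra
  summand pays for the last, failing test. The induction is on \<open>N - k\<close>.\<close>

lemma runs_While:
  assumes "I 0 s"
    and defd: "\<And>k s. I k s \<Longrightarrow> rdefined E s x \<and> rdefined E s y"
    and step: "\<And>k s. I k s \<Longrightarrow> rval E s x < rval E s y \<Longrightarrow> k < N \<and> runs E c s b (I (Suc k))"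
    and Q: "\<And>k s. I k s \<Longrightarrow> \<not> rval E s x < rval E s y \<Longrightarrow> Q s"
  shows "runs E (WhileLess x y c) s (N * (Suc (rcost x + rcost y) + b) + Suc (rcost x + rcost y)) Q"
proof -
  let ?g = "Suc (rcost x + rcost y)"
  have "runs E (WhileLess x y c) s ((N - k) * (?g + b) + ?g) Q" if "I k s" for k s
    using that
  proof (induction "N - k" arbitrary: k s)
    case 0
    \<comment> \<open>The budget is exhausted, so by \<open>step\<close> the guard cannot
      hold.\<close>
    then have "\<not> rval E s x < rval E s y" using step[OF 0(2)] by auto
    then have "exec E (WhileLess x y c) s ?g s" "Q s"
      using defd[OF 0(2)] Q[OF 0(2)] by (auto intro: exec.WhileFalse)
    then show ?case unfolding runs_def by (meson le_add2)
  next
    case (Suc m)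
    show ?case
    proof (cases "rval E s x < rval E s y")
      case True
      obtain t1 s1 where 1: "exec E c s t1 s1" "t1 \<le> b" "I (Suc k) s1"
        using step[OF Suc(3) True] unfolding runs_def by blast
      have m: "m = N - Suc k" using Suc(2) by simp
      obtain t2 s2 where 2: "exec E (WhileLess x y c) s1 t2 s2" "t2 \<le> m * (?g + b) + ?g" "Q s2"
        using Suc(1)[OF m 1(3)] m unfolding runs_def by blast
      have "exec E (WhileLess x y c) s (?g + t1 + t2) s2"
        using exec.WhileTrue[OF _ _ True 1(1) 2(1)] defd[OF Suc(3)] by blast
      moreover have "?g + t1 + t2 \<le> (N - k) * (?g + b) + ?g"
        using 1(2) 2(2) by (simp add: Suc(2)[symmetric])
      ultimately show ?thesis using 2(3) unfolding runs_def by blast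
    next
      case False
      then have "exec E (WhileLess x y c) s ?g s" "Q s"
        using defd[OF Suc(3)] Q[OF Suc(3)] by (auto intro: exec.WhileFalse)
      then show ?thesis unfolding runs_def by (meson le_add2)
    qed
  qed
  from this[OF assms(1)] show ?thesis by simp
qed

text \<open>Rule for updating an array in place: cells from \<open>i\<close> on still have their
  original content when iteration \<open>i\<close> starts, so \<open>f i\<close> may depend on the
  old value of cell \<open>i\<close>.\<close>

lemma runs_For_map:
  assumes "\<And>i h. i < ival E x \<Longrightarrow> (\<And>a. i \<le> a \<Longrightarrow> h a = s arr a) \<Longrightarrow>
      runs (E(v := i)) c (s(arr := h)) b (\<lambda>s'. s' = s(arr := h(i := f i)))"
  shows "runs E (For v x c) s (ival E x * b) (\<lambda>s'. \<exists>h. s' = s(arr := h) \<and> (\<forall>i<ival E x. h i = f i))"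
proof (rule runs_For[where I = "\<lambda>i s'. \<exists>h. s' = s(arr := h) \<and> (\<forall>a<i. h a = f a) \<and> (\<forall>a\<ge>i. h a = s arr a)"])
  fix i s' assume i: "i < ival E x"
    and "\<exists>h. s' = s(arr := h) \<and> (\<forall>a<i. h a = f a) \<and> (\<forall>a\<ge>i. h a = s arr a)"
  then obtain h where h: "s' = s(arr := h)" "\<forall>a<i. h a = f a" "\<forall>a\<ge>i. h a = s arr a" by blast
  have "runs (E(v := i)) c s' b (\<lambda>s'. s' = s(arr := h(i := f i)))"
    unfolding h(1) using i h(3) by (intro assms) auto
  then show "runs (E(v := i)) c s' b
      (\<lambda>s'. \<exists>h. s' = s(arr := h) \<and> (\<forall>a<Suc i. h a = f a) \<and> (\<forall>a\<ge>Suc i. h a = s arr a))"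
  proof (rule runs_mono[OF _ order_refl])
    fix s'' assume "s'' = s(arr := h(i := f i))"
    then show "\<exists>h. s'' = s(arr := h) \<and> (\<forall>a<Suc i. h a = f a) \<and> (\<forall>a\<ge>Suc i. h a = s arr a)"
      using h(2,3) by (intro exI[of _ "h(i := f i)"]) (auto simp: less_Suc_eq)
  qed
qed (rule exI[of _ "s arr"], simp, blast)

lemma runs_For_accumulate:
  assumes "\<And>i h. i < ival E x \<Longrightarrow>
      runs (E(v := i)) c (s(arr := h)) b (\<lambda>s'. s' = s(arr := h(0 := h 0 + f i)))"
  shows "runs E (For v x c) s (ival E x * b)
    (\<lambda>s'. \<exists>h. s' = s(arr := h) \<and> h 0 = s arr 0 + (\<Sum>i<ival E x. f i))"
proof (rule runs_For[where I = "\<lambda>i s'. \<exists>h. s' = s(arr := h) \<and> h 0 = s arr 0 + (\<Sum>a<i. f a)"])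
  fix i s' assume i: "i < ival E x" and "\<exists>h. s' = s(arr := h) \<and> h 0 = s arr 0 + (\<Sum>a<i. f a)"
  then obtain h where h: "s' = s(arr := h)" "h 0 = s arr 0 + (\<Sum>a<i. f a)" by blast
  have "runs (E(v := i)) c s' b (\<lambda>s'. s' = s(arr := h(0 := h 0 + f i)))"
    unfolding h(1) by (rule assms[OF i])
  then show "runs (E(v := i)) c s' b (\<lambda>s'. \<exists>h. s' = s(arr := h) \<and> h 0 = s arr 0 + (\<Sum>a<Suc i. f a))"
  proof (rule runs_mono[OF _ order_refl])
    fix s'' assume "s'' = s(arr := h(0 := h 0 + f i))"
    then show "\<exists>h. s'' = s(arr := h) \<and> h 0 = s arr 0 + (\<Sum>a<Suc i. f a)"
      using h(2) by (intro exI[of _ "h(0 := h 0 + f i)"]) simp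
  qed
qed (auto intro!: exI[of _ "s arr"])

section \<open>Sinkhorn iteration as a program\<close>

definition same_except :: "string set \<Rightarrow> store \<Rightarrow> store \<Rightarrow> bool" where
  "same_except X s s' \<longleftrightarrow> (\<forall>x. x \<notin> X \<longrightarrow> s' x = s x)"

abbreviation entries :: iexp where
  "entries \<equiv> IPow (IVar ''n'') (IVar ''d'')"

abbreviation digit :: iexp where
  "digit \<equiv> IMod (IDiv (IVar ''a'') (IPow (IVar ''n'') (IVar ''j''))) (IVar ''n'')"

abbreviation row_index :: "iexp \<Rightarrow> iexp" where
  "row_index k \<equiv> IAdd (IMul (IVar ''j'') (IVar ''n'')) k"

abbreviation scalar :: "string \<Rightarrow> rexp" where
  "scalar x \<equiv> Cell x (INum 0)"

abbreviation set_scalar :: "string \<Rightarrow> rexp \<Rightarrow> com" where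
  "set_scalar x \<equiv> Assign x (INum 0)"

section \<open>Testing and rescaling a single mode\<close>

definition marginal_prog :: com where
  "marginal_prog =
     Seq (For ''k'' (IVar ''n'') (Assign ''M'' (IVar ''k'') (OfIndex (INum 0))))
       (For ''a'' entries (Assign ''M'' digit (Add (Cell ''M'' digit) (Cell ''B'' (IVar ''a'')))))"

text \<open>One addition per tensor entry; clearing the \<open>n\<close> sums is free, because
  loading an index value costs nothing.\<close>

lemma runs_marginal_prog:
  assumes E: "E ''n'' = n" "E ''d'' = d" "E ''j'' = j" and j: "j < d"
  shows "runs E marginal_prog s (n ^ d) (\<lambda>s'. \<exists>g. s' = s(''M'' := g) \<and>
    (\<forall>k<n. g k = marginal n d (stored_tensor n d s ''B'') j k))"
proof -
  let ?S = "\<lambda>N k. \<Sum>a | a < N \<and> a div n ^ j mod n = k. s ''B'' a"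
  \<comment> \<open>Entry \<open>i\<close> contributes to exactly one of the \<open>n\<close>
    partial sums, the one named by its digit; this matches the single update in the loop
    body.\<close>
  have S: "?S (Suc i) k = ?S i k + (if i div n ^ j mod n = k then s ''B'' i else 0)" for i k
  proof -
    have "{a. a < Suc i \<and> a div n ^ j mod n = k} =
        (if i div n ^ j mod n = k then insert i else id) {a. a < i \<and> a div n ^ j mod n = k}"
      by (auto simp: less_Suc_eq)
    then show ?thesis by simp
  qed
  have "runs E (For ''k'' (IVar ''n'') (Assign ''M'' (IVar ''k'') (OfIndex (INum 0)))) s
    (ival E (IVar ''n'') * 0) (\<lambda>s'. \<exists>h. s' = s(''M'' := h) \<and> (\<forall>k<ival E (IVar ''n''). h k = 0))"
    by (rule runs_For_map) (rule runs_Assign; simp)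
  then have 1: "runs E (For ''k'' (IVar ''n'') (Assign ''M'' (IVar ''k'') (OfIndex (INum 0)))) s
    0 (\<lambda>s'. \<exists>h. s' = s(''M'' := h) \<and> (\<forall>k<n. h k = 0))" by (simp add: E)
  have 2: "runs E (For ''a'' entries (Assign ''M'' digit (Add (Cell ''M'' digit) (Cell ''B'' (IVar ''a'')))))
      (s(''M'' := h)) (ival E entries * 1) (\<lambda>s'. \<exists>g. s' = s(''M'' := g) \<and> (\<forall>k<n. g k = ?S (n ^ d) k))"
    if h: "\<forall>k<n. h k = 0" for h
  proof (rule runs_For[where I = "\<lambda>i s'. \<exists>g. s' = s(''M'' := g) \<and> (\<forall>k<n. g k = ?S i k)"])
    fix i s' assume "i < ival E entries" "\<exists>g. s' = s(''M'' := g) \<and> (\<forall>k<n. g k = ?S i k)"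
    then obtain g where g: "s' = s(''M'' := g)" "\<forall>k<n. g k = ?S i k" by blast
    let ?k = "i div n ^ j mod n"
    show "runs (E(''a'' := i)) (Assign ''M'' digit (Add (Cell ''M'' digit) (Cell ''B'' (IVar ''a'')))) s' 1
        (\<lambda>s'. \<exists>g. s' = s(''M'' := g) \<and> (\<forall>k<n. g k = ?S (Suc i) k))"
      by (rule runs_Assign) (use g(2) in \<open>auto simp: E g(1) S intro!: exI[of _ "g(?k := g ?k + s ''B'' i)"]\<close>)
  qed (use h in \<open>auto simp: E\<close>)
  have "runs E marginal_prog s (0 + ival E entries * 1)
      (\<lambda>s'. \<exists>g. s' = s(''M'' := g) \<and> (\<forall>k<n. g k = ?S (n ^ d) k))"
    unfolding marginal_prog_def
  proof (rule runs_Seq[OF 1])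
    fix s1 assume "\<exists>h. s1 = s(''M'' := h) \<and> (\<forall>k<n. h k = 0)"
    then obtain h where "s1 = s(''M'' := h)" "\<forall>k<n. h k = 0" by blast
    then show "runs E (For ''a'' entries (Assign ''M'' digit (Add (Cell ''M'' digit) (Cell ''B'' (IVar ''a'')))))
        s1 (ival E entries * 1) (\<lambda>s'. \<exists>g. s' = s(''M'' := g) \<and> (\<forall>k<n. g k = ?S (n ^ d) k))"
      using 2 by simp
  qed
  then show ?thesis by (simp add: E sum_digit[OF j])
qed

definition holds_marginals :: "nat \<Rightarrow> nat \<Rightarrow> (nat \<Rightarrow> nat \<Rightarrow> real) \<Rightarrow> store \<Rightarrow> bool" where
  "holds_marginals n d P s \<longleftrightarrow> (\<forall>j<d. \<forall>k<n. s ''P'' (j * n + k) = P j k)"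

definition scale_prog :: com where
  "scale_prog = For ''a'' entries (Assign ''B'' (IVar ''a'')
     (Mul (Cell ''B'' (IVar ''a'')) (Divide (Cell ''P'' (row_index digit)) (Cell ''M'' digit))))"

lemma runs_scale_prog:
  assumes E: "E ''n'' = n" "E ''d'' = d" "E ''j'' = j" and "1 \<le> n" "j < d"
    and P: "holds_marginals n d P s" and M: "\<And>k. k < n \<Longrightarrow> s ''M'' k \<noteq> 0"
  shows "runs E scale_prog s (n ^ d * 2) (\<lambda>s'. \<exists>h. s' = s(''B'' := h) \<and>
    (\<forall>a<n ^ d. h a = s ''B'' a * (P j (a div n ^ j mod n) / s ''M'' (a div n ^ j mod n))))"
proof -
  have "runs E scale_prog s (ival E entries * 2) (\<lambda>s'. \<exists>h. s' = s(''B'' := h) \<and>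
    (\<forall>a<ival E entries. h a = s ''B'' a * (P j (a div n ^ j mod n) / s ''M'' (a div n ^ j mod n))))"
    unfolding scale_prog_def
    by (rule runs_For_map; rule runs_Assign)
      (use assms(4,5) P M in \<open>simp_all add: E holds_marginals_def\<close>)
  then show ?thesis by (simp add: E)
qed

text \<open>The machine has no absolute value, so a comparison selects the sign of each
  difference.\<close>

definition error_prog :: com where
  "error_prog = Seq (set_scalar ''err'' (OfIndex (INum 0)))
     (For ''k'' (IVar ''n'') (IfLess (Cell ''M'' (IVar ''k'')) (Cell ''P'' (row_index (IVar ''k'')))
       (set_scalar ''err'' (Add (scalar ''err'') (Sub (Cell ''P'' (row_index (IVar ''k''))) (Cell ''M'' (IVar ''k'')))))
       (set_scalar ''err'' (Add (scalar ''err'') (Sub (Cell ''M'' (IVar ''k'')) (Cell ''P'' (row_index (IVar ''k''))))))))"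

lemma runs_error_prog:
  assumes E: "E ''n'' = n" "E ''j'' = j" and j: "j < d" and P: "holds_marginals n d P s"
  shows "runs E error_prog s (n * 3) (\<lambda>s'. \<exists>h. s' = s(''err'' := h) \<and>
    h 0 = (\<Sum>k<n. \<bar>s ''M'' k - P j k\<bar>))"
proof -
  let ?loop = "For ''k'' (IVar ''n'') (IfLess (Cell ''M'' (IVar ''k'')) (Cell ''P'' (row_index (IVar ''k'')))
       (set_scalar ''err'' (Add (scalar ''err'') (Sub (Cell ''P'' (row_index (IVar ''k''))) (Cell ''M'' (IVar ''k'')))))
       (set_scalar ''err'' (Add (scalar ''err'') (Sub (Cell ''M'' (IVar ''k'')) (Cell ''P'' (row_index (IVar ''k'')))))))"
  have 1: "runs E (set_scalar ''err'' (OfIndex (INum 0))) s 0 (\<lambda>s'. s' = s(''err'' := (s ''err'')(0 := 0)))"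
    by (rule runs_Assign) auto
  have 2: "runs E ?loop s1 (ival E (IVar ''n'') * (Suc (0 + 0) + 2)) (\<lambda>s'. \<exists>h. s' = s1(''err'' := h) \<and>
      h 0 = s1 ''err'' 0 + (\<Sum>k<ival E (IVar ''n''). \<bar>s ''M'' k - P j k\<bar>))"
    if s1: "s1 = s(''err'' := (s ''err'')(0 := 0))" for s1
  proof (rule runs_For_accumulate)
    fix k h assume k: "k < ival E (IVar ''n'')"
    have "runs (E(''k'' := k)) (IfLess (Cell ''M'' (IVar ''k'')) (Cell ''P'' (row_index (IVar ''k'')))
       (set_scalar ''err'' (Add (scalar ''err'') (Sub (Cell ''P'' (row_index (IVar ''k''))) (Cell ''M'' (IVar ''k'')))))
       (set_scalar ''err'' (Add (scalar ''err'') (Sub (Cell ''M'' (IVar ''k'')) (Cell ''P'' (row_index (IVar ''k'')))))))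
      (s1(''err'' := h)) (Suc (rcost (Cell ''M'' (IVar ''k'')) + rcost (Cell ''P'' (row_index (IVar ''k'')))) + 2)
      (\<lambda>s'. s' = s1(''err'' := h(0 := h 0 + \<bar>s ''M'' k - P j k\<bar>)))"
      by (rule runs_If; (rule runs_Assign)?)
        (use k j P in \<open>simp_all add: s1 E holds_marginals_def abs_if\<close>)
    then show "runs (E(''k'' := k)) (IfLess (Cell ''M'' (IVar ''k'')) (Cell ''P'' (row_index (IVar ''k'')))
       (set_scalar ''err'' (Add (scalar ''err'') (Sub (Cell ''P'' (row_index (IVar ''k''))) (Cell ''M'' (IVar ''k'')))))
       (set_scalar ''err'' (Add (scalar ''err'') (Sub (Cell ''M'' (IVar ''k'')) (Cell ''P'' (row_index (IVar ''k'')))))))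
      (s1(''err'' := h)) (Suc (0 + 0) + 2)
      (\<lambda>s'. s' = s1(''err'' := h(0 := h 0 + \<bar>s ''M'' k - P j k\<bar>)))" by simp
  qed
  have "runs E error_prog s (0 + ival E (IVar ''n'') * (Suc (0 + 0) + 2)) (\<lambda>s'. \<exists>h. s' = s(''err'' := h) \<and>
    h 0 = (\<Sum>k<n. \<bar>s ''M'' k - P j k\<bar>))"
    unfolding error_prog_def
  proof (rule runs_Seq[OF 1])
    fix s1 assume s1: "s1 = s(''err'' := (s ''err'')(0 := 0))"
    show "runs E ?loop s1 (ival E (IVar ''n'') * (Suc (0 + 0) + 2)) (\<lambda>s'. \<exists>h. s' = s(''err'' := h) \<and>
        h 0 = (\<Sum>k<n. \<bar>s ''M'' k - P j k\<bar>))"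
      by (rule runs_mono[OF 2[OF s1] order_refl]) (auto simp: s1 E)
  qed
  then show ?thesis by (rule runs_mono) (simp_all add: E)
qed

text \<open>The flag is raised here but never lowered, so after a loop over the modes it tells
  whether any of them was rescaled.\<close>

definition mode_step :: com where
  "mode_step = Seq marginal_prog (Seq error_prog
     (IfLess (scalar ''eps'') (scalar ''err'')
       (Seq (set_scalar ''flag'' (OfIndex (INum 1))) scale_prog) Skip))"

lemma runs_mode_step:
  fixes n d s
  defines "B \<equiv> stored_tensor n d s ''B''"
  assumes E: "E ''n'' = n" "E ''d'' = d" "E ''j'' = j" and n: "1 \<le> n" and j: "j < d"
    and P: "holds_marginals n d P s" and B: "\<And>i. i \<in> multi_indices n d \<Longrightarrow> 0 < B i"
  shows "runs E mode_step s (7 * n ^ d) (\<lambda>s'. same_except {''B'', ''M'', ''err'', ''flag''} s s' \<and>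
    (mode_error n d P B j \<le> s ''eps'' 0 \<and> s' ''flag'' 0 = s ''flag'' 0 \<and> s' ''B'' = s ''B'' \<or>
     s ''eps'' 0 < mode_error n d P B j \<and> s' ''flag'' 0 = 1 \<and>
       (\<forall>i\<in>multi_indices n d. stored_tensor n d s' ''B'' i = B i * (P j (i j) / marginal n d B j (i j)))))"
    (is "runs E mode_step s _ ?Q")
proof -
  let ?m = "marginal n d B j"
  have m: "0 < ?m k" if "k < n" for k
    using marginal_pos[where n = n and d = d and U = B] B j that by blast
  note 1 = runs_marginal_prog[where s = s, OF E j, folded B_def]
  \<comment> \<open>As \<open>1 <= d\<close>, both 1 and \<open>n\<close> are at most
    \<open>n ^ d\<close>; the coefficients 1, 3, 1 and 2 add up to 7.\<close>
  have b: "n ^ d + (n * 3 + (Suc (rcost (scalar ''eps'') + rcost (scalar ''err'')) + (0 + n ^ d * 2))) \<le> 7 * n ^ d"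
    using self_le_power[OF n, of d] j one_le_power[OF n, of d] by simp
  have "runs E mode_step s
     (n ^ d + (n * 3 + (Suc (rcost (scalar ''eps'') + rcost (scalar ''err'')) + (0 + n ^ d * 2)))) ?Q"
    unfolding mode_step_def
  proof (rule runs_Seq[OF 1], elim exE conjE)
    fix s1 g assume s1: "s1 = s(''M'' := g)" and g: "\<forall>k<n. g k = ?m k"
    have P1: "holds_marginals n d P s1" using P by (simp add: s1 holds_marginals_def)
    have "(\<Sum>k<n. \<bar>s1 ''M'' k - P j k\<bar>) = mode_error n d P B j"
      using g by (simp add: s1 mode_error_def)
    note 2 = runs_error_prog[OF E(1,3) j P1, unfolded this]
    show "runs E (Seq error_prog
     (IfLess (scalar ''eps'') (scalar ''err'')
       (Seq (set_scalar ''flag'' (OfIndex (INum 1))) scale_prog) Skip)) s1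
       (n * 3 + (Suc (rcost (scalar ''eps'') + rcost (scalar ''err'')) + (0 + n ^ d * 2))) ?Q"
    proof (rule runs_Seq[OF 2], elim exE conjE)
      fix s2 e assume s2: "s2 = s1(''err'' := e)" and e: "e 0 = mode_error n d P B j"
      show "runs E (IfLess (scalar ''eps'') (scalar ''err'')
       (Seq (set_scalar ''flag'' (OfIndex (INum 1))) scale_prog) Skip) s2
       (Suc (rcost (scalar ''eps'') + rcost (scalar ''err'')) + (0 + n ^ d * 2)) ?Q"
      proof (rule runs_If)
        assume "\<not> rval E s2 (scalar ''eps'') < rval E s2 (scalar ''err'')"
        then show "runs E Skip s2 (0 + n ^ d * 2) ?Q"
          by (intro runs_Skip) (auto simp: s1 s2 e same_except_def)
      next
        assume lt: "rval E s2 (scalar ''eps'') < rval E s2 (scalar ''err'')"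
        have 3: "runs E (set_scalar ''flag'' (OfIndex (INum 1))) s2 0
            (\<lambda>s'. s' = s2(''flag'' := (s2 ''flag'')(0 := 1)))"
          by (rule runs_Assign) auto
        show "runs E (Seq (set_scalar ''flag'' (OfIndex (INum 1))) scale_prog) s2 (0 + n ^ d * 2) ?Q"
        proof (rule runs_Seq[OF 3])
          fix s3 assume s3: "s3 = s2(''flag'' := (s2 ''flag'')(0 := 1))"
          have P3: "holds_marginals n d P s3" using P by (simp add: s1 s2 s3 holds_marginals_def)
          have M3: "s3 ''M'' k \<noteq> 0" if "k < n" for k using m[OF that] g that by (simp add: s1 s2 s3)
          show "runs E scale_prog s3 (n ^ d * 2) ?Q"
          proof (rule runs_mono[OF runs_scale_prog[OF E n j P3 M3] order_refl])
            fix s4 assume "\<exists>h. s4 = s3(''B'' := h) \<and>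
              (\<forall>a<n ^ d. h a = s3 ''B'' a * (P j (a div n ^ j mod n) / s3 ''M'' (a div n ^ j mod n)))"
            then obtain h where h: "s4 = s3(''B'' := h)"
              "\<forall>a<n ^ d. h a = s3 ''B'' a * (P j (a div n ^ j mod n) / s3 ''M'' (a div n ^ j mod n))"
              by blast
            have "stored_tensor n d s4 ''B'' i = B i * (P j (i j) / ?m (i j))"
              if i: "i \<in> multi_indices n d" for i
              using h(2) g address_less[OF i] multi_indices_less[OF i j]
              by (simp add: stored_tensor_def h(1) digit_address[OF i j] B_def s1 s2 s3)
            then show "?Q s4" using lt by (auto simp: h(1) s1 s2 s3 e same_except_def)
          qed simp
        qed
      qed auto
    qed
  qed
  then show ?thesis by (rule runs_mono) (use b in auto)
qed

section \<open>Sweeps over all modes and a bound on their number\<close>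

lemma same_except_refl: "same_except X s s"
  by (simp add: same_except_def)

lemma same_except_trans: "same_except X s s1 \<Longrightarrow> same_except X s1 s2 \<Longrightarrow> same_except X s s2"
  by (simp add: same_except_def)

lemma same_except_update: "same_except X s s' \<Longrightarrow> a \<in> X \<Longrightarrow> same_except X s (s'(a := g))"
  by (auto simp: same_except_def)

lemma stored_tensor_cong: "s a = s' a \<Longrightarrow> stored_tensor n d s a = stored_tensor n d s' a"
  by (simp add: stored_tensor_def)

text \<open>
  Array indices cannot depend on real data, so the mode with the largest error cannot be
  selected; instead, a sweep rescales every mode whose error exceeds the threshold.
\<close>

definition sweep :: com where
  "sweep = Seq (set_scalar ''flag'' (OfIndex (INum 0))) (For ''j'' (IVar ''d'') mode_step)"

text \<open>The loop invariant has two cases: either some mode was rescaled and the potential has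
  gained at least \<open>\<epsilon>^2 / 4\<close>, or \<open>B\<close> is still the initial tensor.
  In the second case all tests of the sweep referred to the same tensor, so a flag of 0 at the end
  certifies every mode simultaneously.\<close>

lemma runs_sweep:
  fixes n d s
  defines "B \<equiv> stored_tensor n d s ''B''" and "\<epsilon> \<equiv> s ''eps'' 0"
  assumes E: "E ''n'' = n" "E ''d'' = d" and n: "1 \<le> n"
    and P: "holds_marginals n d P s" "\<And>j. j < d \<Longrightarrow> P j \<in> positive_prob_vectors n"
    and B: "scaled_kernel n d C \<eta> B" and U: "U \<in> transport_polytope n d P" and eps: "0 \<le> \<epsilon>"
  shows "runs E sweep s (d * (7 * n ^ d)) (\<lambda>s'. same_except {''B'', ''M'', ''err'', ''flag''} s s' \<and>
    scaled_kernel n d C \<eta> (stored_tensor n d s' ''B'') \<and>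
    (s' ''flag'' 0 = 1 \<and>
       log_potential n d U B + \<epsilon>\<^sup>2 / 4 \<le> log_potential n d U (stored_tensor n d s' ''B'') \<or>
     s' ''flag'' 0 = 0 \<and> (\<forall>j<d. mode_error n d P (stored_tensor n d s' ''B'') j \<le> \<epsilon>)))"
proof -
  let ?X = "{''B'', ''M'', ''err'', ''flag''}" and ?st = "\<lambda>s. stored_tensor n d s ''B''"
  define I where "I = (\<lambda>j s'. same_except ?X s s' \<and> scaled_kernel n d C \<eta> (?st s') \<and>
    (s' ''flag'' 0 = 1 \<and> log_potential n d U B + \<epsilon>\<^sup>2 / 4 \<le> log_potential n d U (?st s') \<or>
     s' ''flag'' 0 = 0 \<and> s' ''B'' = s ''B'' \<and> (\<forall>l<j. mode_error n d P B l \<le> \<epsilon>)))"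
  have 1: "runs E (set_scalar ''flag'' (OfIndex (INum 0))) s 0 (I 0)"
    using B by (intro runs_Assign)
      (auto simp: I_def same_except_update same_except_refl B_def stored_tensor_def)
  have 2: "runs E (For ''j'' (IVar ''d'') mode_step) s1 (ival E (IVar ''d'') * (7 * n ^ d)) (I d)"
    if s1: "I 0 s1" for s1
  proof (rule runs_For[where I = I])
    fix j s2 assume j': "j < ival E (IVar ''d'')" and s2: "I j s2"
    have j: "j < d" using j' by (simp add: E)
    have same: "same_except ?X s s2" and K2: "scaled_kernel n d C \<eta> (?st s2)" using s2 by (auto simp: I_def)
    have P2: "holds_marginals n d P s2" using P(1) same by (simp add: holds_marginals_def same_except_def)
    have e2: "s2 ''eps'' 0 = \<epsilon>" using same by (simp add: same_except_def \<epsilon>_def)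
    have pos: "0 < ?st s2 i" if "i \<in> multi_indices n d" for i using K2 that by (simp add: scaled_kernel_def)
    have "runs (E(''j'' := j)) mode_step s2 (7 * n ^ d) (\<lambda>s'. same_except ?X s2 s' \<and>
      (mode_error n d P (?st s2) j \<le> s2 ''eps'' 0 \<and> s' ''flag'' 0 = s2 ''flag'' 0 \<and> s' ''B'' = s2 ''B'' \<or>
       s2 ''eps'' 0 < mode_error n d P (?st s2) j \<and> s' ''flag'' 0 = 1 \<and>
       (\<forall>i\<in>multi_indices n d. ?st s' i = ?st s2 i * (P j (i j) / marginal n d (?st s2) j (i j)))))"
      by (rule runs_mode_step) (use E n j P2 pos in auto)
    then show "runs (E(''j'' := j)) mode_step s2 (7 * n ^ d) (I (Suc j))"
    proof (rule runs_mono[OF _ order_refl], elim conjE disjE)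
      fix s3 assume s3: "same_except ?X s2 s3" "mode_error n d P (?st s2) j \<le> s2 ''eps'' 0"
        "s3 ''flag'' 0 = s2 ''flag'' 0" "s3 ''B'' = s2 ''B''"
      have "?st s3 = ?st s2" by (rule stored_tensor_cong) (rule s3(4))
      moreover have "?st s2 = B" if "s2 ''B'' = s ''B''"
        unfolding B_def by (rule stored_tensor_cong) (rule that)
      ultimately show "I (Suc j) s3"
        using s2 s3 same_except_trans[OF same s3(1)] unfolding I_def by (auto simp: e2 less_Suc_eq)
    next
      fix s3 assume s3: "same_except ?X s2 s3" "s2 ''eps'' 0 < mode_error n d P (?st s2) j"
        "s3 ''flag'' 0 = 1"
        "\<forall>i\<in>multi_indices n d. ?st s3 i = ?st s2 i * (P j (i j) / marginal n d (?st s2) j (i j))"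
      let ?B' = "\<lambda>i. ?st s2 i * (P j (i j) / marginal n d (?st s2) j (i j))"
      note step = scaling_step[where P = P and j = j, OF K2 P(2)[OF j] j]
      have K3: "scaled_kernel n d C \<eta> (?st s3)"
        using step(1) s3(4) scaled_kernel_cong[of n d "?st s3" ?B'] by simp
      have "log_potential n d U (?st s3) = log_potential n d U ?B'"
        using s3(4) by (intro log_potential_cong) simp
      then have L: "log_potential n d U (?st s2) + (mode_error n d P (?st s2) j)\<^sup>2 / 4
          \<le> log_potential n d U (?st s3)" using step(2)[OF U] by simp
      have "\<epsilon>\<^sup>2 \<le> (mode_error n d P (?st s2) j)\<^sup>2"
        using s3(2) eps by (intro power_mono) (auto simp: e2)
      \<comment> \<open>Earlier rescalings of the same sweep have not lowered the potential: if
        \<open>B\<close> was touched at all, the first case of the invariant holds.\<close>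
      moreover have "log_potential n d U B \<le> log_potential n d U (?st s2)"
      proof (cases "s2 ''B'' = s ''B''")
        case True
        then show ?thesis by (simp add: B_def stored_tensor_def)
      next
        case False
        then have "log_potential n d U B + \<epsilon>\<^sup>2 / 4 \<le> log_potential n d U (?st s2)"
          using s2 by (auto simp: I_def)
        moreover have "0 \<le> \<epsilon>\<^sup>2 / 4" by simp
        ultimately show ?thesis by linarith
      qed
      ultimately have "log_potential n d U B + \<epsilon>\<^sup>2 / 4 \<le> log_potential n d U (?st s3)"
        using L by linarith
      then show "I (Suc j) s3"
        using K3 s3(3) same_except_trans[OF same s3(1)] unfolding I_def by blast
    qed
  qed (use s1 in \<open>auto simp: E\<close>)
  have "runs E sweep s (0 + ival E (IVar ''d'') * (7 * n ^ d)) (I d)"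
    unfolding sweep_def by (rule runs_Seq[OF 1 2])
  then show ?thesis
  proof (rule runs_mono)
    fix s' assume s': "I d s'"
    have "?st s' = B" if "s' ''B'' = s ''B''"
      unfolding B_def by (rule stored_tensor_cong) (rule that)
    then show "same_except ?X s s' \<and> scaled_kernel n d C \<eta> (?st s') \<and>
      (s' ''flag'' 0 = 1 \<and> log_potential n d U B + \<epsilon>\<^sup>2 / 4 \<le> log_potential n d U (?st s') \<or>
       s' ''flag'' 0 = 0 \<and> (\<forall>j<d. mode_error n d P (?st s') j \<le> \<epsilon>))"
      using s' by (auto simp: I_def)
  qed (simp add: E)
qed

text \<open>Raising the flag beforehand forces a first sweep, without which nothing would be known
  about the errors.\<close>

definition sinkhorn :: com where
  "sinkhorn = Seq (set_scalar ''flag'' (OfIndex (INum 1)))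
     (WhileLess (OfIndex (INum 0)) (scalar ''flag'') sweep)"

text \<open>While the flag is 1, \<open>k\<close> sweeps have raised the potential by
  \<open>k * \<epsilon>^2 / 4\<close>. It cannot exceed 0, so hypothesis \<open>N\<close> yields
  \<open>k < N\<close> whenever another sweep starts.\<close>

lemma runs_sinkhorn:
  fixes n d s and N :: nat
  defines "B \<equiv> stored_tensor n d s ''B''" and "\<epsilon> \<equiv> s ''eps'' 0"
  assumes E: "E ''n'' = n" "E ''d'' = d" and n: "1 \<le> n"
    and P: "holds_marginals n d P s" "\<And>j. j < d \<Longrightarrow> P j \<in> positive_prob_vectors n"
    and B: "scaled_kernel n d C \<eta> B" and U: "U \<in> transport_polytope n d P" and eps: "0 < \<epsilon>"
    and N: "- log_potential n d U B < N * (\<epsilon>\<^sup>2 / 4)"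
  shows "runs E sinkhorn s (N * (1 + d * (7 * n ^ d)) + 1)
    (\<lambda>s'. same_except {''B'', ''M'', ''err'', ''flag''} s s' \<and>
    scaled_kernel n d C \<eta> (stored_tensor n d s' ''B'') \<and>
    (\<forall>j<d. mode_error n d P (stored_tensor n d s' ''B'') j \<le> \<epsilon>))"
    (is "runs E sinkhorn s _ ?Q")
proof -
  let ?X = "{''B'', ''M'', ''err'', ''flag''}" and ?st = "\<lambda>s. stored_tensor n d s ''B''"
  let ?L = "log_potential n d U"
  \<comment> \<open>The gain is claimed only while the flag is 1: the last sweep, which leaves the
    flag at 0, need not increase the potential.\<close>
  define I where "I = (\<lambda>(k::nat) s'. same_except ?X s s' \<and> scaled_kernel n d C \<eta> (?st s') \<and>
    (s' ''flag'' 0 = 1 \<and> ?L B + k * (\<epsilon>\<^sup>2 / 4) \<le> ?L (?st s') \<or>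
     s' ''flag'' 0 = 0 \<and> (\<forall>j<d. mode_error n d P (?st s') j \<le> \<epsilon>)))"
  have 1: "runs E (set_scalar ''flag'' (OfIndex (INum 1))) s 0 (I 0)"
    using B by (intro runs_Assign)
      (auto simp: I_def same_except_update same_except_refl B_def stored_tensor_def)
  have 2: "runs E (WhileLess (OfIndex (INum 0)) (scalar ''flag'') sweep) s1
      (N * (Suc (rcost (OfIndex (INum 0)) + rcost (scalar ''flag'')) + d * (7 * n ^ d)) +
       Suc (rcost (OfIndex (INum 0)) + rcost (scalar ''flag''))) ?Q" if "I 0 s1" for s1
    using that
  proof (rule runs_While)
    fix k s2 assume s2: "I k s2" and "rval E s2 (OfIndex (INum 0)) < rval E s2 (scalar ''flag'')"
    then have L: "?L B + k * (\<epsilon>\<^sup>2 / 4) \<le> ?L (?st s2)" by (auto simp: I_def)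
    have same: "same_except ?X s s2" and K2: "scaled_kernel n d C \<eta> (?st s2)" using s2 by (auto simp: I_def)
    have "?L (?st s2) \<le> 0"
      using U by (intro log_potential_nonpos[OF K2]) (auto simp: transport_polytope_def)
    then have "k * (\<epsilon>\<^sup>2 / 4) < N * (\<epsilon>\<^sup>2 / 4)" using L N by linarith
    then have "k < N" using eps by simp
    moreover have "runs E sweep s2 (d * (7 * n ^ d)) (I (Suc k))"
    proof -
      have P2: "holds_marginals n d P s2" using P(1) same by (simp add: holds_marginals_def same_except_def)
      have e2: "s2 ''eps'' 0 = \<epsilon>" using same by (simp add: same_except_def \<epsilon>_def)
      have e0: "0 \<le> s2 ''eps'' 0" using eps by (simp add: e2)
      show ?thesis
      proof (rule runs_mono[OF runs_sweep[OF E n P2 P(2) K2 U e0] order_refl])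
        fix s3 assume s3: "same_except ?X s2 s3 \<and> scaled_kernel n d C \<eta> (?st s3) \<and>
          (s3 ''flag'' 0 = 1 \<and> ?L (?st s2) + (s2 ''eps'' 0)\<^sup>2 / 4 \<le> ?L (?st s3) \<or>
           s3 ''flag'' 0 = 0 \<and> (\<forall>j<d. mode_error n d P (?st s3) j \<le> s2 ''eps'' 0))"
        then show "I (Suc k) s3"
          using same_except_trans[OF same, of s3] L unfolding I_def e2
          by (auto simp: algebra_simps add_divide_distrib)
      qed auto
    qed
    ultimately show "k < N \<and> runs E sweep s2 (d * (7 * n ^ d)) (I (Suc k))" ..
  qed (auto simp: I_def)
  have "runs E sinkhorn s (0 + (N * (Suc (rcost (OfIndex (INum 0)) + rcost (scalar ''flag'')) + d * (7 * n ^ d)) +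
       Suc (rcost (OfIndex (INum 0)) + rcost (scalar ''flag'')))) ?Q"
    unfolding sinkhorn_def by (rule runs_Seq[OF 1 2])
  then show ?thesis by simp
qed

section \<open>Product tensors as a program\<close>

abbreviation level_end :: iexp where
  "level_end \<equiv> IPow (IVar ''n'') (IAdd (IVar ''j'') (INum 1))"

abbreviation descending :: iexp where
  "descending \<equiv> ISub (ISub level_end (INum 1)) (IVar ''b'')"

text \<open>
  Level \<open>j\<close> extends the product in place from \<open>n ^ j\<close> to \<open>n ^ (j + 1)\<close> entries. Addresses
  descend, so that entry \<open>x mod n ^ j \<le> x\<close> is still unmodified when entry \<open>x\<close> is written.
\<close>

definition product_level :: "string \<Rightarrow> string \<Rightarrow> com" where
  "product_level X Y = For ''b'' level_end (Assign Y descending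
     (Mul (Cell Y (IMod descending (IPow (IVar ''n'') (IVar ''j''))))
        (Cell X (row_index (IDiv descending (IPow (IVar ''n'') (IVar ''j'')))))))"

definition product_prog :: "string \<Rightarrow> string \<Rightarrow> com" where
  "product_prog X Y = Seq (set_scalar Y (OfIndex (INum 1))) (For ''j'' (IVar ''d'') (product_level X Y))"

lemma runs_product_level:
  assumes E: "E ''n'' = n" "E ''j'' = j" and n: "1 \<le> n" and XY: "X \<noteq> Y"
  shows "runs E (product_level X Y) s (n ^ Suc j) (\<lambda>s'. \<exists>h. s' = s(Y := h) \<and>
    (\<forall>x<n ^ Suc j. h x = s Y (x mod n ^ j) * s X (j * n + x div n ^ j)))"
proof -
  let ?M = "n ^ Suc j" and ?new = "\<lambda>x. s Y (x mod n ^ j) * s X (j * n + x div n ^ j)"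
  have M: "ival E level_end = ?M" by (simp add: E)
  have "runs E (product_level X Y) s (ival E level_end * 1) (\<lambda>s'. \<exists>h. s' = s(Y := h) \<and> (\<forall>x<?M. h x = ?new x))"
    unfolding product_level_def
  \<comment> \<open>After \<open>i\<close> iterations the topmost \<open>i\<close> addresses hold
    new values and all lower ones are untouched.\<close>
  proof (rule runs_For[where I = "\<lambda>i s'. \<exists>h. s' = s(Y := h) \<and>
      (\<forall>x<?M. h x = (if ?M - i \<le> x then ?new x else s Y x))"])
    fix i s' assume i: "i < ival E level_end"
      and "\<exists>h. s' = s(Y := h) \<and> (\<forall>x<?M. h x = (if ?M - i \<le> x then ?new x else s Y x))"
    then obtain h where h: "s' = s(Y := h)"
      "\<And>x. x < ?M \<Longrightarrow> h x = (if ?M - i \<le> x then ?new x else s Y x)" by blast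
    have iM: "i < ?M" using i M by simp
    let ?x = "?M - 1 - i"
    \<comment> \<open>The cell to be read is at most \<open>?x\<close>, hence below the range
      \<open>?M - i\<close> and up that has been overwritten.\<close>
    have x: "?x < ?M" "\<not> ?M - i \<le> ?x mod n ^ j" "?x mod n ^ j < ?M"
      using iM mod_less_eq_dividend[of ?x "n ^ j"] by linarith+
    have hx: "h (?x mod n ^ j) = s Y (?x mod n ^ j)" using h(2)[OF x(3)] x(2) by simp
    have all: "(h(?x := ?new ?x)) y = (if ?M - Suc i \<le> y then ?new y else s Y y)" if "y < ?M" for y
    proof (cases "y = ?x")
      case False
      then have "?M - Suc i \<le> y \<longleftrightarrow> ?M - i \<le> y" using iM by linarith
      then show ?thesis using h(2)[OF that] False by simp
    qed simp
    have ev: "ival (E(''b'' := i)) descending = ?x" by (simp add: E)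
    show "runs (E(''b'' := i)) (Assign Y descending
     (Mul (Cell Y (IMod descending (IPow (IVar ''n'') (IVar ''j''))))
        (Cell X (row_index (IDiv descending (IPow (IVar ''n'') (IVar ''j''))))))) s' 1
      (\<lambda>s'. \<exists>h. s' = s(Y := h) \<and> (\<forall>x<?M. h x = (if ?M - Suc i \<le> x then ?new x else s Y x)))"
    proof (rule runs_Assign)
      let ?e = "Mul (Cell Y (IMod descending (IPow (IVar ''n'') (IVar ''j''))))
        (Cell X (row_index (IDiv descending (IPow (IVar ''n'') (IVar ''j'')))))"
      have "rval (E(''b'' := i)) s' ?e = ?new ?x"
        using XY hx by (simp add: h(1) E)
      then have "s'(Y := (s' Y)(ival (E(''b'' := i)) descending := rval (E(''b'' := i)) s' ?e)) =
          s(Y := h(?x := ?new ?x))" unfolding ev by (simp add: h(1))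
      then show "\<exists>h. s'(Y := (s' Y)(ival (E(''b'' := i)) descending := rval (E(''b'' := i)) s' ?e)) = s(Y := h) \<and>
          (\<forall>x<?M. h x = (if ?M - Suc i \<le> x then ?new x else s Y x))"
        using all by blast
    qed auto
  next
    show "\<exists>h. s = s(Y := h) \<and> (\<forall>x<?M. h x = (if ?M - 0 \<le> x then ?new x else s Y x))"
      by (rule exI[of _ "s Y"]) simp
  next
    fix s' assume "\<exists>h. s' = s(Y := h) \<and>
      (\<forall>x<?M. h x = (if ?M - ival E level_end \<le> x then ?new x else s Y x))"
    then show "\<exists>h. s' = s(Y := h) \<and> (\<forall>x<?M. h x = ?new x)" unfolding M by simp
  qed
  then show ?thesis unfolding M by simp
qed

lemma digit_mod:
  assumes "m < l"
  shows "(x mod n ^ l) div n ^ m mod n = x div n ^ m mod (n::nat)"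
proof (cases "n = 0")
  case False
  obtain e where "l = Suc (m + e)" using assms less_iff_Suc_add by auto
  then have "n ^ l = n ^ m * (n * n ^ e)" by (simp add: power_add)
  then have "(x mod n ^ l) div n ^ m = x div n ^ m mod (n * n ^ e)"
    using False by (simp add: mod_mult2_eq)
  then show ?thesis by (simp add: mod_mod_cancel)
\<comment> \<open>For \<open>n = 0\<close> the exponent \<open>l\<close> is positive, so
  \<open>n ^ l\<close> is 0, and \<open>x mod 0\<close> is \<open>x\<close>.\<close>
qed (use assms in \<open>simp add: power_0_left\<close>)

text \<open>For \<open>2 <= n\<close> the sum is geometric and at most \<open>2 * n ^ d\<close>; for
  \<open>n = 1\<close> it is \<open>d\<close>, covered by \<open>d * n\<close>. Thus a product
  tensor costs a multiple of the input size rather than \<open>d * n ^ d\<close>.\<close>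

lemma sum_powers_le: "1 \<le> n \<Longrightarrow> (\<Sum>j<d. n ^ Suc j) \<le> 2 * (n ^ d + d * n)"
proof -
  assume "1 \<le> n"
  then consider "n = 1" | "2 \<le> n" by linarith
  then show ?thesis
  proof cases
    case 2
    have "(\<Sum>j<d. n ^ Suc j) \<le> 2 * n ^ d"
    proof (induction d)
      case (Suc d)
      have "2 * n ^ d \<le> n ^ Suc d" using 2 by simp
      then have "2 * n ^ d + n ^ Suc d \<le> 2 * n ^ Suc d" by linarith
      then show ?case using Suc unfolding sum.lessThan_Suc by linarith
    qed simp
    then show ?thesis by (rule order_trans) simp
  qed simp
qed

lemma runs_product_prog:
  assumes E: "E ''n'' = n" "E ''d'' = d" and n: "1 \<le> n" and XY: "X \<noteq> Y"
  shows "runs E (product_prog X Y) s (2 * (n ^ d + d * n)) (\<lambda>s'. \<exists>h. s' = s(Y := h) \<and>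
    (\<forall>a<n ^ d. h a = (\<Prod>l<d. s X (l * n + a div n ^ l mod n))))"
proof -
  \<comment> \<open>After \<open>l\<close> levels the first \<open>n ^ l\<close> cells form the
    product tensor of the first \<open>l\<close> modes.\<close>
  let ?J = "\<lambda>l s'. \<exists>h. s' = s(Y := h) \<and> (\<forall>a<n ^ l. h a = (\<Prod>m<l. s X (m * n + a div n ^ m mod n)))"
  have 1: "runs E (set_scalar Y (OfIndex (INum 1))) s 0 (?J 0)"
    by (intro runs_Assign) auto
  have 2: "runs E (For ''j'' (IVar ''d'') (product_level X Y)) s1 (\<Sum>l<ival E (IVar ''d''). n ^ Suc l)
      (?J (ival E (IVar ''d'')))" if s1: "?J 0 s1" for s1
  proof (rule runs_For_sum)
    fix l s2 assume "?J l s2"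
    then obtain h where h: "s2 = s(Y := h)"
      "\<And>a. a < n ^ l \<Longrightarrow> h a = (\<Prod>m<l. s X (m * n + a div n ^ m mod n))" by blast
    have "runs (E(''j'' := l)) (product_level X Y) s2 (n ^ Suc l) (\<lambda>s'. \<exists>h. s' = s2(Y := h) \<and>
      (\<forall>x<n ^ Suc l. h x = s2 Y (x mod n ^ l) * s2 X (l * n + x div n ^ l)))"
      by (rule runs_product_level) (use E n XY in auto)
    then show "runs (E(''j'' := l)) (product_level X Y) s2 (n ^ Suc l) (?J (Suc l))"
    proof (rule runs_mono[OF _ order_refl])
      fix s3 assume "\<exists>h. s3 = s2(Y := h) \<and>
        (\<forall>x<n ^ Suc l. h x = s2 Y (x mod n ^ l) * s2 X (l * n + x div n ^ l))"
      then obtain g where g: "s3 = s2(Y := g)"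
        "\<And>x. x < n ^ Suc l \<Longrightarrow> g x = s2 Y (x mod n ^ l) * s2 X (l * n + x div n ^ l)" by blast
      have "g x = (\<Prod>m<Suc l. s X (m * n + x div n ^ m mod n))" if x: "x < n ^ Suc l" for x
      proof -
        \<comment> \<open>The leading digit of \<open>x\<close> needs no reduction modulo
          \<open>n\<close>.\<close>
        have "x div n ^ l < n" using x n by (simp add: div_less_iff_less_mult)
        moreover have "h (x mod n ^ l) = (\<Prod>m<l. s X (m * n + x div n ^ m mod n))"
          using h(2)[of "x mod n ^ l"] n by (simp add: digit_mod)
        ultimately show ?thesis using g(2)[OF x] XY by (simp add: h(1))
      qed
      then show "?J (Suc l) s3" by (intro exI[of _ g]) (auto simp: g(1) h(1))
    qed
  qed (use s1 in auto)
  have "runs E (product_prog X Y) s (0 + (\<Sum>l<ival E (IVar ''d''). n ^ Suc l)) (?J (ival E (IVar ''d'')))"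
    unfolding product_prog_def by (rule runs_Seq[OF 1 2])
  then show ?thesis
    by (rule runs_mono) (use sum_powers_le[OF n, of d] in \<open>simp_all add: E\<close>)
qed

section \<open>Rounding as a program\<close>

definition cap_prog :: com where
  "cap_prog = For ''j'' (IVar ''d'') (Seq marginal_prog
     (For ''a'' entries (IfLess (Cell ''P'' (row_index digit)) (Cell ''M'' digit)
       (Assign ''B'' (IVar ''a'')
         (Mul (Cell ''B'' (IVar ''a'')) (Divide (Cell ''P'' (row_index digit)) (Cell ''M'' digit)))) Skip)))"

text \<open>Per mode, each entry costs one addition for the marginal and at most three operations
  for comparing, dividing and multiplying.\<close>

lemma runs_cap_prog:
  fixes n d s
  defines "B \<equiv> stored_tensor n d s ''B''"
  assumes E: "E ''n'' = n" "E ''d'' = d" and n: "1 \<le> n"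
    and P: "holds_marginals n d P s" "\<And>j. j < d \<Longrightarrow> P j \<in> positive_prob_vectors n"
  shows "runs E cap_prog s (4 * d * n ^ d) (\<lambda>s'. same_except {''B'', ''M''} s s' \<and>
    (\<forall>i\<in>multi_indices n d. stored_tensor n d s' ''B'' i = cap_modes n d P B d i))"
proof -
  let ?st = "\<lambda>s. stored_tensor n d s ''B''" and ?X = "{''B'', ''M''}"
  let ?J = "\<lambda>j s'. same_except ?X s s' \<and> (\<forall>i\<in>multi_indices n d. ?st s' i = cap_modes n d P B j i)"
  let ?assign = "Assign ''B'' (IVar ''a'')
         (Mul (Cell ''B'' (IVar ''a'')) (Divide (Cell ''P'' (row_index digit)) (Cell ''M'' digit)))"
  let ?if = "IfLess (Cell ''P'' (row_index digit)) (Cell ''M'' digit) ?assign Skip"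
  have "runs E cap_prog s (ival E (IVar ''d'') * (n ^ d + n ^ d * 3)) (?J d)"
    unfolding cap_prog_def
  proof (rule runs_For[where I = ?J])
    show "?J 0 s" by (simp add: same_except_refl B_def)
  next
    fix j s1 assume "j < ival E (IVar ''d'')" and s1: "?J j s1"
    then have j: "j < d" by (simp add: E)
    let ?E = "E(''j'' := j)" and ?m = "marginal n d (cap_modes n d P B j) j"
    have E': "?E ''n'' = n" "?E ''d'' = d" "?E ''j'' = j" by (simp_all add: E)
    have same: "same_except ?X s s1" using s1 by blast
    have P1: "s1 ''P'' (j * n + k) = P j k" if "k < n" for k
      using P(1) same j that by (simp add: holds_marginals_def same_except_def)
    have Pp: "0 < P j k" if "k < n" for k using P(2)[OF j] that by (simp add: positive_prob_vectors_def)
    have "marginal n d (?st s1) = marginal n d (cap_modes n d P B j)" using s1 by (intro marginal_cong) simp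
    note 1 = runs_marginal_prog[where s = s1, OF E' j, unfolded this]
    show "runs ?E (Seq marginal_prog (For ''a'' entries ?if)) s1 (n ^ d + n ^ d * 3) (?J (Suc j))"
    proof (rule runs_Seq[OF 1], elim exE conjE)
      fix s2 g assume s2: "s2 = s1(''M'' := g)" and g: "\<forall>k<n. g k = ?m k"
      let ?f = "\<lambda>a. if P j (a div n ^ j mod n) < ?m (a div n ^ j mod n)
        then s1 ''B'' a * (P j (a div n ^ j mod n) / ?m (a div n ^ j mod n)) else s1 ''B'' a"
      have "runs ?E (For ''a'' entries ?if) s2 (ival ?E entries * 3)
          (\<lambda>s'. \<exists>h. s' = s2(''B'' := h) \<and> (\<forall>a<ival ?E entries. h a = ?f a))"
      proof (rule runs_For_map)
        fix a h assume h: "\<And>b. a \<le> b \<Longrightarrow> h b = s2 ''B'' b"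
        let ?k = "a div n ^ j mod n"
        have k: "?k < n" using n by simp
        have ha: "h a = s1 ''B'' a" using h[of a] by (simp add: s2)
        have "runs (?E(''a'' := a)) ?if (s2(''B'' := h))
          (Suc (rcost (Cell ''P'' (row_index digit)) + rcost (Cell ''M'' digit)) + 2)
          (\<lambda>s'. s' = s2(''B'' := h(a := ?f a)))"
        proof (rule runs_If)
          assume "rval (?E(''a'' := a)) (s2(''B'' := h)) (Cell ''P'' (row_index digit)) <
            rval (?E(''a'' := a)) (s2(''B'' := h)) (Cell ''M'' digit)"
          then have lt: "P j ?k < ?m ?k" using P1[OF k] g k by (simp add: E s2)
          \<comment> \<open>The division is safe: the marginal exceeds a positive target.\<close>
          then have "?m ?k \<noteq> 0" using Pp[OF k] by linarith
          then show "runs (?E(''a'' := a)) ?assign (s2(''B'' := h)) 2 (\<lambda>s'. s' = s2(''B'' := h(a := ?f a)))"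
            using lt P1[OF k] g k ha by (intro runs_Assign) (simp_all add: E s2)
        next
          assume "\<not> rval (?E(''a'' := a)) (s2(''B'' := h)) (Cell ''P'' (row_index digit)) <
            rval (?E(''a'' := a)) (s2(''B'' := h)) (Cell ''M'' digit)"
          then have "\<not> P j ?k < ?m ?k" using P1[OF k] g k by (simp add: E s2)
          then have "h(a := ?f a) = h" using ha by auto
          then show "runs (?E(''a'' := a)) Skip (s2(''B'' := h)) 2 (\<lambda>s'. s' = s2(''B'' := h(a := ?f a)))"
            by (intro runs_Skip) simp
        qed auto
        then show "runs (?E(''a'' := a)) ?if (s2(''B'' := h)) 3 (\<lambda>s'. s' = s2(''B'' := h(a := ?f a)))"
          by (rule runs_mono) (simp, assumption)
      qed
      then have "runs ?E (For ''a'' entries ?if) s2 (n ^ d * 3)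
          (\<lambda>s'. \<exists>h. s' = s2(''B'' := h) \<and> (\<forall>a<n ^ d. h a = ?f a))" by (simp add: E)
      then show "runs ?E (For ''a'' entries ?if) s2 (n ^ d * 3) (?J (Suc j))"
      proof (rule runs_mono[OF _ order_refl])
        fix s3 assume "\<exists>h. s3 = s2(''B'' := h) \<and> (\<forall>a<n ^ d. h a = ?f a)"
        then obtain h where h: "s3 = s2(''B'' := h)" "\<And>a. a < n ^ d \<Longrightarrow> h a = ?f a" by blast
        have "same_except ?X s s3" using same by (simp add: h(1) s2 same_except_update)
        moreover have "?st s3 i = cap_modes n d P B (Suc j) i" if i: "i \<in> multi_indices n d" for i
        proof -
          have "?st s1 i = cap_modes n d P B j i" using s1 i by blast
          then show ?thesis using h(2)[OF address_less[OF i]]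
            by (simp add: h(1) stored_tensor_def digit_address[OF i j] cap_mode_def)
        qed
        ultimately show "?J (Suc j) s3" by blast
      qed
    qed
  qed (simp add: E)
  then show ?thesis by (rule runs_mono) (simp_all add: E)
qed

definition gap_prog :: com where
  "gap_prog = For ''j'' (IVar ''d'') (Seq marginal_prog
     (For ''k'' (IVar ''n'') (Assign ''E'' (row_index (IVar ''k''))
       (Divide (Sub (Cell ''P'' (row_index (IVar ''k''))) (Cell ''M'' (IVar ''k''))) (scalar ''mass'')))))"

lemma runs_gap_prog:
  assumes E: "E ''n'' = n" "E ''d'' = d" and P: "holds_marginals n d P s"
    and m: "s ''mass'' 0 \<noteq> 0"
  shows "runs E gap_prog s (d * (n ^ d + n * 2)) (\<lambda>s'. same_except {''E'', ''M''} s s' \<and>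
    (\<forall>j<d. \<forall>k<n. s' ''E'' (j * n + k) =
      (P j k - marginal n d (stored_tensor n d s ''B'') j k) / s ''mass'' 0))"
proof -
  let ?X = "{''E'', ''M''}" and ?e = "\<lambda>j k. (P j k - marginal n d (stored_tensor n d s ''B'') j k) / s ''mass'' 0"
  let ?J = "\<lambda>j s'. same_except ?X s s' \<and> (\<forall>l<j. \<forall>k<n. s' ''E'' (l * n + k) = ?e l k)"
  let ?assign = "Assign ''E'' (row_index (IVar ''k''))
       (Divide (Sub (Cell ''P'' (row_index (IVar ''k''))) (Cell ''M'' (IVar ''k''))) (scalar ''mass''))"
  have "runs E gap_prog s (ival E (IVar ''d'') * (n ^ d + n * 2)) (?J d)"
    unfolding gap_prog_def
  proof (rule runs_For[where I = ?J])
    fix j s1 assume "j < ival E (IVar ''d'')" and s1: "?J j s1"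
    then have j: "j < d" by (simp add: E)
    let ?E = "E(''j'' := j)"
    have E': "?E ''n'' = n" "?E ''d'' = d" "?E ''j'' = j" by (simp_all add: E)
    have same: "same_except ?X s s1" using s1 by blast
    have "s1 ''B'' = s ''B''" using same by (simp add: same_except_def)
    then have "stored_tensor n d s1 ''B'' = stored_tensor n d s ''B''" by (simp add: stored_tensor_def)
    note 1 = runs_marginal_prog[where s = s1, OF E' j, unfolded this]
    show "runs ?E (Seq marginal_prog (For ''k'' (IVar ''n'') ?assign)) s1 (n ^ d + n * 2) (?J (Suc j))"
    proof (rule runs_Seq[OF 1], elim exE conjE)
      fix s2 g assume s2: "s2 = s1(''M'' := g)"
        and g: "\<forall>k<n. g k = marginal n d (stored_tensor n d s ''B'') j k"
      have same2: "same_except ?X s s2" using same by (simp add: s2 same_except_update)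
      \<comment> \<open>While row \<open>j\<close> is being filled, the earlier rows of
        \<open>E\<close> must be known to survive, besides the part of row \<open>j\<close> already
        written.\<close>
      let ?K = "\<lambda>k s'. same_except {''E''} s2 s' \<and> (\<forall>l<j. \<forall>k<n. s' ''E'' (l * n + k) = ?e l k) \<and>
        (\<forall>k'<k. s' ''E'' (j * n + k') = ?e j k')"
      have "runs ?E (For ''k'' (IVar ''n'') ?assign) s2 (ival ?E (IVar ''n'') * 2) (?J (Suc j))"
      proof (rule runs_For[where I = ?K])
        show "?K 0 s2" using s1 by (simp add: s2 same_except_refl)
      next
        fix k s3 assume k': "k < ival ?E (IVar ''n'')" and s3: "?K k s3"
        then have k: "k < n" by (simp add: E)
        have eq: "s3 ''P'' = s ''P''" "s3 ''mass'' = s ''mass''" "s3 ''M'' = g"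
          using s3 same by (simp_all add: same_except_def s2)
        have ne: "l * n + k' \<noteq> j * n + k" if "l < j" "k' < n" for l k'
        proof -
          have "l * n + k' < Suc l * n" using that by simp
          also have "\<dots> \<le> j * n" using that by (intro mult_le_mono1) simp
          finally show ?thesis by linarith
        qed
        show "runs (?E(''k'' := k)) ?assign s3 2 (?K (Suc k))"
        proof (rule runs_Assign)
          show "rdefined (?E(''k'' := k)) s3 (Divide (Sub (Cell ''P'' (row_index (IVar ''k''))) (Cell ''M'' (IVar ''k''))) (scalar ''mass''))"
            using m by (simp add: eq)
          have v: "rval (?E(''k'' := k)) s3 (Divide (Sub (Cell ''P'' (row_index (IVar ''k''))) (Cell ''M'' (IVar ''k''))) (scalar ''mass'')) = ?e j k"
            using P j k g by (simp add: eq E holds_marginals_def)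
          show "?K (Suc k) (s3(''E'' := (s3 ''E'')(ival (?E(''k'' := k)) (row_index (IVar ''k'')) :=
            rval (?E(''k'' := k)) s3 (Divide (Sub (Cell ''P'' (row_index (IVar ''k''))) (Cell ''M'' (IVar ''k''))) (scalar ''mass'')))))"
            unfolding v using s3 ne by (auto simp: E same_except_update less_Suc_eq)
        qed simp
      next
        fix s3 assume s3: "?K (ival ?E (IVar ''n'')) s3"
        have "same_except ?X s2 s3" using s3 by (simp add: same_except_def)
        then show "?J (Suc j) s3" using same_except_trans[OF same2, of s3] s3 by (auto simp: E less_Suc_eq)
      qed
      then show "runs ?E (For ''k'' (IVar ''n'') ?assign) s2 (n * 2) (?J (Suc j))" by (simp add: E)
    qed
  qed (auto simp: E same_except_refl)
  then show ?thesis by (simp add: E)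
qed

definition round_prog :: com where
  "round_prog = Seq cap_prog (Seq (set_scalar ''mass'' (OfIndex (INum 1)))
     (Seq (For ''a'' entries (set_scalar ''mass'' (Sub (scalar ''mass'') (Cell ''B'' (IVar ''a'')))))
       (IfLess (OfIndex (INum 0)) (scalar ''mass'')
         (Seq gap_prog (Seq (product_prog ''E'' ''R'')
           (For ''a'' entries (Assign ''B'' (IVar ''a'')
             (Add (Cell ''B'' (IVar ''a'')) (Mul (scalar ''mass'') (Cell ''R'' (IVar ''a''))))))))
         Skip)))"

text \<open>The bound keeps the shape produced by nested \<open>runs_Seq\<close>; it is summed up
  only in \<open>runs_tot_prog\<close>.\<close>

lemma runs_round_prog:
  fixes n d s
  defines "B \<equiv> stored_tensor n d s ''B''"
  assumes E: "E ''n'' = n" "E ''d'' = d" and n: "1 \<le> n"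
    and P: "holds_marginals n d P s" "\<And>j. j < d \<Longrightarrow> P j \<in> positive_prob_vectors n"
  shows "runs E round_prog s (4 * d * n ^ d + (0 + (n ^ d + (1 + (d * (n ^ d + n * 2) +
      (2 * (n ^ d + d * n) + n ^ d * 2))))))
    (\<lambda>s'. \<forall>i\<in>multi_indices n d. stored_tensor n d s' ''B'' i = rounded n d P B i)"
    (is "runs E _ s _ ?Q")
proof -
  let ?st = "\<lambda>s. stored_tensor n d s ''B''"
  define V where "V = cap_modes n d P B d"
  define m where "m = 1 - (\<Sum>i\<in>multi_indices n d. V i)"
  have r: "rounded n d P B = (if 0 < m
      then \<lambda>i. V i + m * (\<Prod>l<d. (P l (i l) - marginal n d V l (i l)) / m) else V)"
    by (simp add: rounded_def V_def m_def Let_def)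
  note 1 = runs_cap_prog[OF E n P, folded B_def V_def]
  show ?thesis
    unfolding round_prog_def
  proof (rule runs_Seq[OF 1])
    fix s1 assume s1: "same_except {''B'', ''M''} s s1 \<and> (\<forall>i\<in>multi_indices n d. ?st s1 i = V i)"
    have P1: "holds_marginals n d P s1" using P(1) s1 by (simp add: holds_marginals_def same_except_def)
    have 2: "runs E (set_scalar ''mass'' (OfIndex (INum 1))) s1 0 (\<lambda>s'. s' = s1(''mass'' := (s1 ''mass'')(0 := 1)))"
      by (rule runs_Assign) auto
    show "runs E (Seq (set_scalar ''mass'' (OfIndex (INum 1)))
     (Seq (For ''a'' entries (set_scalar ''mass'' (Sub (scalar ''mass'') (Cell ''B'' (IVar ''a'')))))
       (IfLess (OfIndex (INum 0)) (scalar ''mass'')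
         (Seq gap_prog (Seq (product_prog ''E'' ''R'')
           (For ''a'' entries (Assign ''B'' (IVar ''a'')
             (Add (Cell ''B'' (IVar ''a'')) (Mul (scalar ''mass'') (Cell ''R'' (IVar ''a''))))))))
         Skip))) s1 (0 + (n ^ d + (1 + (d * (n ^ d + n * 2) +
      (2 * (n ^ d + d * n) + n ^ d * 2))))) ?Q"
    proof (rule runs_Seq[OF 2])
      fix s2 assume s2: "s2 = s1(''mass'' := (s1 ''mass'')(0 := 1))"
      have "runs E (For ''a'' entries (set_scalar ''mass'' (Sub (scalar ''mass'') (Cell ''B'' (IVar ''a''))))) s2
          (ival E entries * 1) (\<lambda>s'. \<exists>h. s' = s2(''mass'' := h) \<and>
            h 0 = s2 ''mass'' 0 + (\<Sum>a<ival E entries. - s1 ''B'' a))"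
        by (rule runs_For_accumulate; rule runs_Assign) (simp_all add: s2)
      moreover have "1 + (\<Sum>a<n ^ d. - s1 ''B'' a) = m"
      proof -
        have "(\<Sum>a<n ^ d. s1 ''B'' a) = (\<Sum>i\<in>multi_indices n d. ?st s1 i)"
          by (simp add: sum_address[symmetric] stored_tensor_def)
        also have "\<dots> = (\<Sum>i\<in>multi_indices n d. V i)" using s1 by (intro sum.cong) auto
        finally show ?thesis by (simp add: m_def sum_negf)
      qed
      ultimately have 3: "runs E (For ''a'' entries (set_scalar ''mass'' (Sub (scalar ''mass'') (Cell ''B'' (IVar ''a''))))) s2
          (n ^ d) (\<lambda>s'. \<exists>h. s' = s2(''mass'' := h) \<and> h 0 = m)"
        by (simp add: E s2)
      show "runs E (Seq (For ''a'' entries (set_scalar ''mass'' (Sub (scalar ''mass'') (Cell ''B'' (IVar ''a'')))))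
       (IfLess (OfIndex (INum 0)) (scalar ''mass'')
         (Seq gap_prog (Seq (product_prog ''E'' ''R'')
           (For ''a'' entries (Assign ''B'' (IVar ''a'')
             (Add (Cell ''B'' (IVar ''a'')) (Mul (scalar ''mass'') (Cell ''R'' (IVar ''a''))))))))
         Skip)) s2 (n ^ d + (1 + (d * (n ^ d + n * 2) +
      (2 * (n ^ d + d * n) + n ^ d * 2)))) ?Q"
      proof (rule runs_Seq[OF 3], elim exE conjE)
        fix s3 h assume s3: "s3 = s2(''mass'' := h)" and h: "h 0 = m"
        have B3: "?st s3 i = V i" if "i \<in> multi_indices n d" for i
          using s1 that by (simp add: s2 s3 stored_tensor_def)
        have "runs E (IfLess (OfIndex (INum 0)) (scalar ''mass'')
         (Seq gap_prog (Seq (product_prog ''E'' ''R'')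
           (For ''a'' entries (Assign ''B'' (IVar ''a'')
             (Add (Cell ''B'' (IVar ''a'')) (Mul (scalar ''mass'') (Cell ''R'' (IVar ''a''))))))))
         Skip) s3 (Suc (rcost (OfIndex (INum 0)) + rcost (scalar ''mass'')) + (d * (n ^ d + n * 2) +
          (2 * (n ^ d + d * n) + n ^ d * 2))) ?Q"
        proof (rule runs_If)
          assume "\<not> rval E s3 (OfIndex (INum 0)) < rval E s3 (scalar ''mass'')"
          then have "\<not> 0 < m" by (simp add: s3 h)
          then show "runs E Skip s3 (d * (n ^ d + n * 2) + (2 * (n ^ d + d * n) + n ^ d * 2)) ?Q"
            using B3 by (intro runs_Skip) (simp add: r)
        next
          assume "rval E s3 (OfIndex (INum 0)) < rval E s3 (scalar ''mass'')"
          then have m0: "0 < m" by (simp add: s3 h)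
          have P3: "holds_marginals n d P s3" using P1 by (simp add: holds_marginals_def s2 s3)
          have m3: "s3 ''mass'' 0 = m" by (simp add: s3 h)
          have m3': "s3 ''mass'' 0 \<noteq> 0" using m0 m3 by simp
          \<comment> \<open>The store agrees with \<open>V\<close> on multi-indices only, which is
            all that a marginal depends on.\<close>
          have "marginal n d (?st s3) = marginal n d V" using B3 by (rule marginal_cong)
          note 4 = runs_gap_prog[OF E P3 m3', unfolded m3 this]
          show "runs E (Seq gap_prog (Seq (product_prog ''E'' ''R'')
           (For ''a'' entries (Assign ''B'' (IVar ''a'')
             (Add (Cell ''B'' (IVar ''a'')) (Mul (scalar ''mass'') (Cell ''R'' (IVar ''a'')))))))) s3
             (d * (n ^ d + n * 2) + (2 * (n ^ d + d * n) + n ^ d * 2)) ?Q"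
          proof (rule runs_Seq[OF 4])
            fix s4 assume s4: "same_except {''E'', ''M''} s3 s4 \<and>
              (\<forall>j<d. \<forall>k<n. s4 ''E'' (j * n + k) = (P j k - marginal n d V j k) / m)"
            have ER: "''E'' \<noteq> ''R''" by simp
            show "runs E (Seq (product_prog ''E'' ''R'')
             (For ''a'' entries (Assign ''B'' (IVar ''a'')
              (Add (Cell ''B'' (IVar ''a'')) (Mul (scalar ''mass'') (Cell ''R'' (IVar ''a''))))))) s4
             (2 * (n ^ d + d * n) + n ^ d * 2) ?Q"
            proof (rule runs_Seq[OF runs_product_prog[OF E n ER]], elim exE conjE)
              fix s5 q assume s5: "s5 = s4(''R'' := q)"
                and q: "\<forall>a<n ^ d. q a = (\<Prod>l<d. s4 ''E'' (l * n + a div n ^ l mod n))"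
              have B5: "s5 ''B'' = s3 ''B''" "s5 ''mass'' 0 = m"
                using s4 m3 by (simp_all add: s5 same_except_def)
              have "runs E (For ''a'' entries (Assign ''B'' (IVar ''a'')
                  (Add (Cell ''B'' (IVar ''a'')) (Mul (scalar ''mass'') (Cell ''R'' (IVar ''a'')))))) s5
                (ival E entries * 2) (\<lambda>s'. \<exists>h. s' = s5(''B'' := h) \<and>
                  (\<forall>a<ival E entries. h a = s3 ''B'' a + m * q a))"
                by (rule runs_For_map; rule runs_Assign) (simp_all add: B5, simp add: s5)
              then have "runs E (For ''a'' entries (Assign ''B'' (IVar ''a'')
                  (Add (Cell ''B'' (IVar ''a'')) (Mul (scalar ''mass'') (Cell ''R'' (IVar ''a'')))))) s5
                (n ^ d * 2) (\<lambda>s'. \<exists>h. s' = s5(''B'' := h) \<and> (\<forall>a<n ^ d. h a = s3 ''B'' a + m * q a))"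
                by (simp add: E)
              then show "runs E (For ''a'' entries (Assign ''B'' (IVar ''a'')
                  (Add (Cell ''B'' (IVar ''a'')) (Mul (scalar ''mass'') (Cell ''R'' (IVar ''a'')))))) s5
                (n ^ d * 2) ?Q"
              proof (rule runs_mono[OF _ order_refl], elim exE conjE)
                fix s6 h assume h6: "s6 = s5(''B'' := h)" "\<forall>a<n ^ d. h a = s3 ''B'' a + m * q a"
                show "?Q s6"
                proof
                  fix i assume i: "i \<in> multi_indices n d"
                  have "q (address n d i) = (\<Prod>l<d. (P l (i l) - marginal n d V l (i l)) / m)"
                    using q s4 address_less[OF i] multi_indices_less[OF i]
                    by (auto simp: digit_address[OF i] intro!: prod.cong)
                  then show "?st s6 i = rounded n d P B i"
                    using m0 B3[OF i] h6(2) address_less[OF i]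
                    by (simp add: r h6(1) stored_tensor_def)
                qed
              qed
            qed
          qed
        qed auto
        then show "runs E (IfLess (OfIndex (INum 0)) (scalar ''mass'')
         (Seq gap_prog (Seq (product_prog ''E'' ''R'')
           (For ''a'' entries (Assign ''B'' (IVar ''a'')
             (Add (Cell ''B'' (IVar ''a'')) (Mul (scalar ''mass'') (Cell ''R'' (IVar ''a''))))))))
         Skip) s3 (1 + (d * (n ^ d + n * 2) +
          (2 * (n ^ d + d * n) + n ^ d * 2))) ?Q" by simp
      qed
    qed
  qed
qed

section \<open>The complete algorithm\<close>

definition range_prog :: com where
  "range_prog = Seq (set_scalar ''mx'' (scalar ''C'')) (Seq (set_scalar ''mn'' (scalar ''C''))
     (For ''a'' entries (Seq
       (IfLess (scalar ''mx'') (Cell ''C'' (IVar ''a'')) (set_scalar ''mx'' (Cell ''C'' (IVar ''a''))) Skip)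
       (IfLess (Cell ''C'' (IVar ''a'')) (scalar ''mn'') (set_scalar ''mn'' (Cell ''C'' (IVar ''a''))) Skip))))"

lemma runs_range_prog:
  assumes E: "E ''n'' = n" "E ''d'' = d" and n: "1 \<le> n"
    and C: "\<And>i. i \<in> multi_indices n d \<Longrightarrow> stored_tensor n d s ''C'' i = C i"
  shows "runs E range_prog s (n ^ d * 2) (\<lambda>s'. same_except {''mx'', ''mn''} s s' \<and>
    s' ''mx'' 0 - s' ''mn'' 0 = entry_range n d C)"
proof -
  let ?X = "{''mx'', ''mn''}" and ?c = "s ''C''"
  let ?mx = "IfLess (scalar ''mx'') (Cell ''C'' (IVar ''a'')) (set_scalar ''mx'' (Cell ''C'' (IVar ''a''))) Skip"
  let ?mn = "IfLess (Cell ''C'' (IVar ''a'')) (scalar ''mn'') (set_scalar ''mn'' (Cell ''C'' (IVar ''a''))) Skip"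
  \<comment> \<open>Both extremes are actual entries and bound all entries seen so far; at the end
    this identifies them as maximum and minimum. Starting from cell 0 is legitimate because
    \<open>0 < n ^ d\<close>.\<close>
  let ?J = "\<lambda>i s'. same_except ?X s s' \<and> s' ''mx'' 0 \<in> ?c ` {..<n ^ d} \<and> s' ''mn'' 0 \<in> ?c ` {..<n ^ d} \<and>
    (\<forall>a<i. s' ''mn'' 0 \<le> ?c a \<and> ?c a \<le> s' ''mx'' 0)"
  have N: "0 < n ^ d" using n by simp
  have 1: "runs E (set_scalar ''mx'' (scalar ''C'')) s 0 (\<lambda>s'. s' = s(''mx'' := (s ''mx'')(0 := ?c 0)))"
    by (rule runs_Assign) auto
  have 2: "runs E (set_scalar ''mn'' (scalar ''C'')) s1 0 (?J 0)"
    if s1: "s1 = s(''mx'' := (s ''mx'')(0 := ?c 0))" for s1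
    using N by (intro runs_Assign) (auto simp: s1 same_except_update same_except_refl)
  have 3: "runs E (For ''a'' entries (Seq ?mx ?mn)) s2 (ival E entries * (1 + 1)) (?J (n ^ d))"
    if s2: "?J 0 s2" for s2
  proof (rule runs_For[where I = ?J])
    fix i s3 assume i': "i < ival E entries" and s3: "?J i s3"
    then have i: "i < n ^ d" by (simp add: E)
    have C3: "s3 ''C'' = ?c" using s3 by (simp add: same_except_def)
    \<comment> \<open>The state between the two tests: entry \<open>i\<close> is accounted for in
      the maximum but not yet in the minimum.\<close>
    let ?K = "\<lambda>s'. ?J i s' \<and> ?c i \<le> s' ''mx'' 0"
    have "runs (E(''a'' := i)) ?mx s3 (Suc (rcost (scalar ''mx'') + rcost (Cell ''C'' (IVar ''a''))) + 0) ?K"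
    proof (rule runs_If)
      assume lt: "rval (E(''a'' := i)) s3 (scalar ''mx'') < rval (E(''a'' := i)) s3 (Cell ''C'' (IVar ''a''))"
      then show "runs (E(''a'' := i)) (set_scalar ''mx'' (Cell ''C'' (IVar ''a''))) s3 0 ?K"
        using s3 i by (intro runs_Assign) (auto simp: C3 same_except_update intro: order.trans less_imp_le)
    next
      assume "\<not> rval (E(''a'' := i)) s3 (scalar ''mx'') < rval (E(''a'' := i)) s3 (Cell ''C'' (IVar ''a''))"
      then show "runs (E(''a'' := i)) Skip s3 0 ?K" using s3 by (intro runs_Skip) (simp add: C3)
    qed auto
    then have a: "runs (E(''a'' := i)) ?mx s3 1 ?K" by (rule runs_mono) (simp, assumption)
    have "runs (E(''a'' := i)) ?mn s4 (Suc (rcost (Cell ''C'' (IVar ''a'')) + rcost (scalar ''mn'')) + 0) (?J (Suc i))"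
      if s4: "?K s4" for s4
    proof (rule runs_If)
      have C4: "s4 ''C'' = ?c" using s4 by (simp add: same_except_def)
      {
        assume lt: "rval (E(''a'' := i)) s4 (Cell ''C'' (IVar ''a'')) < rval (E(''a'' := i)) s4 (scalar ''mn'')"
        then show "runs (E(''a'' := i)) (set_scalar ''mn'' (Cell ''C'' (IVar ''a''))) s4 0 (?J (Suc i))"
          using s4 i by (intro runs_Assign)
            (auto simp: C4 same_except_update less_Suc_eq intro: order.trans less_imp_le)
      next
        assume "\<not> rval (E(''a'' := i)) s4 (Cell ''C'' (IVar ''a'')) < rval (E(''a'' := i)) s4 (scalar ''mn'')"
        then show "runs (E(''a'' := i)) Skip s4 0 (?J (Suc i))"
          using s4 by (intro runs_Skip) (auto simp: C4 less_Suc_eq)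
      }
    qed auto
    then have b: "runs (E(''a'' := i)) ?mn s4 1 (?J (Suc i))" if "?K s4" for s4
      using that by (metis (no_types, lifting) One_nat_def add_0_right rcost.simps(1))
    show "runs (E(''a'' := i)) (Seq ?mx ?mn) s3 (1 + 1) (?J (Suc i))" by (rule runs_Seq[OF a b])
  qed (use s2 in \<open>simp_all add: E\<close>)
  have "runs E range_prog s (0 + (0 + ival E entries * (1 + 1))) (?J (n ^ d))"
    unfolding range_prog_def by (rule runs_Seq[OF 1]) (rule runs_Seq[OF 2 3])
  then show ?thesis
  proof (rule runs_mono)
    have im: "C ` multi_indices n d = ?c ` {..<n ^ d}"
    proof -
      have "C ` multi_indices n d = (\<lambda>i. ?c (address n d i)) ` multi_indices n d"
        using C by (intro image_cong) (auto simp: stored_tensor_def)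
      also have "\<dots> = ?c ` (address n d ` multi_indices n d)" by (simp add: image_image)
      finally show ?thesis using bij_betw_address[of n d] by (simp add: bij_betw_def)
    qed
    fix s' assume s': "?J (n ^ d) s'"
    have "Max (C ` multi_indices n d) = s' ''mx'' 0"
      unfolding im using s' by (intro Max_eqI) auto
    moreover have "Min (C ` multi_indices n d) = s' ''mn'' 0"
      unfolding im using s' by (intro Min_eqI) auto
    ultimately show "same_except ?X s s' \<and> s' ''mx'' 0 - s' ''mn'' 0 = entry_range n d C"
      using s' by (simp add: entry_range_def)
  qed (simp add: E)
qed

text \<open>Dividing by \<open>Z\<close> gives total mass 1, as required by
  \<open>scaled_kernel\<close>. The minus sign in the exponent is a subtraction from 0, since the
  machine has no negation.\<close>

definition kernel_prog :: com where
  "kernel_prog = Seq (set_scalar ''eta'' (Divide (Mul (OfIndex (IMul (INum 2) (IVar ''d''))) (Log (OfIndex (IVar ''n'')))) (scalar ''delta'')))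
     (Seq (set_scalar ''eps'' (Divide (scalar ''delta'') (Mul (OfIndex (IMul (INum 8) (IVar ''d''))) (Sub (scalar ''mx'') (scalar ''mn'')))))
     (Seq (set_scalar ''Z'' (OfIndex (INum 0)))
     (Seq (For ''a'' entries (Assign ''B'' (IVar ''a'')
       (Exp (Sub (OfIndex (INum 0)) (Mul (scalar ''eta'') (Cell ''C'' (IVar ''a'')))))))
     (Seq (For ''a'' entries (set_scalar ''Z'' (Add (scalar ''Z'') (Cell ''B'' (IVar ''a'')))))
       (For ''a'' entries (Assign ''B'' (IVar ''a'') (Divide (Cell ''B'' (IVar ''a'')) (scalar ''Z''))))))))"

lemma runs_kernel_prog:
  fixes n d s
  defines "\<delta> \<equiv> s ''delta'' 0"
  defines "\<eta> \<equiv> 2 * real d * ln (real n) / \<delta>"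
  assumes E: "E ''n'' = n" "E ''d'' = d" and n: "1 \<le> n" and d: "1 \<le> d"
    and C: "\<And>i. i \<in> multi_indices n d \<Longrightarrow> stored_tensor n d s ''C'' i = C i"
    and pos: "0 < \<delta>" "0 < s ''mx'' 0 - s ''mn'' 0"
  shows "runs E kernel_prog s (3 + (3 + (0 + (n ^ d * 3 + (n ^ d * 1 + n ^ d * 1)))))
    (\<lambda>s'. same_except {''eta'', ''eps'', ''Z'', ''B''} s s' \<and>
      s' ''eps'' 0 = \<delta> / (8 * real d * (s ''mx'' 0 - s ''mn'' 0)) \<and>
      (\<forall>i\<in>multi_indices n d. stored_tensor n d s' ''B'' i =
         exp (- \<eta> * C i) / (\<Sum>i\<in>multi_indices n d. exp (- \<eta> * C i))))"
    (is "runs E _ s _ ?Q")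
proof -
  let ?c = "s ''C''" and ?\<epsilon> = "\<delta> / (8 * real d * (s ''mx'' 0 - s ''mn'' 0))"
  let ?X = "{''eta'', ''eps'', ''Z'', ''B''}"
  let ?Z = "\<Sum>a<n ^ d. exp (- \<eta> * ?c a)"
  \<comment> \<open>The program sums over addresses, the Gibbs kernel over multi-indices.\<close>
  have Z: "?Z = (\<Sum>i\<in>multi_indices n d. exp (- \<eta> * C i))"
    unfolding sum_address[symmetric] by (intro sum.cong) (use C in \<open>auto simp: stored_tensor_def\<close>)
  have "0 < n ^ d" using n by simp
  then have Z0: "0 < ?Z" by (intro sum_pos) (simp_all add: lessThan_empty_iff)
  have 1: "runs E (set_scalar ''eta'' (Divide (Mul (OfIndex (IMul (INum 2) (IVar ''d''))) (Log (OfIndex (IVar ''n'')))) (scalar ''delta''))) s 3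
      (\<lambda>s1. same_except ?X s s1 \<and> s1 ''eta'' 0 = \<eta>)"
    using n pos by (intro runs_Assign) (auto simp: E \<eta>_def \<delta>_def same_except_update same_except_refl)
  have 2: "runs E (set_scalar ''eps'' (Divide (scalar ''delta'') (Mul (OfIndex (IMul (INum 8) (IVar ''d''))) (Sub (scalar ''mx'') (scalar ''mn''))))) s1 3
      (\<lambda>s2. same_except ?X s s2 \<and> s2 ''eta'' 0 = \<eta> \<and> s2 ''eps'' 0 = ?\<epsilon>)"
    if s1: "same_except ?X s s1 \<and> s1 ''eta'' 0 = \<eta>" for s1
  proof -
    have eq: "s1 ''delta'' = s ''delta''" "s1 ''mx'' = s ''mx''" "s1 ''mn'' = s ''mn''"
      using s1 by (simp_all add: same_except_def)
    show ?thesis using s1 d pos by (intro runs_Assign) (auto simp: E \<delta>_def eq same_except_update)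
  qed
  have 3: "runs E (set_scalar ''Z'' (OfIndex (INum 0))) s2 0
      (\<lambda>s3. same_except ?X s s3 \<and> s3 ''eta'' 0 = \<eta> \<and> s3 ''eps'' 0 = ?\<epsilon> \<and> s3 ''Z'' 0 = 0)"
    if s2: "same_except ?X s s2 \<and> s2 ''eta'' 0 = \<eta> \<and> s2 ''eps'' 0 = ?\<epsilon>" for s2
    using s2 by (intro runs_Assign) (auto simp: same_except_update)
  have 4: "runs E (For ''a'' entries (Assign ''B'' (IVar ''a'')
       (Exp (Sub (OfIndex (INum 0)) (Mul (scalar ''eta'') (Cell ''C'' (IVar ''a''))))))) s3 (n ^ d * 3)
      (\<lambda>s4. same_except ?X s s4 \<and> s4 ''eps'' 0 = ?\<epsilon> \<and> s4 ''Z'' 0 = 0 \<and>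
        (\<forall>a<n ^ d. s4 ''B'' a = exp (- \<eta> * ?c a)))"
    if s3: "same_except ?X s s3 \<and> s3 ''eta'' 0 = \<eta> \<and> s3 ''eps'' 0 = ?\<epsilon> \<and> s3 ''Z'' 0 = 0" for s3
  proof -
    have C3: "s3 ''C'' = ?c" using s3 by (simp add: same_except_def)
    have "runs E (For ''a'' entries (Assign ''B'' (IVar ''a'')
       (Exp (Sub (OfIndex (INum 0)) (Mul (scalar ''eta'') (Cell ''C'' (IVar ''a''))))))) s3 (ival E entries * 3)
      (\<lambda>s'. \<exists>h. s' = s3(''B'' := h) \<and> (\<forall>a<ival E entries. h a = exp (- \<eta> * ?c a)))"
      by (rule runs_For_map; rule runs_Assign) (use s3 in \<open>simp_all add: C3\<close>)
    then show ?thesis by (rule runs_mono) (use s3 in \<open>auto simp: E same_except_update\<close>)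
  qed
  have 5: "runs E (For ''a'' entries (set_scalar ''Z'' (Add (scalar ''Z'') (Cell ''B'' (IVar ''a''))))) s4 (n ^ d * 1)
      (\<lambda>s5. same_except ?X s s5 \<and> s5 ''eps'' 0 = ?\<epsilon> \<and> s5 ''Z'' 0 = ?Z \<and>
        (\<forall>a<n ^ d. s5 ''B'' a = exp (- \<eta> * ?c a)))"
    if s4: "same_except ?X s s4 \<and> s4 ''eps'' 0 = ?\<epsilon> \<and> s4 ''Z'' 0 = 0 \<and>
        (\<forall>a<n ^ d. s4 ''B'' a = exp (- \<eta> * ?c a))" for s4
  proof -
    have "runs E (For ''a'' entries (set_scalar ''Z'' (Add (scalar ''Z'') (Cell ''B'' (IVar ''a''))))) s4
      (ival E entries * 1) (\<lambda>s'. \<exists>h. s' = s4(''Z'' := h) \<and>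
        h 0 = s4 ''Z'' 0 + (\<Sum>a<ival E entries. s4 ''B'' a))"
      by (rule runs_For_accumulate; rule runs_Assign) simp_all
    then show ?thesis
      by (rule runs_mono) (use s4 in \<open>auto simp: E same_except_update\<close>)
  qed
  have 6: "runs E (For ''a'' entries (Assign ''B'' (IVar ''a'') (Divide (Cell ''B'' (IVar ''a'')) (scalar ''Z'')))) s5 (n ^ d * 1) ?Q"
    if s5: "same_except ?X s s5 \<and> s5 ''eps'' 0 = ?\<epsilon> \<and> s5 ''Z'' 0 = ?Z \<and>
        (\<forall>a<n ^ d. s5 ''B'' a = exp (- \<eta> * ?c a))" for s5
  proof -
    have Z5: "s5 ''Z'' 0 = ?Z" "?Z \<noteq> 0" using s5 Z0 by auto
    have "runs E (For ''a'' entries (Assign ''B'' (IVar ''a'') (Divide (Cell ''B'' (IVar ''a'')) (scalar ''Z'')))) s5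
      (ival E entries * 1) (\<lambda>s'. \<exists>h. s' = s5(''B'' := h) \<and> (\<forall>a<ival E entries. h a = exp (- \<eta> * ?c a) / ?Z))"
    proof (rule runs_For_map)
      fix a h assume a: "a < ival E entries" and h: "\<And>b. a \<le> b \<Longrightarrow> h b = s5 ''B'' b"
      have "h a = exp (- \<eta> * ?c a)" using h[of a] s5 a by (simp add: E)
      then show "runs (E(''a'' := a)) (Assign ''B'' (IVar ''a'') (Divide (Cell ''B'' (IVar ''a'')) (scalar ''Z'')))
        (s5(''B'' := h)) 1 (\<lambda>s'. s' = s5(''B'' := h(a := exp (- \<eta> * ?c a) / ?Z)))"
        using Z5 by (intro runs_Assign) simp_all
    qed
    then show ?thesis
    proof (rule runs_mono, simp add: E, elim exE conjE)
      fix s6 h assume h: "s6 = s5(''B'' := h)" "\<forall>a<ival E entries. h a = exp (- \<eta> * ?c a) / ?Z"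
      have "stored_tensor n d s6 ''B'' i = exp (- \<eta> * C i) / ?Z" if i: "i \<in> multi_indices n d" for i
        using h address_less[OF i] C[OF i] by (simp add: stored_tensor_def E)
      then show "?Q s6" using s5 unfolding Z by (simp add: h(1) same_except_update)
    qed
  qed
  show ?thesis
    unfolding kernel_prog_def
    by (rule runs_Seq[OF 1 runs_Seq[OF 2 runs_Seq[OF 3 runs_Seq[OF 4 runs_Seq[OF 5 6]]]]])
qed

section \<open>Choice of parameters and total cost\<close>

definition tot_prog :: com where
  "tot_prog = Seq range_prog (IfLess (scalar ''delta'') (Sub (scalar ''mx'') (scalar ''mn''))
     (Seq kernel_prog (Seq sinkhorn round_prog)) (product_prog ''P'' ''B''))"

text \<open>\<open>T\<close> is the initial distance of the potential from 0 divided by the gain per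
  sweep, and \<open>N\<close> is the next larger integer. With
  \<open>q = \<omega> / \<delta>\<close>, \<open>T\<close> equals
  \<open>256 d^3 q^2 (2 q + 1) ln n\<close>.\<close>

lemma sweep_count:
  fixes \<omega> \<delta> :: real and n d :: nat
  defines "\<eta> \<equiv> 2 * real d * ln (real n) / \<delta>" and "\<epsilon> \<equiv> \<delta> / (8 * real d * \<omega>)"
  assumes n: "2 \<le> n" and d: "1 \<le> d" and dw: "0 < \<delta>" "\<delta> < \<omega>"
  shows "\<exists>N\<ge>1. \<eta> * \<omega> + real d * ln (real n) < real N * (\<epsilon>\<^sup>2 / 4) \<and>
    real (N * (d * n ^ d)) \<le> 770 * bound_term n d \<omega> \<delta>"
proof -
  let ?L = "ln (real n)" and ?q = "\<omega> / \<delta>"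
  define T where "T = (\<eta> * \<omega> + real d * ?L) / (\<epsilon>\<^sup>2 / 4)"
  define R where "R = real d ^ 3 * ?q ^ 3 * ?L"
  have pos: "0 < \<omega>" "1 \<le> ?q" "0 < ?L" "1 \<le> real d" using n d dw by auto
  have eps: "0 < \<epsilon>\<^sup>2 / 4" using pos dw by (simp add: \<epsilon>_def)
  have "\<eta> * \<omega> + real d * ?L = real d * ?L * (2 * ?q + 1)"
    by (simp add: \<eta>_def algebra_simps)
  moreover have "\<epsilon>\<^sup>2 / 4 = 1 / (256 * real d ^ 2 * ?q ^ 2)"
    using pos dw by (simp add: \<epsilon>_def power_mult_distrib power_divide)
  ultimately have T: "T = real d * ?L * (2 * ?q + 1) * (256 * real d ^ 2 * ?q ^ 2)"
    by (simp add: T_def)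
  \<comment> \<open>From \<open>1 <= q\<close> one gets \<open>2 q + 1 <= 3 q\<close>, whence 768 =
    3 * 256.\<close>
  also have "\<dots> \<le> real d * ?L * (3 * ?q) * (256 * real d ^ 2 * ?q ^ 2)"
    using pos by (intro mult_right_mono mult_left_mono) auto
  also have "\<dots> = 768 * R" by (simp add: R_def power3_eq_cube power2_eq_square mult_ac)
  finally have T_le: "T \<le> 768 * R" .
  have T0: "0 \<le> T" unfolding T using pos by simp
  \<comment> \<open>\<open>R\<close> is at least 1/2, so the 1 lost in passing from \<open>T\<close>
    to \<open>N\<close> is absorbed by \<open>2 * R\<close>; this gives 770.\<close>
  have "ln 2 \<le> ?L" using n by simp
  then have "1 / 2 \<le> ?L" using ln2_ge_two_thirds by linarith
  moreover have "1 \<le> real d ^ 3 * ?q ^ 3"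
    using mult_mono[of 1 "real d ^ 3" 1 "?q ^ 3"] one_le_power[OF pos(4), of 3] one_le_power[OF pos(2), of 3]
    by simp
  ultimately have "1 * (1 / 2) \<le> R" unfolding R_def by (intro mult_mono) auto
  define N where "N = Suc (nat \<lfloor>T\<rfloor>)"
  have N: "T < real N" "real N \<le> T + 1" unfolding N_def using T0 by linarith+
  have "real N \<le> 770 * R" using N(2) T_le \<open>1 * (1 / 2) \<le> R\<close> by linarith
  then have "real N * (real d * real n ^ d) \<le> (770 * R) * (real d * real n ^ d)"
    by (rule mult_right_mono) simp
  also have "\<dots> = 770 * (real d ^ 4 * ?q ^ 3 * ?L * (real n ^ d * 1))"
    by (simp add: R_def power3_eq_cube power4_eq_xxxx)
  \<comment> \<open>A sweep costs a multiple of \<open>d * n ^ d\<close>; the bound to be met leaves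
    room for one more factor \<open>n\<close>.\<close>
  also have "\<dots> \<le> 770 * (real d ^ 4 * ?q ^ 3 * ?L * (real n ^ d * real n))"
    using n pos by (intro mult_left_mono) auto
  also have "\<dots> = 770 * bound_term n d \<omega> \<delta>" by (simp add: bound_term_def power_divide)
  finally have "real (N * (d * n ^ d)) \<le> 770 * bound_term n d \<omega> \<delta>" by simp
  moreover have "\<eta> * \<omega> + real d * ?L < real N * (\<epsilon>\<^sup>2 / 4)"
    using N(1) eps by (simp add: T_def pos_divide_less_eq)
  moreover have "1 \<le> N" by (simp add: N_def)
  ultimately show ?thesis by blast
qed

lemma runs_tot_prog:
  assumes n: "1 \<le> n" and d: "1 \<le> d" and P: "\<And>j. j < d \<Longrightarrow> P j \<in> positive_prob_vectors n"
    and delta: "0 < \<delta>" and s: "holds_input n d P C \<delta> s"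
  shows "\<exists>b. runs (size_env n d) tot_prog s b (\<lambda>s'. stored_tensor n d s' ''B'' \<in> transport_polytope n d P \<and>
       tensor_inner n d C (stored_tensor n d s' ''B'') \<le> tot_value n d C P + \<delta>) \<and>
     real b \<le> 50000 * (bound_term n d (entry_range n d C) \<delta> + real (input_size n d))"
    (is "\<exists>b. runs ?E _ s b ?Q \<and> _")
proof -
  define \<omega> where "\<omega> = entry_range n d C"
  let ?I = "multi_indices n d" and ?st = "\<lambda>s. stored_tensor n d s ''B''" and ?X = "n ^ d"
  have E: "?E ''n'' = n" "?E ''d'' = d" by (simp_all add: size_env_def)
  have C: "\<And>i. i \<in> ?I \<Longrightarrow> stored_tensor n d s ''C'' i = C i" using s by (simp add: holds_input_def)
  \<comment> \<open>Feasibility and objective depend only on the values at multi-indices, which is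
    where the store is known to agree with \<open>V\<close>.\<close>
  have transfer: "?Q s'" if V: "\<And>i. i \<in> ?I \<Longrightarrow> ?st s' i = V i" "V \<in> transport_polytope n d P"
      "tensor_inner n d C V \<le> tot_value n d C P + \<delta>" for s' V
  proof -
    have "tensor_inner n d C (?st s') = tensor_inner n d C V"
      unfolding tensor_inner_def using V(1) by (intro sum.cong) auto
    moreover have "marginal n d (?st s') = marginal n d V" using V(1) by (rule marginal_cong)
    ultimately show ?thesis using V by (simp add: transport_polytope_def)
  qed
  have w0: "0 \<le> \<omega>" unfolding \<omega>_def by (rule entry_range_nonneg[OF n])
  have bt0: "0 \<le> bound_term n d \<omega> \<delta>" using w0 n delta by (simp add: bound_term_def)
  let ?body = "IfLess (scalar ''delta'') (Sub (scalar ''mx'') (scalar ''mn''))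
     (Seq kernel_prog (Seq sinkhorn round_prog)) (product_prog ''P'' ''B'')"
  \<comment> \<open>The common prefix of both branches: two comparisons per entry for the range,
    then one subtraction and one comparison. The branch is now decided by \<open>\<delta>\<close>
    and \<open>\<omega>\<close> themselves, and \<open>b\<close> is its budget.\<close>
  have main: "\<exists>b. runs ?E tot_prog s b ?Q \<and> real b \<le> 50000 * (bound_term n d \<omega> \<delta> + real (input_size n d))"
    if b: "\<And>s1. same_except {''mx'', ''mn''} s s1 \<Longrightarrow> s1 ''mx'' 0 - s1 ''mn'' 0 = \<omega> \<Longrightarrow>
        runs ?E (if \<delta> < \<omega> then Seq kernel_prog (Seq sinkhorn round_prog) else product_prog ''P'' ''B'') s1 b ?Q"
      and b_le: "real (?X * 2 + 2 + b) \<le> 50000 * (bound_term n d \<omega> \<delta> + real (input_size n d))" for b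
  proof -
    have "runs ?E tot_prog s (?X * 2 + (Suc (rcost (scalar ''delta'') + rcost (Sub (scalar ''mx'') (scalar ''mn''))) + b)) ?Q"
      unfolding tot_prog_def
    proof (rule runs_Seq[OF runs_range_prog[OF E n C]], assumption)
      fix s1 assume s1: "same_except {''mx'', ''mn''} s s1 \<and> s1 ''mx'' 0 - s1 ''mn'' 0 = entry_range n d C"
      have "s1 ''delta'' 0 = \<delta>" using s s1 by (simp add: holds_input_def same_except_def)
      then show "runs ?E ?body s1 (Suc (rcost (scalar ''delta'') + rcost (Sub (scalar ''mx'') (scalar ''mn''))) + b) ?Q"
        using b[of s1] s1 by (intro runs_If) (simp_all add: \<omega>_def)
    qed
    then show ?thesis using b_le by (intro exI[of _ "?X * 2 + 2 + b"]) (simp add: add.assoc)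
  qed
  have "\<exists>b. runs ?E tot_prog s b ?Q \<and> real b \<le> 50000 * (bound_term n d \<omega> \<delta> + real (input_size n d))"
  proof (cases "\<delta> < \<omega>")
    case False
    let ?V = "\<lambda>i. \<Prod>l<d. P l (i l)"
    have V: "?V \<in> transport_polytope n d P" using P by (rule transport_polytope_nonempty)
    have opt: "tensor_inner n d C ?V \<le> tot_value n d C P + \<delta>"
      using polytope_near_optimal[OF n d P V, of C] False by (simp add: \<omega>_def)
    have PB: "''P'' \<noteq> ''B''" by simp
    show ?thesis
    proof (rule main)
      fix s1 assume s1: "same_except {''mx'', ''mn''} s s1"
      have "runs ?E (product_prog ''P'' ''B'') s1 (2 * (?X + d * n)) ?Q"
      proof (rule runs_mono[OF runs_product_prog[OF E n PB] order_refl], elim exE conjE)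
        fix s2 h assume h: "s2 = s1(''B'' := h)"
          "\<forall>a<?X. h a = (\<Prod>l<d. s1 ''P'' (l * n + a div n ^ l mod n))"
        have "?st s2 i = ?V i" if i: "i \<in> ?I" for i
          using h(2) s s1 address_less[OF i] multi_indices_less[OF i]
          by (auto simp: h(1) stored_tensor_def digit_address[OF i] holds_input_def same_except_def
              intro!: prod.cong)
        then show "?Q s2" using V opt by (rule transfer)
      qed
      then show "runs ?E (if \<delta> < \<omega> then Seq kernel_prog (Seq sinkhorn round_prog) else product_prog ''P'' ''B'')
        s1 (2 * (?X + d * n)) ?Q" using False by simp
    next
      \<comment> \<open>In this case \<open>bound_term\<close> may vanish, so the whole cost is
        charged to the input size.\<close>
      have "1 \<le> ?X" using n by simp
      then have "?X * 2 + 2 + 2 * (?X + d * n) \<le> 50000 * input_size n d"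
        unfolding input_size_def distrib_left by linarith
      then have "real (?X * 2 + 2 + 2 * (?X + d * n)) \<le> real (50000 * input_size n d)" by (rule of_nat_mono)
      then show "real (?X * 2 + 2 + 2 * (?X + d * n)) \<le> 50000 * (bound_term n d \<omega> \<delta> + real (input_size n d))"
        using bt0 by simp
    qed
  next
    case True
    \<comment> \<open>A tensor with a single entry has range 0, which is not above
      \<open>\<delta>\<close>. So \<open>ln n\<close>, and with it \<open>\<eta>\<close>, is
      positive.\<close>
    have "n \<noteq> 1"
    proof
      assume n1: "n = 1"
      have "is_singleton ?I" by (simp add: is_singleton_altdef card_multi_indices n1)
      then obtain i where "?I = {i}" by (rule is_singletonE)
      then have "\<omega> = 0" by (simp add: \<omega>_def entry_range_def)
      then show False using True delta by simp
    qed
    then have n2: "2 \<le> n" using n by simp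
    define \<eta> where "\<eta> = 2 * real d * ln (real n) / \<delta>"
    define \<epsilon> where "\<epsilon> = \<delta> / (8 * real d * \<omega>)"
    have wpos: "0 < \<omega>" using True delta by simp
    have lnpos: "0 < ln (real n)" using n2 by simp
    have eta: "0 < \<eta>" using d delta lnpos by (simp add: \<eta>_def)
    have eps: "0 < \<epsilon>" using d delta wpos by (simp add: \<epsilon>_def)
    obtain N where N: "1 \<le> N" "\<eta> * \<omega> + real d * ln (real n) < real N * (\<epsilon>\<^sup>2 / 4)"
      "real (N * (d * ?X)) \<le> 770 * bound_term n d \<omega> \<delta>"
      using sweep_count[OF n2 d delta True] unfolding \<eta>_def \<epsilon>_def by blast
    \<comment> \<open>The reference tensor of the potential argument is an arbitrary member of the
      polytope and appears only in the analysis.\<close>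
    obtain U where U: "U \<in> transport_polytope n d P"
      using transport_polytope_nonempty[where d = d and n = n and P = P] P by blast
    have P1: "(\<Sum>k<n. P 0 k) = 1" using P[of 0] d by (simp add: positive_prob_vectors_def)
    have U1: "(\<Sum>i\<in>?I. U i) = 1"
      using U d P1 sum_marginal[of 0 d n U] by (simp add: transport_polytope_def)
    let ?c1 = "3 + (3 + (0 + (?X * 3 + (?X * 1 + ?X * 1))))"
    let ?c2 = "N * (1 + d * (7 * ?X)) + 1"
    let ?c3 = "4 * d * ?X + (0 + (?X + (1 + (d * (?X + n * 2) + (2 * (?X + d * n) + ?X * 2)))))"
    show ?thesis
    proof (rule main)
      fix s1 assume s1: "same_except {''mx'', ''mn''} s s1" and w1: "s1 ''mx'' 0 - s1 ''mn'' 0 = \<omega>"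
      have C1: "\<And>i. i \<in> ?I \<Longrightarrow> stored_tensor n d s1 ''C'' i = C i"
        using C s1 by (simp add: stored_tensor_def same_except_def)
      have Pm1: "holds_marginals n d P s1"
        using s s1 by (simp add: holds_marginals_def holds_input_def same_except_def)
      have d1: "s1 ''delta'' 0 = \<delta>" using s s1 by (simp add: holds_input_def same_except_def)
      have 1: "runs ?E kernel_prog s1 ?c1
        (\<lambda>s'. same_except {''eta'', ''eps'', ''Z'', ''B''} s1 s' \<and> s' ''eps'' 0 = \<epsilon> \<and>
          (\<forall>i\<in>?I. ?st s' i = exp (- \<eta> * C i) / (\<Sum>i\<in>?I. exp (- \<eta> * C i))))"
        using runs_kernel_prog[where s = s1 and C = C, OF E n d C1] delta wpos
        unfolding d1 w1 \<eta>_def \<epsilon>_def by blast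
      have "runs ?E (Seq kernel_prog (Seq sinkhorn round_prog)) s1 (?c1 + (?c2 + ?c3)) ?Q"
      proof (rule runs_Seq[OF 1], elim conjE)
        fix s2 let ?K = "\<lambda>i. exp (- \<eta> * C i) / (\<Sum>i\<in>?I. exp (- \<eta> * C i))"
        assume s2: "same_except {''eta'', ''eps'', ''Z'', ''B''} s1 s2" "s2 ''eps'' 0 = \<epsilon>"
          "\<forall>i\<in>?I. ?st s2 i = ?K i"
        note gibbs = gibbs_kernel[where C = C, OF n d less_imp_le[OF eta]]
        have K2: "scaled_kernel n d C \<eta> (?st s2)"
          using gibbs(2) s2(3) scaled_kernel_cong[of n d "?st s2" ?K] by simp
        have "log_potential n d U (?st s2) = log_potential n d U ?K"
          using s2(3) by (intro log_potential_cong) simp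
        then have L: "- log_potential n d U (?st s2) < real N * ((s2 ''eps'' 0)\<^sup>2 / 4)"
          using gibbs(3)[of U] U U1 N(2) by (simp add: transport_polytope_def s2(2) \<omega>_def)
        have Pm2: "holds_marginals n d P s2" using Pm1 s2(1) by (simp add: holds_marginals_def same_except_def)
        have eps2: "0 < s2 ''eps'' 0" using eps s2(2) by simp
        show "runs ?E (Seq sinkhorn round_prog) s2 (?c2 + ?c3) ?Q"
        proof (rule runs_Seq[OF runs_sinkhorn[OF E n Pm2 P K2 U eps2 L]], assumption, elim conjE)
          fix s3 assume s3: "same_except {''B'', ''M'', ''err'', ''flag''} s2 s3"
            "scaled_kernel n d C \<eta> (?st s3)" "\<forall>j<d. mode_error n d P (?st s3) j \<le> s2 ''eps'' 0"
          have Pm3: "holds_marginals n d P s3" using Pm2 s3(1) by (simp add: holds_marginals_def same_except_def)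
          show "runs ?E round_prog s3 ?c3 ?Q"
          proof (rule runs_mono[OF runs_round_prog[OF E n Pm3 P] order_refl], assumption)
            fix s4 assume s4: "\<forall>i\<in>?I. ?st s4 i = rounded n d P (?st s3) i"
            have err: "mode_error n d P (?st s3) j \<le> \<epsilon>" if "j < d" for j using s3(3) s2(2) that by simp
            note opt = rounded_near_optimal[OF n d P s3(2) eta err]
            have "4 * real d * \<epsilon> * entry_range n d C = \<delta> / 2"
              using d wpos by (simp add: \<epsilon>_def \<omega>_def[symmetric])
            moreover have "real d * ln (real n) / \<eta> = \<delta> / 2"
              using d lnpos delta by (simp add: \<eta>_def)
            ultimately have "tensor_inner n d C (rounded n d P (?st s3)) \<le> tot_value n d C P + \<delta>"
              using opt(2) by linarith
            with opt(1) show "?Q s4" using s4 by (intro transfer) auto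
          qed
        qed
      qed
      then show "runs ?E (if \<delta> < \<omega> then Seq kernel_prog (Seq sinkhorn round_prog) else product_prog ''P'' ''B'')
        s1 (?c1 + (?c2 + ?c3)) ?Q" using True by simp
    next
      let ?Y = "N * (d * ?X)"
      have "n \<le> ?X" using self_le_power[of n d] n d by simp
      then have dn: "d * n \<le> d * ?X" by simp
      have X1: "1 \<le> ?X" using n by simp
      have dX: "1 \<le> d * ?X" "?X \<le> d * ?X" using d X1 mult_le_mono[OF d X1] by simp_all
      have Y: "d * ?X \<le> ?Y" "N \<le> ?Y" using N(1) dX by simp_all
      have "?c2 = N + 7 * ?Y + 1" "?c3 = 5 * (d * ?X) + 5 * ?X + 4 * (d * n) + 1"
        by (simp_all add: algebra_simps)
      \<comment> \<open>Each of 1, \<open>N\<close>, \<open>?X\<close>, \<open>d * n\<close> and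
        \<open>d * ?X\<close> is at most \<open>?Y\<close>, and the coefficients add up to 39.
        Together with 770 from \<open>sweep_count\<close>, the rounded value 60 gives 46200, below
        50000.\<close>
      then have "?X * 2 + 2 + (?c1 + (?c2 + ?c3)) \<le> 60 * ?Y" using Y dX dn X1 by linarith
      then have "real (?X * 2 + 2 + (?c1 + (?c2 + ?c3))) \<le> real (60 * ?Y)" by (rule of_nat_mono)
      also have "\<dots> \<le> 60 * (770 * bound_term n d \<omega> \<delta>)" using N(3) by simp
      also have "\<dots> \<le> 50000 * (bound_term n d \<omega> \<delta> + real (input_size n d))" using bt0 by simp
      finally show "real (?X * 2 + 2 + (?c1 + (?c2 + ?c3))) \<le>
        50000 * (bound_term n d \<omega> \<delta> + real (input_size n d))" .
    qed
  qed
  then show ?thesis unfolding \<omega>_def .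
qed

theorem corollary3p8:
  shows "\<exists>(prog :: com) (K :: real). \<forall>(n :: nat) (d :: nat) (P :: nat \<Rightarrow> nat \<Rightarrow> real) (C :: tensor) (\<delta> :: real) (s :: store).
    1 \<le> n \<and> 1 \<le> d \<and> (\<forall>j<d. P j \<in> positive_prob_vectors n) \<and> 0 < \<delta> \<and> holds_input n d P C \<delta> s \<longrightarrow>
    (\<exists>t s'. exec (size_env n d) prog s t s' \<and>
       real t \<le> K * (bound_term n d (entry_range n d C) \<delta> + real (input_size n d)) \<and>
       stored_tensor n d s' ''B'' \<in> transport_polytope n d P \<and>
       tensor_inner n d C (stored_tensor n d s' ''B'') \<le> tot_value n d C P + \<delta>)"
proof (intro exI[of _ tot_prog] exI[of _ "50000::real"] allI impI, elim conjE)
  fix n d :: nat and P :: "nat \<Rightarrow> nat \<Rightarrow> real" and C :: tensor and \<delta> :: real and s :: store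
  assume A: "1 \<le> n" "1 \<le> d" "\<forall>j<d. P j \<in> positive_prob_vectors n" "0 < \<delta>" "holds_input n d P C \<delta> s"
  obtain b where b: "runs (size_env n d) tot_prog s b (\<lambda>s'. stored_tensor n d s' ''B'' \<in> transport_polytope n d P \<and>
       tensor_inner n d C (stored_tensor n d s' ''B'') \<le> tot_value n d C P + \<delta>)"
    "real b \<le> 50000 * (bound_term n d (entry_range n d C) \<delta> + real (input_size n d))"
    using runs_tot_prog[OF A(1,2) _ A(4,5)] A(3) by blast
  then obtain t s' where "exec (size_env n d) tot_prog s t s'" "t \<le> b"
    "stored_tensor n d s' ''B'' \<in> transport_polytope n d P"
    "tensor_inner n d C (stored_tensor n d s' ''B'') \<le> tot_value n d C P + \<delta>"
    unfolding runs_def by blast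
  moreover have "real t \<le> 50000 * (bound_term n d (entry_range n d C) \<delta> + real (input_size n d))"
    using b(2) \<open>t \<le> b\<close> by linarith
  ultimately show "\<exists>t s'. exec (size_env n d) tot_prog s t s' \<and>
       real t \<le> 50000 * (bound_term n d (entry_range n d C) \<delta> + real (input_size n d)) \<and>
       stored_tensor n d s' ''B'' \<in> transport_polytope n d P \<and>
       tensor_inner n d C (stored_tensor n d s' ''B'') \<le> tot_value n d C P + \<delta>" by blast
qed

end
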